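(* Let $\sigma\in W_f^+$. Then $$Cas(\lambda^\sigma)\ge\ell(\sigma),$$ and equality occurs if and only if $\sigma\in W_f^{(2)}$. Furthermore in that case, writing $\sigma=\sigma_\xi$ for $\xi\in\Xi$, one has $$Cas(\lambda^\sigma)=\ell(\sigma)=\dim\mathfrak a_\xi.$$
   Context: Let $\mathfrak g$ be a complex simple Lie algebra of rank $\ell$ with Killing form $(\cdot,\cdot)$, $\mathfrak h$ the real form (real span of the roots) of a Cartan subalgebra, identified with its dual via the Killing form, so that the root system $\Delta\subset\mathfrak h$. Fix positive roots $\Delta_+$, simple roots $\alpha_i$ ($1\le i\le\ell$), highest root $\psi$, $\rho=\frac12\sum_{\varphi\in\Delta_+}\varphi$, $\varphi^\vee=2\varphi/(\varphi,\varphi)$, and let $\mathfrak h^+$ be the closed dominant Weyl chamber. For a dominant integral weight $\lambda$, $Cas(\lambda)=(\lambda+\rho,\lambda+\rho)-(\rho,\rho)$ is the scalar by which the Casimir element (for the Killing form) acts on the irreducible module of highest weight $\lambda$. Affine Weyl group: $W$ is the Weyl group, $\Gamma$ the lattice spanned by the $\alpha_i^\vee$, $W_f=\Gamma\rtimes W$ acting on $\mathfrak h$ by affine transformations. $A_1=\{x\in\mathfrak h^+:(\psi,x)\le1\}$, $A_\sigma=\sigma(A_1)$, $W_f^+=\{\sigma\in W_f:A_\sigma\subset\mathfrak h^+\}$, $W_f^{(2)}=\{\sigma\in W_f^+:A_\sigma\subset2A_1\}$. $\ell(\sigma)$ is the Coxeter length (simple reflections: reflections in the walls of $A_1$), equal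 to the number of hyperplanes $\{x:(\varphi,x)=n\}$, $\varphi\in\Delta_+$, $n\in\mathbb Z$, separating the interiors of $A_1$ and $A_\sigma$. For $\sigma\in W_f^+$, $\lambda^\sigma=\sigma(2\rho)/2-\rho$, a dominant integral weight; the map $\sigma\mapsto\lambda^\sigma$ on $W_f^+$ is injective. Abelian ideals: let $\mathfrak b$ be the Borel subalgebra containing the Cartan subalgebra and the root spaces of all $\varphi\in\Delta_+$. $\Xi$ is an index set for all abelian ideals $\mathfrak a_\xi$ of $\mathfrak b$ (including $0$). $\Delta(\mathfrak a_\xi)\subset\Delta_+$ is the set of roots whose root vectors lie in $\mathfrak a_\xi$, and $\lambda_\xi=\sum_{\varphi\in\Delta(\mathfrak a_\xi)}\varphi$. For each $\xi\in\Xi$ there is a unique $\sigma_\xi\in W_f^+$ with $\lambda_\xi=\lambda^{\sigma_\xi}$, and $\xi\mapsto\sigma_\xi$ is a bijection from $\Xi$ onto $W_f^{(2)}$. *)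

theory Defs
  imports "HOL-Analysis.Analysis"
begin

section \<open>Finite-dimensional complex Lie algebras\<close>

text \<open>The superclass provides the underlying real vector space, so that
  real spans and real linear independence are the library notions.\<close>

class complex_lie_algebra = real_vector +
  fixes scaleC :: "complex \<Rightarrow> 'a \<Rightarrow> 'a"  (infixr \<open>*\<^sub>C\<close> 75)
    and lie :: "'a \<Rightarrow> 'a \<Rightarrow> 'a"
  assumes scaleR_scaleC: "r *\<^sub>R x = complex_of_real r *\<^sub>C x"
    and scaleC_add_right: "a *\<^sub>C (x + y) = a *\<^sub>C x + a *\<^sub>C y"
    and scaleC_add_left: "(a + b) *\<^sub>C x = a *\<^sub>C x + b *\<^sub>C x"
    and scaleC_scaleC: "a *\<^sub>C b *\<^sub>C x = (a * b) *\<^sub>C x"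
    and scaleC_one: "1 *\<^sub>C x = x"
    and finite_dim: "\<exists>B. finite B \<and> (\<forall>x. \<exists>c. x = (\<Sum>b\<in>B. c b *\<^sub>C b))"
    and lie_add_left: "lie (x + y) z = lie x z + lie y z"
    and lie_add_right: "lie x (y + z) = lie x y + lie x z"
    and lie_scaleC_left: "lie (a *\<^sub>C x) y = a *\<^sub>C lie x y"
    and lie_scaleC_right: "lie x (a *\<^sub>C y) = a *\<^sub>C lie x y"
    and lie_self: "lie x x = 0"
    and jacobi: "lie x (lie y z) + lie y (lie z x) + lie z (lie x y) = 0"

global_interpretation cvec: vector_space "scaleC :: complex \<Rightarrow> 'g \<Rightarrow> 'g::complex_lie_algebra"
  by unfold_locales
    (simp_all add: scaleC_add_right scaleC_add_left scaleC_scaleC scaleC_one)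

definition (in complex_lie_algebra) lie_ideal :: "'a set \<Rightarrow> bool" where
  "lie_ideal I \<longleftrightarrow>
     0 \<in> I \<and> (\<forall>x\<in>I. \<forall>y\<in>I. x + y \<in> I) \<and> (\<forall>c. \<forall>x\<in>I. c *\<^sub>C x \<in> I) \<and>
     (\<forall>x. \<forall>y\<in>I. lie x y \<in> I)"

class complex_simple_lie_algebra = complex_lie_algebra +
  assumes nonabelian: "\<exists>x y. lie x y \<noteq> 0"
    and simple: "lie_ideal I \<Longrightarrow> I = {0} \<or> I = UNIV"

text \<open>Trace of an endomorphism, computed in some complex basis of the whole space.\<close>

definition ctrace :: "('g::complex_lie_algebra \<Rightarrow> 'g) \<Rightarrow> complex" where
  "ctrace f =
    (let B = (SOME B. cvec.independent B \<and> cvec.span B = UNIV)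
     in \<Sum>b\<in>B. cvec.representation B (f b) b)"

definition killing :: "'g::complex_lie_algebra \<Rightarrow> 'g \<Rightarrow> complex" where
  "killing x y = ctrace (\<lambda>z. lie x (lie y z))"


section \<open>Cartan subalgebra and roots\<close>

definition abelian_subalgebra :: "'g::complex_lie_algebra set \<Rightarrow> bool" where
  "abelian_subalgebra K \<longleftrightarrow> cvec.subspace K \<and> (\<forall>x\<in>K. \<forall>y\<in>K. lie x y = 0)"

text \<open>The usual definition for semisimple complex Lie algebras: a maximal abelian
  subalgebra whose elements are all ad-diagonalizable.\<close>

definition cartan_subalgebra :: "'g::complex_lie_algebra set \<Rightarrow> bool" where
  "cartan_subalgebra H \<longleftrightarrow>
     abelian_subalgebra H \<and>
     (\<forall>K. abelian_subalgebra K \<and> H \<subseteq> K \<longrightarrow> K = H) \<and>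
     (\<forall>h\<in>H. cvec.span {x. \<exists>c. lie h x = c *\<^sub>C x} = UNIV)"

text \<open>Linear functionals on \<open>H\<close> are identified with elements of \<open>H\<close> through the
  Killing form: \<open>\<phi> \<in> H\<close> stands for the functional \<open>\<lambda>h. killing \<phi> h\<close>.\<close>

definition root_space :: "'g::complex_lie_algebra set \<Rightarrow> 'g \<Rightarrow> 'g set" where
  "root_space H \<phi> = {x. \<forall>h\<in>H. lie h x = killing \<phi> h *\<^sub>C x}"

definition roots :: "'g::complex_lie_algebra set \<Rightarrow> 'g set" where
  "roots H = {\<phi>\<in>H. \<phi> \<noteq> 0 \<and> root_space H \<phi> \<noteq> {0}}"

definition real_form :: "'g::complex_lie_algebra set \<Rightarrow> 'g set" where
  "real_form H = span (roots H)"

text \<open>The Killing form is real (and positive definite) on \<open>real_form H\<close>; \<open>kf\<close> is its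
  real-valued version and is only evaluated there.\<close>

definition kf :: "'g::complex_lie_algebra \<Rightarrow> 'g \<Rightarrow> real" where
  "kf x y = Re (killing x y)"

definition nonneg_comb :: "'g::complex_lie_algebra set \<Rightarrow> 'g set" where
  "nonneg_comb P = {\<Sum>\<alpha>\<in>P. real (n \<alpha>) *\<^sub>R \<alpha> | n :: 'g \<Rightarrow> nat. True}"

definition simple_roots :: "'g::complex_lie_algebra set \<Rightarrow> 'g set \<Rightarrow> bool" where
  "simple_roots H P \<longleftrightarrow> P \<subseteq> roots H \<and> independent P \<and>
     (\<forall>\<phi>\<in>roots H. \<phi> \<in> nonneg_comb P \<or> - \<phi> \<in> nonneg_comb P)"

definition pos_roots :: "'g::complex_lie_algebra set \<Rightarrow> 'g set \<Rightarrow> 'g set" where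
  "pos_roots H P = roots H \<inter> nonneg_comb P"

definition highest_root :: "'g::complex_lie_algebra set \<Rightarrow> 'g set \<Rightarrow> 'g" where
  "highest_root H P = (THE \<psi>. \<psi> \<in> roots H \<and> (\<forall>\<phi>\<in>roots H. \<psi> - \<phi> \<in> nonneg_comb P))"

definition rho :: "'g::complex_lie_algebra set \<Rightarrow> 'g set \<Rightarrow> 'g" where
  "rho H P = (1/2) *\<^sub>R (\<Sum>\<phi>\<in>pos_roots H P. \<phi>)"

definition coroot :: "'g::complex_lie_algebra \<Rightarrow> 'g" where
  "coroot \<phi> = (2 / kf \<phi> \<phi>) *\<^sub>R \<phi>"

definition dominant_chamber :: "'g::complex_lie_algebra set \<Rightarrow> 'g set \<Rightarrow> 'g set" where
  "dominant_chamber H P = {x \<in> real_form H. \<forall>\<alpha>\<in>P. kf \<alpha> x \<ge> 0}"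

definition Cas :: "'g::complex_lie_algebra set \<Rightarrow> 'g set \<Rightarrow> 'g \<Rightarrow> real" where
  "Cas H P v = kf (v + rho H P) (v + rho H P) - kf (rho H P) (rho H P)"


section \<open>The affine Weyl group\<close>

text \<open>The reflection in the hyperplane \<open>{x. (\<phi>, x) = n}\<close>. Weyl group elements are
  represented as complex-affine maps of the whole Lie algebra; their linear parts fix the
  Killing-orthogonal complement of the Cartan subalgebra pointwise, hence such a map is
  determined by its restriction to \<open>real_form H\<close>, and equality of maps is
  equality in the affine Weyl group acting on \<open>real_form H\<close>.\<close>

definition reflection :: "'g::complex_lie_algebra \<Rightarrow> int \<Rightarrow> 'g \<Rightarrow> 'g" where
  "reflection \<phi> n x = x - (killing \<phi> x - of_int n) *\<^sub>C coroot \<phi>"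

text \<open>The product of a word; as reflections are involutions, the products of words in a set
  of reflections form the group it generates.\<close>

definition word_prod :: "('g \<Rightarrow> 'g) list \<Rightarrow> 'g \<Rightarrow> 'g" where
  "word_prod ws = foldr (\<circ>) ws id"

definition weyl_group :: "'g::complex_lie_algebra set \<Rightarrow> ('g \<Rightarrow> 'g) set" where
  "weyl_group H = {word_prod ws | ws. set ws \<subseteq> {reflection \<phi> 0 | \<phi>. \<phi> \<in> roots H}}"

definition coroot_lattice :: "'g::complex_lie_algebra set \<Rightarrow> 'g set" where
  "coroot_lattice P = {\<Sum>\<alpha>\<in>P. real_of_int (n \<alpha>) *\<^sub>R coroot \<alpha> | n :: 'g \<Rightarrow> int. True}"

definition affine_weyl :: "'g::complex_lie_algebra set \<Rightarrow> 'g set \<Rightarrow> ('g \<Rightarrow> 'g) set" where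
  "affine_weyl H P = {(\<lambda>x. \<gamma> + w x) | \<gamma> w. \<gamma> \<in> coroot_lattice P \<and> w \<in> weyl_group H}"

definition fund_alcove :: "'g::complex_lie_algebra set \<Rightarrow> 'g set \<Rightarrow> 'g set" where
  "fund_alcove H P = {x \<in> dominant_chamber H P. kf (highest_root H P) x \<le> 1}"

definition affine_weyl_plus :: "'g::complex_lie_algebra set \<Rightarrow> 'g set \<Rightarrow> ('g \<Rightarrow> 'g) set" where
  "affine_weyl_plus H P =
     {\<sigma> \<in> affine_weyl H P. \<sigma> ` fund_alcove H P \<subseteq> dominant_chamber H P}"

definition affine_weyl_two :: "'g::complex_lie_algebra set \<Rightarrow> 'g set \<Rightarrow> ('g \<Rightarrow> 'g) set" where
  "affine_weyl_two H P =
     {\<sigma> \<in> affine_weyl_plus H P. \<sigma> ` fund_alcove H P \<subseteq> (\<lambda>x. 2 *\<^sub>R x) ` fund_alcove H P}"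

text \<open>The reflections in the walls of the fundamental alcove, and the length with respect
  to them.\<close>

definition simple_reflections :: "'g::complex_lie_algebra set \<Rightarrow> 'g set \<Rightarrow> ('g \<Rightarrow> 'g) set" where
  "simple_reflections H P =
     insert (reflection (highest_root H P) 1) {reflection \<alpha> 0 | \<alpha>. \<alpha> \<in> P}"

definition coxeter_length :: "'g::complex_lie_algebra set \<Rightarrow> 'g set \<Rightarrow> ('g \<Rightarrow> 'g) \<Rightarrow> nat" where
  "coxeter_length H P \<sigma> =
     (LEAST k. \<exists>ws. length ws = k \<and> set ws \<subseteq> simple_reflections H P \<and> word_prod ws = \<sigma>)"

definition weight_of :: "'g::complex_lie_algebra set \<Rightarrow> 'g set \<Rightarrow> ('g \<Rightarrow> 'g) \<Rightarrow> 'g" where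
  "weight_of H P \<sigma> = (1/2) *\<^sub>R \<sigma> (2 *\<^sub>R rho H P) - rho H P"


section \<open>Abelian ideals of the Borel subalgebra\<close>

definition borel_subalgebra :: "'g::complex_lie_algebra set \<Rightarrow> 'g set \<Rightarrow> 'g set" where
  "borel_subalgebra H P = cvec.span (H \<union> (\<Union>\<phi>\<in>pos_roots H P. root_space H \<phi>))"

definition abelian_ideals :: "'g::complex_lie_algebra set \<Rightarrow> 'g set \<Rightarrow> 'g set set" where
  "abelian_ideals H P =
     {A. abelian_subalgebra A \<and> A \<subseteq> borel_subalgebra H P \<and>
         (\<forall>x\<in>borel_subalgebra H P. \<forall>y\<in>A. lie x y \<in> A)}"

definition ideal_roots :: "'g::complex_lie_algebra set \<Rightarrow> 'g set \<Rightarrow> 'g set \<Rightarrow> 'g set" where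
  "ideal_roots H P A = {\<phi> \<in> pos_roots H P. root_space H \<phi> \<subseteq> A}"

definition ideal_weight :: "'g::complex_lie_algebra set \<Rightarrow> 'g set \<Rightarrow> 'g set \<Rightarrow> 'g" where
  "ideal_weight H P A = (\<Sum>\<phi>\<in>ideal_roots H P A. \<phi>)"

definition ideal_elt :: "'g::complex_lie_algebra set \<Rightarrow> 'g set \<Rightarrow> 'g set \<Rightarrow> 'g \<Rightarrow> 'g" where
  "ideal_elt H P A = (THE \<sigma>. \<sigma> \<in> affine_weyl_plus H P \<and> ideal_weight H P A = weight_of H P \<sigma>)"

end

theory Submission
  imports Defs
begin

text \<open>
  For \<open>\<sigma>\<close> in the affine Weyl group put \<open>y = \<sigma>(2\<rho>)\<close>. Since the adjoint representation has
  Casimir eigenvalue one, \<open>(\<psi>, 2\<rho>) = 1 - (\<psi>, \<psi>)\<close>, while \<open>(\<alpha>, 2\<rho>) = (\<alpha>, \<alpha>)\<close> for simple \<open>\<alpha>\<close>.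
  So \<open>2\<rho>\<close> is an interior point of the fundamental alcove, and on it each of the affine
  functions \<open>\<alpha>\<close> and \<open>1 - \<psi>\<close> that define the walls takes the squared length of its own linear
  part. Reflecting \<open>y\<close> in a wall of its alcove therefore moves \<open>y\<close> by exactly twice a root,
  and if that wall is the hyperplane \<open>(\<phi>, x) = k\<close> with \<open>k \<ge> 0\<close>, crossed away from the
  fundamental alcove, then \<open>|y|\<^sup>2\<close> grows by exactly \<open>4k\<close> (lemma \<open>image_two_rho\<close>).

  Walking from the fundamental alcove to \<open>\<sigma>(A\<^sub>1)\<close>, one obtains \<open>\<lambda>\<^sup>\<sigma> = (y - 2\<rho>)/2\<close> as the sum
  of the roots \<open>\<phi>\<close> and \<open>Cas(\<lambda>\<^sup>\<sigma>) = (|y|\<^sup>2 - |2\<rho>|\<^sup>2)/4\<close> as the sum of the levels \<open>k\<close> of the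
  separating hyperplanes (\<open>Cas_weight_of\<close>), while the Coxeter length is their number
  (\<open>coxeter_length_eq\<close>). If \<open>\<sigma>(A\<^sub>1)\<close> is dominant, all levels are at least one, which is the
  inequality; and equality means that all levels equal one, that is, that \<open>\<sigma>(A\<^sub>1)\<close> lies in
  \<open>2A\<^sub>1\<close> (\<open>affine_weyl_two_iff\<close>).

  In the case of equality the hyperplanes are \<open>(\<phi>, x) = 1\<close> for \<open>\<phi>\<close> in a set \<open>\<Phi>\<close> of positive
  roots that is closed under adding positive roots and contains no two elements whose sum is
  a root. These sets are the root sets of the abelian ideals of the Borel subalgebra
  (\<open>abelian_ideal_structure\<close>, \<open>abelian_ideal_of_root_ideal\<close>), and conversely each of them
  belongs to an alcove (\<open>root_ideal_alcove\<close>). The dimension of the ideal is the number of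
  elements of \<open>\<Phi>\<close>.

  The structure theory of the Lie algebra is developed from the definition of a Cartan
  subalgebra. Its engine is the vanishing of the trace of a commutator on an invariant span
  of weight vectors (\<open>sum_weights_invariant_span\<close>). Suitable invariant subspaces give
  nondegeneracy of the Killing form (\<open>killing_nondegenerate\<close>), one-dimensional root spaces
  (\<open>root_multiples\<close>), root strings with their integrality (\<open>root_string\<close>) and nonzero
  brackets of root vectors (\<open>lie_root_vectors_nonzero\<close>), taking the place of Cartan's
  criterion and of the representation theory of \<open>sl\<^sub>2\<close>.
\<close>

section \<open>Traces and the Killing form\<close>

lemma lie_0_left [simp]: "lie 0 x = (0::'g::complex_lie_algebra)"
  using lie_scaleC_left[of 0 0 x] by simp

lemma lie_0_right [simp]: "lie x 0 = (0::'g::complex_lie_algebra)"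
  using lie_scaleC_right[of x 0 0] by simp

lemma lie_minus_right: "lie x (- y) = - lie x (y::'g::complex_lie_algebra)"
  using lie_scaleC_right[of x "-1" y] by (simp add: cvec.scale_minus_left)

lemma lie_diff_right: "lie x (y - z) = lie x y - lie x (z::'g::complex_lie_algebra)"
  using lie_add_right[of x y "-z"] by (simp add: lie_minus_right)

lemma lie_antisym: "lie x y = - lie y (x::'g::complex_lie_algebra)"
proof -
  have "lie (x + y) (x + y) = lie x x + lie x y + (lie y x + lie y y)"
    by (simp only: lie_add_left lie_add_right add.assoc add.left_commute)
  then have "lie y x + lie x y = 0" by (simp add: lie_self add.commute)
  then show ?thesis by (simp add: add_eq_0_iff)
qed

lemma lie_lie_left: "lie (lie x y) z = lie x (lie y z) - lie y (lie x (z::'g::complex_lie_algebra))"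
proof -
  have "lie (lie x y) z = - lie z (lie x y)" by (rule lie_antisym)
  also have "\<dots> = lie x (lie y z) + lie y (lie z x)"
    using jacobi[of x y z] by (simp add: minus_unique add.commute)
  also have "lie y (lie z x) = - lie y (lie x z)"
    by (subst lie_antisym[of z x]) (simp add: lie_minus_right)
  finally show ?thesis by simp
qed

abbreviation clinear :: "('g::complex_lie_algebra \<Rightarrow> 'g) \<Rightarrow> bool" where
  "clinear \<equiv> module_hom scaleC scaleC"

lemma clinearI:
  assumes "\<And>x y. f (x + y) = f x + f y" "\<And>c x. f (c *\<^sub>C x) = c *\<^sub>C f x"
  shows "clinear f"
  by unfold_locales (simp_all add: assms)

lemma clinear_lie: "clinear (lie x)"
  by (intro clinearI lie_add_right lie_scaleC_right)

lemma clinear_comp: "clinear f \<Longrightarrow> clinear g \<Longrightarrow> clinear (\<lambda>x. f (g x))"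
  using module_hom_compose[of scaleC scaleC g scaleC f] by (simp add: o_def)

lemma lie_sum_right: "lie x (sum f I) = (\<Sum>i\<in>I. lie x (f i :: 'g::complex_lie_algebra))"
  by (rule module_hom.sum[OF clinear_lie])

lemma lie_sum_left: "lie (sum f I) x = (\<Sum>i\<in>I. lie (f i :: 'g::complex_lie_algebra) x)"
  by (rule module_hom.sum[of scaleC scaleC "\<lambda>y. lie y x"])
    (intro clinearI lie_add_left lie_scaleC_left)

lemma cfinite_independent:
  assumes "cvec.independent (S :: 'g::complex_lie_algebra set)" shows "finite S"
proof -
  obtain T :: "'g set" where T: "finite T" "\<forall>x. \<exists>c. x = (\<Sum>b\<in>T. c b *\<^sub>C b)"
    using finite_dim by blast
  have "x \<in> cvec.span T" for x
  proof -
    obtain c where "x = (\<Sum>b\<in>T. c b *\<^sub>C b)" using T(2) by blast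
    then show ?thesis by (auto intro: cvec.span_sum cvec.span_scale cvec.span_base)
  qed
  then show ?thesis
    using cvec.independent_span_bound[OF T(1) assms] by blast
qed

text \<open>When \<open>C\<close> spans only a subspace that \<open>f\<close> preserves, this is the trace of the
  restriction of \<open>f\<close>. Traces on proper invariant subspaces drive the structure theory below.\<close>

definition trace_on :: "'g::complex_lie_algebra set \<Rightarrow> ('g \<Rightarrow> 'g) \<Rightarrow> complex" where
  "trace_on C f = (\<Sum>c\<in>C. cvec.representation C (f c) c)"

lemma clinear_image_expand:
  assumes ind: "cvec.independent C" and fin: "finite C"
    and g: "clinear g" and x: "x \<in> cvec.span C"
  shows "g x = (\<Sum>d\<in>C. cvec.representation C x d *\<^sub>C g d)"
proof -
  have "g x = g (\<Sum>d\<in>C. cvec.representation C x d *\<^sub>C d)"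
    using cvec.sum_representation_eq[OF ind x fin] by simp
  then show ?thesis
    by (simp add: module_hom.sum[OF g] module_hom.scale[OF g])
qed

lemma representation_clinear_image:
  assumes ind: "cvec.independent C" and fin: "finite C"
    and g: "clinear g" and x: "x \<in> cvec.span C"
    and E: "cvec.independent E" and gC: "\<And>d. d \<in> C \<Longrightarrow> g d \<in> cvec.span E"
  shows "cvec.representation E (g x) e
    = (\<Sum>d\<in>C. cvec.representation C x d * cvec.representation E (g d) e)"
  unfolding clinear_image_expand[OF ind fin g x]
  by (subst cvec.representation_sum[OF E])
    (auto simp: cvec.representation_scale[OF E] gC cvec.span_scale)

text \<open>Both sides are the double sum of products of matrix entries of \<open>f\<close> and \<open>g\<close>.\<close>

lemma trace_on_commute:
  assumes ind: "cvec.independent C" and f: "clinear f" and g: "clinear g"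
    and fC: "\<And>c. c \<in> C \<Longrightarrow> f c \<in> cvec.span C" and gC: "\<And>c. c \<in> C \<Longrightarrow> g c \<in> cvec.span C"
  shows "trace_on C (\<lambda>x. f (g x)) = trace_on C (\<lambda>x. g (f x))"
proof -
  note fin = cfinite_independent[OF ind]
  have "trace_on C (\<lambda>x. f (g x))
      = (\<Sum>c\<in>C. \<Sum>d\<in>C. cvec.representation C (g c) d * cvec.representation C (f d) c)"
    unfolding trace_on_def
    by (intro sum.cong refl representation_clinear_image[OF ind fin f _ ind]) (auto intro: fC gC)
  also have "\<dots> = (\<Sum>d\<in>C. \<Sum>c\<in>C. cvec.representation C (f d) c * cvec.representation C (g c) d)"
    by (subst sum.swap) (simp add: mult.commute)
  also have "\<dots> = trace_on C (\<lambda>x. g (f x))"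
    unfolding trace_on_def
    by (intro sum.cong refl representation_clinear_image[OF ind fin g _ ind, symmetric])
      (auto intro: fC gC)
  finally show ?thesis .
qed

text \<open>Expanding the elements of \<open>B\<close> in \<open>C\<close> and interchanging summations turns one trace into
  the other.\<close>

lemma trace_on_basis_change:
  assumes B: "cvec.independent B" and C: "cvec.independent C"
    and span: "cvec.span B = cvec.span C" and f: "clinear f"
    and fC: "\<And>c. c \<in> C \<Longrightarrow> f c \<in> cvec.span C"
  shows "trace_on B f = trace_on C f"
proof -
  have bC: "b \<in> cvec.span C" if "b \<in> B" for b
    using cvec.span_base[OF that] span by simp
  have id: "clinear (\<lambda>x. x)" by (rule clinearI) auto
  have "trace_on B f
      = (\<Sum>b\<in>B. \<Sum>c\<in>C. cvec.representation C b c * cvec.representation B (f c) b)"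
    unfolding trace_on_def
    by (intro sum.cong refl representation_clinear_image[OF C cfinite_independent[OF C] f _ B])
      (auto intro: bC simp: fC span)
  also have "\<dots> = (\<Sum>c\<in>C. \<Sum>b\<in>B. cvec.representation B (f c) b * cvec.representation C b c)"
    by (subst sum.swap) (simp add: mult.commute)
  also have "\<dots> = trace_on C f"
    unfolding trace_on_def
    by (intro sum.cong refl representation_clinear_image
        [OF B cfinite_independent[OF B] id _ C, symmetric])
      (auto intro: bC simp: fC span)
  finally show ?thesis .
qed

text \<open>This frees the trace from the basis chosen in its definition; below, the basis
  consists of weight vectors.\<close>

lemma ctrace_eq_trace_on:
  assumes B: "cvec.independent B" "cvec.span B = UNIV" and f: "clinear f"
  shows "ctrace f = trace_on B f"
proof -
  define C where "C = (SOME B :: 'a set. cvec.independent B \<and> cvec.span B = UNIV)"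
  have C: "cvec.independent C \<and> cvec.span C = UNIV"
    unfolding C_def by (rule someI[of _ B]) (use B in auto)
  have "ctrace f = trace_on C f"
    by (simp add: ctrace_def C_def[symmetric] trace_on_def)
  then show ?thesis
    using trace_on_basis_change[of C B f] C B f by simp
qed

lemma trace_on_diff:
  assumes ind: "cvec.independent C"
    and fC: "\<And>c. c \<in> C \<Longrightarrow> f c \<in> cvec.span C" and gC: "\<And>c. c \<in> C \<Longrightarrow> g c \<in> cvec.span C"
  shows "trace_on C (\<lambda>x. f x - g x) = trace_on C f - trace_on C g"
  unfolding trace_on_def
  by (simp add: cvec.representation_diff[OF ind gC fC] sum_subtractf fC gC)

lemma trace_on_add:
  assumes ind: "cvec.independent C"
    and fC: "\<And>c. c \<in> C \<Longrightarrow> f c \<in> cvec.span C" and gC: "\<And>c. c \<in> C \<Longrightarrow> g c \<in> cvec.span C"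
  shows "trace_on C (\<lambda>x. f x + g x) = trace_on C f + trace_on C g"
  unfolding trace_on_def
  by (simp add: cvec.representation_add[OF ind gC fC] sum.distrib fC gC)

lemma trace_on_scale:
  assumes ind: "cvec.independent C" and fC: "\<And>c. c \<in> C \<Longrightarrow> f c \<in> cvec.span C"
  shows "trace_on C (\<lambda>x. a *\<^sub>C f x) = a * trace_on C f"
  unfolding trace_on_def
  by (simp add: cvec.representation_scale[OF ind fC] sum_distrib_left fC)

lemma basis_exists_UNIV:
  obtains B :: "'g::complex_lie_algebra set" where "cvec.independent B" "cvec.span B = UNIV"
  using cvec.independent_extend_basis[OF cvec.independent_empty] cvec.span_extend_basis[OF cvec.independent_empty]
  by blast

lemma killing_trace:
  assumes B: "cvec.independent B" "cvec.span B = UNIV"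
  shows "killing x y = trace_on B (\<lambda>z. lie x (lie y z))"
  unfolding killing_def
  by (rule ctrace_eq_trace_on[OF B clinear_comp[OF clinear_lie clinear_lie]])

lemma killing_add_left: "killing (x + y) z = killing x z + killing y (z::'g::complex_lie_algebra)"
proof -
  obtain B :: "'g set" where B: "cvec.independent B" "cvec.span B = UNIV" by (rule basis_exists_UNIV)
  show ?thesis by (simp add: killing_trace[OF B] lie_add_left trace_on_add B)
qed

lemma killing_scale_left: "killing (a *\<^sub>C x) z = a * killing x (z::'g::complex_lie_algebra)"
proof -
  obtain B :: "'g set" where B: "cvec.independent B" "cvec.span B = UNIV" by (rule basis_exists_UNIV)
  show ?thesis by (simp add: killing_trace[OF B] lie_scaleC_left trace_on_scale B)
qed

lemma killing_sym: "killing x y = killing y (x::'g::complex_lie_algebra)"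
proof -
  obtain B :: "'g set" where B: "cvec.independent B" "cvec.span B = UNIV" by (rule basis_exists_UNIV)
  show ?thesis
    unfolding killing_trace[OF B] by (rule trace_on_commute) (simp_all add: B clinear_lie)
qed

lemma killing_add_right: "killing z (x + y) = killing z x + killing z (y::'g::complex_lie_algebra)"
  by (metis killing_add_left killing_sym)

lemma killing_scale_right: "killing z (a *\<^sub>C x) = a * killing z (x::'g::complex_lie_algebra)"
  by (metis killing_scale_left killing_sym)

text \<open>After expanding \<open>ad [x, y]\<close> and \<open>ad [y, z]\<close> as commutators, the two sides differ by a
  cyclic permutation of three operators under the trace.\<close>

lemma killing_invariant: "killing (lie x y) z = killing x (lie y (z::'g::complex_lie_algebra))"
proof -
  obtain B :: "'g set" where B: "cvec.independent B" "cvec.span B = UNIV" by (rule basis_exists_UNIV)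
  have "killing (lie x y) z = trace_on B (\<lambda>u. lie x (lie y (lie z u)) - lie y (lie x (lie z u)))"
    by (simp add: killing_trace[OF B] lie_lie_left)
  also have "\<dots> = trace_on B (\<lambda>u. lie x (lie y (lie z u))) - trace_on B (\<lambda>u. lie y (lie x (lie z u)))"
    by (rule trace_on_diff) (simp_all add: B)
  also have "trace_on B (\<lambda>u. lie y (lie x (lie z u))) = trace_on B (\<lambda>u. lie x (lie z (lie y u)))"
    by (rule trace_on_commute) (simp_all add: B clinear_lie clinear_comp[OF clinear_lie clinear_lie])
  also have "trace_on B (\<lambda>u. lie x (lie y (lie z u))) - trace_on B (\<lambda>u. lie x (lie z (lie y u)))
      = trace_on B (\<lambda>u. lie x (lie (lie y z) u))"
    by (subst trace_on_diff[symmetric]) (simp_all add: B lie_lie_left lie_diff_right)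
  also have "\<dots> = killing x (lie y z)" by (simp add: killing_trace[OF B])
  finally show ?thesis .
qed

lemma killing_0 [simp]: "killing 0 x = 0" "killing x 0 = (0::complex)"
  for x :: "'g::complex_lie_algebra"
  using killing_scale_left[of 0 0 x] killing_scale_right[of x 0 0] by auto

lemma killing_minus_left: "killing (- x) y = - killing x (y::'g::complex_lie_algebra)"
  using killing_scale_left[of "-1" x y] by (simp add: cvec.scale_minus_left)

lemma killing_minus_right: "killing x (- y) = - killing x (y::'g::complex_lie_algebra)"
  using killing_scale_right[of x "-1" y] by (simp add: cvec.scale_minus_left)

lemma killing_diff_left: "killing (x - y) z = killing x z - killing y (z::'g::complex_lie_algebra)"
  using killing_add_left[of x "-y" z] by (simp add: killing_minus_left)

lemma killing_diff_right: "killing z (x - y) = killing z x - killing z (y::'g::complex_lie_algebra)"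
  using killing_add_right[of z x "-y"] by (simp add: killing_minus_right)

lemma killing_sum_left: "killing (sum f I) y = (\<Sum>i\<in>I. killing (f i) (y::'g::complex_lie_algebra))"
  by (induction I rule: infinite_finite_induct) (simp_all add: killing_add_left)

lemma killing_sum_right: "killing y (sum f I) = (\<Sum>i\<in>I. killing y (f i::'g::complex_lie_algebra))"
  by (induction I rule: infinite_finite_induct) (simp_all add: killing_add_right)

section \<open>Weight decomposition under a Cartan subalgebra\<close>

text \<open>For an eigenvalue \<open>\<lambda>\<close> of a suitable \<open>h\<close>, the operator \<open>ad h - \<lambda>\<close> kills one summand,
  rescales the others and leaves \<open>W\<close> invariant. Killing the summands one by one isolates the
  component \<open>v i\<close>, up to a nonzero factor.\<close>

lemma invariant_subspace_contains_components:
  fixes v :: "'i \<Rightarrow> 'g::complex_lie_algebra"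
  assumes "finite I" "i \<in> I" "cvec.subspace W"
    and "\<And>h z. h \<in> K \<Longrightarrow> z \<in> W \<Longrightarrow> lie h z \<in> W"
    and "\<And>k h. k \<in> I \<Longrightarrow> h \<in> K \<Longrightarrow> lie h (v k) = l k h *\<^sub>C v k"
    and "\<And>j k. j \<in> I \<Longrightarrow> k \<in> I \<Longrightarrow> j \<noteq> k \<Longrightarrow> \<exists>h\<in>K. l j h \<noteq> l k h"
    and "(\<Sum>k\<in>I. v k) \<in> W"
  shows "v i \<in> W"
  using assms
proof (induction "card I" arbitrary: I v)
  case 0
  then show ?case by auto
next
  case (Suc n)
  show ?case
  proof (cases "I = {i}")
    case True
    then show ?thesis using Suc.prems by simp
  next
    case False
    then obtain j where j: "j \<in> I" "j \<noteq> i" using Suc.prems by blast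
    then obtain h where h: "h \<in> K" "l j h \<noteq> l i h" using Suc.prems by blast
    define v' where "v' k = (l k h - l j h) *\<^sub>C v k" for k
    have "(\<Sum>k\<in>I. v' k) = lie h (\<Sum>k\<in>I. v k) - l j h *\<^sub>C (\<Sum>k\<in>I. v k)"
      using Suc.prems(5) h(1)
      by (simp add: v'_def lie_sum_right cvec.scale_sum_right sum_subtractf[symmetric]
          cvec.scale_left_diff_distrib)
    also have "\<dots> \<in> W"
      using Suc.prems h by (intro cvec.subspace_diff cvec.subspace_scale) auto
    finally have "(\<Sum>k\<in>I. v' k) \<in> W" .
    moreover have "(\<Sum>k\<in>I. v' k) = (\<Sum>k\<in>I - {j}. v' k)"
      by (rule sum.mono_neutral_right) (use Suc.prems in \<open>auto simp: v'_def\<close>)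
    ultimately have sumW: "(\<Sum>k\<in>I - {j}. v' k) \<in> W" by simp
    have "v' i \<in> W"
    proof (rule Suc.hyps(1)[of "I - {j}"])
      show "n = card (I - {j})" using Suc.hyps(2) Suc.prems(1) j by simp
      show "finite (I - {j})" "i \<in> I - {j}" using Suc.prems j by auto
      show "lie h (v' k) = l k h *\<^sub>C v' k" if "k \<in> I - {j}" "h \<in> K" for k h
        using Suc.prems(5)[of k h] that
        by (simp add: v'_def lie_scaleC_right mult.commute)
    qed (use Suc.prems sumW in auto)
    then have "inverse (l i h - l j h) *\<^sub>C v' i \<in> W"
      using Suc.prems(3) by (rule cvec.subspace_scale[rotated])
    then show ?thesis using h by (simp add: v'_def)
  qed
qed

locale cartan =
  fixes H :: "'g::complex_simple_lie_algebra set"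
  assumes cartan: "cartan_subalgebra H"
begin

lemma subspace_H: "cvec.subspace H"
  and abelian_H: "h \<in> H \<Longrightarrow> h' \<in> H \<Longrightarrow> lie h h' = 0"
  and diagonalizable: "h \<in> H \<Longrightarrow> cvec.span {x. \<exists>c. lie h x = c *\<^sub>C x} = UNIV"
  using cartan unfolding cartan_subalgebra_def abelian_subalgebra_def by auto

text \<open>The span of \<open>H\<close> and \<open>x\<close> is an abelian subalgebra, so maximality of \<open>H\<close> applies.\<close>

lemma centralizer_H:
  assumes "\<And>h. h \<in> H \<Longrightarrow> lie h x = 0"
  shows "x \<in> H"
proof -
  have "abelian_subalgebra (cvec.span (insert x H))"
    unfolding abelian_subalgebra_def
  proof (intro conjI ballI)
    have hx: "lie x h = 0" if "h \<in> H" for h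
      using assms[OF that] lie_antisym[of x h] by simp
    fix y z assume "y \<in> cvec.span (insert x H)" "z \<in> cvec.span (insert x H)"
    then obtain a b where ab: "y - a *\<^sub>C x \<in> H" "z - b *\<^sub>C x \<in> H"
      using subspace_H by (auto simp: cvec.span_insert cvec.span_eq_iff[THEN iffD2])
    define h k where "h = y - a *\<^sub>C x" and "k = z - b *\<^sub>C x"
    have yz: "y = h + a *\<^sub>C x" "z = k + b *\<^sub>C x" "h \<in> H" "k \<in> H"
      using ab by (auto simp: h_def k_def)
    then show "lie y z = 0"
      using hx assms by (simp add: lie_add_left lie_add_right lie_scaleC_left lie_scaleC_right
          abelian_H lie_self)
  qed simp
  moreover have "H \<subseteq> cvec.span (insert x H)"
    by (meson cvec.span_superset order_trans subset_insertI)
  ultimately have "cvec.span (insert x H) = H"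
    using cartan unfolding cartan_subalgebra_def by blast
  then show ?thesis using cvec.span_base[of x "insert x H"] by simp
qed

text \<open>A simultaneous eigenspace of the operators in \<open>F\<close> is invariant under the commuting
  operator \<open>ad h\<close>; hence it contains the \<open>ad h\<close>-eigencomponents of its elements.\<close>

lemma simultaneous_eigenvectors_finite:
  assumes "finite F" "F \<subseteq> H"
  shows "cvec.span {x. \<forall>h\<in>F. \<exists>c. lie h x = c *\<^sub>C x} = UNIV"
  using assms
proof (induction F rule: finite_induct)
  case empty
  then show ?case by simp
next
  case (insert h F)
  define E where "E = {x. \<forall>f\<in>insert h F. \<exists>c. lie f x = c *\<^sub>C x}"
  have h: "h \<in> H" using insert by simp
  have "x \<in> cvec.span E" if x: "\<forall>f\<in>F. \<exists>c. lie f x = c *\<^sub>C x" for x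
  proof -
    from bchoice[OF x] obtain c where c: "\<And>f. f \<in> F \<Longrightarrow> lie f x = c f *\<^sub>C x" by blast
    define W where "W = {z. \<forall>f\<in>F. lie f z = c f *\<^sub>C z}"
    have W: "cvec.subspace W"
      by (rule cvec.subspaceI)
        (auto simp: W_def lie_add_right lie_scaleC_right cvec.scale_right_distrib mult.commute)
    have W_inv: "lie h' z \<in> W" if "h' \<in> {h}" "z \<in> W" for h' z
    proof -
      have "lie f (lie h z) = lie h (lie f z)" if "f \<in> F" for f
        using lie_lie_left[of f h z] abelian_H[of f h] insert.prems that by auto
      then show ?thesis using that by (auto simp: W_def lie_scaleC_right)
    qed
    have "x \<in> cvec.span {x. \<exists>c. lie h x = c *\<^sub>C x}" using diagonalizable[OF h] by simp
    then obtain T r where T: "finite T" "T \<subseteq> {x. \<exists>c. lie h x = c *\<^sub>C x}"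
        and xT: "x = (\<Sum>a\<in>T. r a *\<^sub>C a)"
      unfolding cvec.span_explicit by auto
    from T(2) have "\<forall>a\<in>T. \<exists>c. lie h a = c *\<^sub>C a" by blast
    from bchoice[OF this] obtain e where e: "\<And>a. a \<in> T \<Longrightarrow> lie h a = e a *\<^sub>C a" by blast
    define v where "v d = (\<Sum>a\<in>{a\<in>T. e a = d}. r a *\<^sub>C a)" for d
    have x_sum: "x = (\<Sum>d\<in>e ` T. v d)"
      unfolding xT v_def by (rule sum.image_gen[OF T(1)])
    have lv: "lie h (v d) = d *\<^sub>C v d" for d
      unfolding v_def lie_sum_right cvec.scale_sum_right
      by (rule sum.cong) (auto simp: lie_scaleC_right e mult.commute)
    have "v d \<in> W" if "d \<in> e ` T" for d
    proof (rule invariant_subspace_contains_components[where I = "e ` T" and K = "{h}" and l = "\<lambda>d _. d"])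
      show "(\<Sum>d\<in>e ` T. v d) \<in> W" using x_sum c by (auto simp: W_def)
    qed (use T W W_inv lv that in auto)
    then have "v d \<in> E" if "d \<in> e ` T" for d
      using that lv unfolding E_def W_def by blast
    then show ?thesis unfolding x_sum by (intro cvec.span_sum cvec.span_base)
  qed
  then have "cvec.span {x. \<forall>f\<in>F. \<exists>c. lie f x = c *\<^sub>C x} \<subseteq> cvec.span E"
    by (intro cvec.span_minimal) auto
  then show ?case using insert unfolding E_def by auto
qed

definition weight_vectors :: "'g set" where
  "weight_vectors = {x. \<exists>w. \<forall>h\<in>H. lie h x = w h *\<^sub>C x}"

lemma span_weight_vectors: "cvec.span weight_vectors = UNIV"
proof -
  obtain F where F: "F \<subseteq> H" "cvec.independent F" "H \<subseteq> cvec.span F"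
    by (rule cvec.maximal_independent_subset)
  have "{x. \<forall>h\<in>F. \<exists>c. lie h x = c *\<^sub>C x} \<subseteq> weight_vectors"
  proof
    fix x assume x: "x \<in> {x. \<forall>h\<in>F. \<exists>c. lie h x = c *\<^sub>C x}"
    have "\<exists>c. lie h x = c *\<^sub>C x" if "h \<in> cvec.span F" for h
      using that
    proof (induction rule: cvec.span_induct_alt)
      case base
      show ?case by (rule exI[of _ 0]) simp
    next
      case (step a y z)
      then obtain c d where "lie y x = c *\<^sub>C x" "lie z x = d *\<^sub>C x" using x by blast
      then have "lie (a *\<^sub>C y + z) x = (a * c + d) *\<^sub>C x"
        by (simp add: lie_add_left lie_scaleC_left cvec.scale_left_distrib)
      then show ?case by blast
    qed
    then have "\<forall>h\<in>H. \<exists>c. lie h x = c *\<^sub>C x" using F(3) by blast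
    from bchoice[OF this] show "x \<in> weight_vectors" unfolding weight_vectors_def by blast
  qed
  then show ?thesis
    using cvec.span_mono simultaneous_eigenvectors_finite[OF cfinite_independent[OF F(2)] F(1)]
    by blast
qed

end

text \<open>The value \<open>w b h\<close> is the eigenvalue of \<open>ad h\<close> on \<open>b\<close>. Weights are functions here;
  representing them by elements of \<open>H\<close> requires the Killing form to be nondegenerate.\<close>

locale weight_basis = cartan H for H :: "'g::complex_simple_lie_algebra set" +
  fixes B :: "'g set" and w :: "'g \<Rightarrow> 'g \<Rightarrow> complex"
  assumes independent_B: "cvec.independent B" and span_B: "cvec.span B = UNIV"
    and weight_B: "b \<in> B \<Longrightarrow> h \<in> H \<Longrightarrow> lie h b = w b h *\<^sub>C b"

lemma (in cartan) weight_basis_exists: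
  assumes "S \<subseteq> weight_vectors" "cvec.independent S"
  shows "\<exists>B w. S \<subseteq> B \<and> weight_basis H B w"
proof -
  obtain B where B: "S \<subseteq> B" "B \<subseteq> weight_vectors" "cvec.independent B" "weight_vectors \<subseteq> cvec.span B"
    using cvec.maximal_independent_subset_extend[OF assms] by metis
  have "cvec.span B = UNIV"
    using B(4) span_weight_vectors by (metis cvec.span_minimal cvec.subspace_span top.extremum_unique)
  moreover have "\<forall>b\<in>B. \<exists>w. \<forall>h\<in>H. lie h b = w h *\<^sub>C b"
    using B(2) unfolding weight_vectors_def by blast
  from bchoice[OF this] obtain w where "\<And>b h. b \<in> B \<Longrightarrow> h \<in> H \<Longrightarrow> lie h b = w b h *\<^sub>C b"
    by blast
  ultimately have "weight_basis H B w" using B(3) by unfold_locales auto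
  then show ?thesis using B(1) by blast
qed

section \<open>Nondegeneracy of the Killing form\<close>

lemma lie_derivation: "lie h (lie x y) = lie (lie h x) y + lie x (lie h (y::'g::complex_lie_algebra))"
  by (simp add: lie_lie_left)

lemma center_trivial:
  fixes z :: "'g::complex_simple_lie_algebra"
  assumes "\<And>x. lie z x = 0"
  shows "z = 0"
proof -
  let ?Z = "{z::'g. \<forall>x. lie z x = 0}"
  have "lie_ideal ?Z"
    unfolding lie_ideal_def
    by (auto simp: lie_add_left lie_scaleC_left) (metis lie_antisym neg_0_equal_iff_equal lie_0_left)
  then have "?Z = {0} \<or> ?Z = UNIV" by (rule simple)
  moreover have "?Z \<noteq> UNIV" using nonabelian by blast
  ultimately show ?thesis using assms by blast
qed

context cartan
begin

definition weight_space :: "('g \<Rightarrow> complex) \<Rightarrow> 'g set" where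
  "weight_space a = {x. \<forall>h\<in>H. lie h x = a h *\<^sub>C x}"

lemma subspace_weight_space: "cvec.subspace (weight_space a)"
  by (rule cvec.subspaceI)
    (auto simp: weight_space_def lie_add_right lie_scaleC_right cvec.scale_right_distrib mult.commute)

lemma lie_weight_space:
  assumes "x \<in> weight_space a" "y \<in> weight_space b"
  shows "lie x y \<in> weight_space (\<lambda>h. a h + b h)"
  using assms unfolding weight_space_def
  by (auto simp: lie_derivation lie_scaleC_left lie_scaleC_right cvec.scale_left_distrib)

lemma lie_opposite_weight_spaces:
  assumes "x \<in> weight_space a" "y \<in> weight_space (\<lambda>h. - a h)"
  shows "lie x y \<in> H"
  using lie_weight_space[OF assms] by (intro centralizer_H) (auto simp: weight_space_def)

text \<open>By invariance, moving \<open>ad h\<close> from the first argument to the second one changes its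
  sign.\<close>

lemma killing_weight_spaces_orthogonal:
  assumes "x \<in> weight_space a" "y \<in> weight_space b" "h \<in> H" "a h + b h \<noteq> 0"
  shows "killing x y = 0"
proof -
  have "a h * killing x y = killing (lie h x) y"
    using assms by (simp add: weight_space_def killing_scale_left)
  also have "\<dots> = - killing (lie x h) y" by (subst lie_antisym) (simp add: killing_minus_left)
  also have "\<dots> = - (b h * killing x y)"
    using assms by (simp add: killing_invariant weight_space_def killing_scale_right)
  finally have "(a h + b h) * killing x y = 0" by (simp add: distrib_right)
  then show ?thesis using assms(4) by simp
qed

lemma H_nonzero: "\<exists>h\<in>H. h \<noteq> 0"
proof (rule ccontr)
  assume "\<not> ?thesis"
  then have "h = 0" if "h \<in> H" for h using that by blast
  then have "x \<in> H" for x by (intro centralizer_H) (metis lie_0_left)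
  then have "x = 0" for x :: 'g using \<open>\<not> (\<exists>h\<in>H. h \<noteq> 0)\<close> by blast
  then show False using nonabelian by metis
qed

end

context weight_basis
begin

abbreviation coord :: "'g \<Rightarrow> 'g \<Rightarrow> complex" where
  "coord \<equiv> cvec.representation B"

lemma finite_B: "finite B"
  using cfinite_independent independent_B .

lemma expand: "(\<Sum>b\<in>B. coord x b *\<^sub>C b) = x"
  using cvec.sum_representation_eq[OF independent_B _ finite_B] span_B by simp

lemma coord_nonzero:
  assumes "x \<noteq> 0"
  shows "\<exists>b\<in>B. coord x b \<noteq> 0"
proof (rule ccontr)
  assume "\<not> ?thesis"
  then have "(\<Sum>b\<in>B. coord x b *\<^sub>C b) = 0" by simp
  then show False using assms by (simp add: expand)
qed

lemma coord_add: "coord (x + y) b = coord x b + coord y b"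
  and coord_scale: "coord (c *\<^sub>C x) b = c * coord x b"
  by (simp_all add: cvec.representation_add[OF independent_B] cvec.representation_scale[OF independent_B] span_B)

lemma coord_basis: "b \<in> B \<Longrightarrow> coord b c = (if c = b then 1 else 0)"
  by (simp add: cvec.representation_basis[OF independent_B])

lemma coord_clinear: "clinear f \<Longrightarrow> coord (f x) b = (\<Sum>d\<in>B. coord x d * coord (f d) b)"
  using representation_clinear_image[OF independent_B finite_B _ _ independent_B] span_B by simp

lemma B_weight_space: "b \<in> B \<Longrightarrow> b \<in> weight_space (w b)"
  by (simp add: weight_space_def weight_B)

text \<open>The \<open>b\<close>-coordinate of \<open>[h, x]\<close> can be computed from the weight of \<open>x\<close> and from the
  weight of \<open>b\<close>. So a weight space is spanned by the basis vectors in it.\<close>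

lemma component_weight:
  assumes x: "x \<in> weight_space a" and nz: "coord x b \<noteq> 0" and h: "h \<in> H"
  shows "w b h = a h"
proof -
  have b: "b \<in> B" using nz cvec.representation_ne_zero by blast
  have "a h * coord x b = coord (lie h x) b"
    using x h by (simp add: weight_space_def coord_scale)
  also have "\<dots> = (\<Sum>d\<in>B. coord x d * coord (lie h d) b)" by (rule coord_clinear[OF clinear_lie])
  also have "\<dots> = (\<Sum>d\<in>B. if d = b then coord x d * w d h else 0)"
    by (rule sum.cong) (auto simp: weight_B h coord_scale coord_basis)
  also have "\<dots> = coord x b * w b h" using b finite_B by simp
  finally show ?thesis using nz by simp
qed

lemma weight_vector_in_span:
  assumes x: "x \<in> weight_space a" and S: "\<And>b. b \<in> B \<Longrightarrow> (\<And>h. h \<in> H \<Longrightarrow> w b h = a h) \<Longrightarrow> b \<in> S"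
  shows "x \<in> cvec.span S"
proof -
  have "coord x b *\<^sub>C b \<in> cvec.span S" if "b \<in> B" for b
  proof (cases "coord x b = 0")
    case True
    then show ?thesis by (simp add: cvec.span_zero)
  next
    case False
    then have "b \<in> S" using component_weight[OF x] S that by blast
    then show ?thesis by (intro cvec.span_scale cvec.span_base)
  qed
  then have "(\<Sum>b\<in>B. coord x b *\<^sub>C b) \<in> cvec.span S" by (rule cvec.span_sum)
  then show ?thesis by (simp add: expand)
qed

lemma killing_H:
  assumes "h \<in> H" "h' \<in> H"
  shows "killing h h' = (\<Sum>b\<in>B. w b h * w b h')"
  unfolding killing_trace[OF independent_B span_B] trace_on_def
  by (rule sum.cong) (auto simp: weight_B assms lie_scaleC_right coord_scale coord_basis)

text \<open>The sum is the trace of \<open>ad [x, y]\<close>, a commutator of operators that preserve the span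
  of \<open>S\<close>.\<close>

lemma sum_weights_invariant_span:
  assumes S: "S \<subseteq> B" and H: "lie x y \<in> H"
    and x: "\<And>b. b \<in> S \<Longrightarrow> lie x b \<in> cvec.span S" and y: "\<And>b. b \<in> S \<Longrightarrow> lie y b \<in> cvec.span S"
  shows "(\<Sum>b\<in>S. w b (lie x y)) = 0"
proof -
  have ind: "cvec.independent S" using independent_B S by (rule cvec.independent_mono)
  have stable: "lie u v \<in> cvec.span S"
    if u: "\<And>b. b \<in> S \<Longrightarrow> lie u b \<in> cvec.span S" and v: "v \<in> cvec.span S" for u v
    using v
  proof (induction rule: cvec.span_induct_alt)
    case (step c b z)
    then show ?case
      by (auto simp: lie_add_right lie_scaleC_right intro!: cvec.span_add cvec.span_scale u)
  qed (simp add: cvec.span_zero)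
  have "(\<Sum>b\<in>S. w b (lie x y)) = trace_on S (lie (lie x y))"
    unfolding trace_on_def
    using S by (intro sum.cong refl)
      (auto simp: weight_B[OF _ H] cvec.representation_scale[OF ind] cvec.representation_basis[OF ind]
        cvec.span_base subset_iff)
  also have "\<dots> = trace_on S (\<lambda>z. lie x (lie y z) - lie y (lie x z))"
    by (rule arg_cong[of _ _ "trace_on S"]) (simp add: lie_lie_left fun_eq_iff)
  also have "\<dots> = trace_on S (\<lambda>z. lie x (lie y z)) - trace_on S (\<lambda>z. lie y (lie x z))"
    by (rule trace_on_diff[OF ind])
      (auto intro: stable[of x, OF x] stable[of y, OF y] cvec.span_base)
  also have "trace_on S (\<lambda>z. lie x (lie y z)) = trace_on S (\<lambda>z. lie y (lie x z))"
    by (rule trace_on_commute[OF ind clinear_lie clinear_lie x y])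
  finally show ?thesis by simp
qed

text \<open>The weight spaces whose weights lie on the line through \<open>w b\<close> in the direction \<open>a\<close>
  together form an invariant subspace. Its trace identity is a linear relation, with
  integral coefficients, between the values of \<open>w b\<close> and \<open>a\<close>.\<close>

lemma weights_proportional:
  assumes x: "x \<in> weight_space a" and y: "y \<in> weight_space (\<lambda>h. - a h)" and b: "b \<in> B"
  shows "\<exists>q::real. w b (lie x y) = of_real q * a (lie x y)"
proof -
  define h where "h = lie x y"
  have h: "h \<in> H" unfolding h_def by (rule lie_opposite_weight_spaces[OF x y])
  define S where "S = {c\<in>B. \<exists>k::int. \<forall>h\<in>H. w c h = w b h + of_int k * a h}"
  have "\<forall>c\<in>S. \<exists>k::int. \<forall>h\<in>H. w c h = w b h + of_int k * a h" unfolding S_def by blast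
  from bchoice[OF this] obtain k :: "'g \<Rightarrow> int"
    where k: "\<And>c h. c \<in> S \<Longrightarrow> h \<in> H \<Longrightarrow> w c h = w b h + of_int (k c) * a h" by blast
  have "(\<Sum>c\<in>S. w c h) = 0"
    unfolding h_def
  proof (rule sum_weights_invariant_span)
    show "lie x c \<in> cvec.span S" if c: "c \<in> S" for c
    proof (rule weight_vector_in_span[OF lie_weight_space[OF x B_weight_space]])
      fix d assume d: "d \<in> B" "\<And>h. h \<in> H \<Longrightarrow> w d h = a h + w c h"
      then have "\<forall>h\<in>H. w d h = w b h + of_int (k c + 1) * a h" using k[OF c] by (simp add: algebra_simps)
      then show "d \<in> S" using d(1) unfolding S_def by blast
    qed (use c S_def in auto)
    show "lie y c \<in> cvec.span S" if c: "c \<in> S" for c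
    proof (rule weight_vector_in_span[OF lie_weight_space[OF y B_weight_space]])
      fix d assume d: "d \<in> B" "\<And>h. h \<in> H \<Longrightarrow> w d h = - a h + w c h"
      then have "\<forall>h\<in>H. w d h = w b h + of_int (k c - 1) * a h" using k[OF c] by (simp add: algebra_simps)
      then show "d \<in> S" using d(1) unfolding S_def by blast
    qed (use c S_def in auto)
  qed (use h h_def S_def in auto)
  also have "(\<Sum>c\<in>S. w c h) = (\<Sum>c\<in>S. w b h + of_int (k c) * a h)"
    using k h by (intro sum.cong) auto
  also have "\<dots> = of_nat (card S) * w b h + of_int (\<Sum>c\<in>S. k c) * a h"
    by (simp add: sum.distrib sum_distrib_right)
  finally have eq: "of_nat (card S) * w b h = - (of_int (\<Sum>c\<in>S. k c) * a h)" by (simp add: add_eq_0_iff2)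
  have "b \<in> S" using b unfolding S_def by (auto intro: exI[of _ 0])
  then have "card S \<noteq> 0" using finite_B by (auto simp: S_def)
  with eq have "w b h = of_real (- of_int (\<Sum>c\<in>S. k c) / of_nat (card S)) * a h"
    by (simp add: field_simps)
  then show ?thesis unfolding h_def by blast
qed

lemma H_weights_zero:
  assumes "h \<in> H" "\<And>b. b \<in> B \<Longrightarrow> w b h = 0"
  shows "h = 0"
proof (rule center_trivial)
  fix x
  have "lie h x = (\<Sum>b\<in>B. coord x b *\<^sub>C lie h b)"
    by (subst expand[of x, symmetric]) (simp add: lie_sum_right lie_scaleC_right)
  also have "\<dots> = 0" using assms by (simp add: weight_B)
  finally show "lie h x = 0" .
qed

text \<open>Suppose that the form vanishes, and let \<open>h = [x, y]\<close> for opposite weight vectors. By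
  proportionality, \<open>0 = (h, h)\<close> is a nonempty sum of squares of real multiples of the same
  number, one of the multiples being one. So all weights vanish on \<open>h\<close>, and \<open>h = 0\<close>. Then no
  bracket has a component of weight zero, and the elements without a coordinate at a given
  weight-zero basis vector form a proper ideal that contains all brackets.\<close>

lemma killing_not_zero: "\<exists>x y::'g. killing x y \<noteq> 0"
proof (rule ccontr)
  assume "\<not> ?thesis"
  then have zero: "killing x y = 0" for x y :: 'g by blast
  have opposite: "lie x y = 0"
    if b: "x \<in> B" and y: "y \<in> weight_space (\<lambda>h. - w x h)" for x y
  proof -
    define h where "h = lie x y"
    have h: "h \<in> H" unfolding h_def by (rule lie_opposite_weight_spaces[OF B_weight_space[OF b] y])
    have "\<forall>c\<in>B. \<exists>q::real. w c h = of_real q * w x h"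
      using weights_proportional[OF B_weight_space[OF b] y] unfolding h_def by blast
    from bchoice[OF this] obtain q :: "'g \<Rightarrow> real" where q: "\<And>c. c \<in> B \<Longrightarrow> w c h = of_real (q c) * w x h"
      by blast
    \<comment> \<open>The multiple belonging to the weight of \<open>x\<close> itself is one, so the squares cannot sum to zero.\<close>
    have "w x h = 0"
    proof (rule ccontr)
      assume nz: "w x h \<noteq> 0"
      have "0 = killing h h" by (simp add: zero)
      also have "\<dots> = (\<Sum>c\<in>B. (of_real (q c) * w x h) * (of_real (q c) * w x h))"
        unfolding killing_H[OF h h] by (rule sum.cong) (simp_all add: q)
      also have "\<dots> = of_real (\<Sum>c\<in>B. (q c)\<^sup>2) * (w x h)\<^sup>2"
        by (simp add: sum_distrib_left sum_distrib_right power2_eq_square mult_ac)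
      finally have "(\<Sum>c\<in>B. (q c)\<^sup>2) = 0" using nz by (simp del: of_real_sum)
      then have "q x = 0" using finite_B b by (simp add: sum_nonneg_eq_0_iff)
      then show False using q[OF b] nz by simp
    qed
    then have "h = 0" using h q by (intro H_weights_zero) auto
    then show ?thesis by (simp add: h_def)
  qed
  obtain h where h: "h \<in> H" "h \<noteq> 0" using H_nonzero by blast
  then obtain b where b: "b \<in> B" "coord h b \<noteq> 0" using coord_nonzero by blast
  have wb: "w b k = 0" if "k \<in> H" for k
    using component_weight[of h "\<lambda>_. 0" b k] b h that by (auto simp: weight_space_def abelian_H)
  have brackets_basis: "coord (lie c d) b = 0" if "c \<in> B" "d \<in> B" for c d
  proof (rule ccontr)
    assume nz: "coord (lie c d) b \<noteq> 0"
    have "w d k = - w c k" if "k \<in> H" for k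
      using component_weight[OF lie_weight_space[OF B_weight_space B_weight_space] nz that] wb[OF that]
        \<open>c \<in> B\<close> \<open>d \<in> B\<close> by (simp add: add_eq_0_iff)
    then have "d \<in> weight_space (\<lambda>h. - w c h)" using weight_B \<open>d \<in> B\<close> by (simp add: weight_space_def)
    then have "lie c d = 0" using opposite \<open>c \<in> B\<close> by blast
    then show False using nz by (simp add: cvec.representation_zero)
  qed
  have brackets_left: "coord (lie c y) b = 0" if "c \<in> B" for c y
    using that by (subst coord_clinear[OF clinear_lie]) (simp add: brackets_basis)
  have brackets: "coord (lie x y) b = 0" for x y
  proof -
    have "clinear (\<lambda>x. lie x y)" by (intro clinearI lie_add_left lie_scaleC_left)
    from coord_clinear[OF this, of x b] show ?thesis by (simp add: brackets_left)
  qed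
  have "lie_ideal {z. coord z b = 0}"
    unfolding lie_ideal_def by (simp add: brackets coord_add coord_scale cvec.representation_zero)
  then have "{z. coord z b = 0} = {0} \<or> {z. coord z b = 0} = UNIV" by (rule simple)
  then have "{z. coord z b = 0} = {0}" using b(2) by blast
  then have "lie x y = 0" for x y :: 'g using brackets by blast
  then show False using nonabelian by blast
qed

end

context cartan
begin

text \<open>The radical of the form is an ideal.\<close>

lemma killing_nondegenerate:
  assumes "\<And>y. killing x y = 0"
  shows "x = (0::'g)"
proof -
  obtain B w where "weight_basis H B w"
    using weight_basis_exists[OF empty_subsetI cvec.independent_empty] by blast
  then interpret weight_basis H B w .
  let ?R = "{x::'g. \<forall>y. killing x y = 0}"
  have "lie_ideal ?R"
    unfolding lie_ideal_def
    by (auto simp: killing_add_left killing_scale_left)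
      (metis killing_invariant killing_sym)
  then have "?R = {0} \<or> ?R = UNIV" by (rule simple)
  then show ?thesis using killing_not_zero assms by blast
qed

lemma dual_weight_vector:
  assumes x: "x \<in> weight_space a" "x \<noteq> 0"
  shows "\<exists>y. y \<in> weight_space (\<lambda>h. - a h) \<and> killing x y = 1"
proof -
  obtain B w where "weight_basis H B w"
    using weight_basis_exists[OF empty_subsetI cvec.independent_empty] by blast
  then interpret weight_basis H B w .
  obtain z where z: "killing x z \<noteq> 0" using killing_nondegenerate x by blast
  have "killing x z = (\<Sum>b\<in>B. coord z b * killing x b)"
    by (subst expand[of z, symmetric]) (simp add: killing_sum_right killing_scale_right)
  then obtain b where b: "b \<in> B" "killing x b \<noteq> 0"
    using z by (metis (no_types, lifting) mult_zero_right sum.neutral)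
  have "w b h = - a h" if "h \<in> H" for h
    using killing_weight_spaces_orthogonal[OF x(1) B_weight_space[OF b(1)] that] b
    by (metis add_eq_0_iff)
  then have "b \<in> weight_space (\<lambda>h. - a h)" using weight_B b by (simp add: weight_space_def)
  then have "(1 / killing x b) *\<^sub>C b \<in> weight_space (\<lambda>h. - a h)"
    using subspace_weight_space by (rule cvec.subspace_scale[rotated])
  then show ?thesis using b by (auto simp: killing_scale_right)
qed

text \<open>For \<open>y\<close> of opposite weight with \<open>(x, y) = 1\<close>, invariance shows that \<open>[x, y]\<close>
  represents the weight.\<close>

lemma weight_represented:
  assumes x: "x \<in> weight_space a" "x \<noteq> 0"
  shows "\<exists>t\<in>H. \<forall>h\<in>H. a h = killing t h"
proof -
  obtain y where y: "y \<in> weight_space (\<lambda>h. - a h)" "killing x y = 1" using dual_weight_vector[OF x] by blast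
  have "killing (lie x y) h = a h" if "h \<in> H" for h
  proof -
    have "killing (lie x y) h = - killing x (lie h y)"
      by (simp add: killing_invariant lie_antisym[of y h] killing_minus_right)
    also have "\<dots> = a h" using y that by (simp add: weight_space_def killing_scale_right killing_minus_right cvec.scale_minus_left)
    finally show ?thesis .
  qed
  then show ?thesis using lie_opposite_weight_spaces[OF x(1) y(1)] by metis
qed

lemma killing_nondegenerate_H:
  assumes h: "h \<in> H" and "\<And>k. k \<in> H \<Longrightarrow> killing h k = 0"
  shows "h = 0"
proof (rule ccontr)
  assume "h \<noteq> 0"
  moreover have "h \<in> weight_space (\<lambda>_. 0)" using h by (auto simp: weight_space_def abelian_H)
  ultimately obtain y where "y \<in> weight_space (\<lambda>_. 0)" "killing h y = 1"
    using dual_weight_vector[of h "\<lambda>_. 0"] by auto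
  moreover from this have "y \<in> H" by (intro centralizer_H) (auto simp: weight_space_def)
  ultimately show False using assms by simp
qed

end

section \<open>Root spaces and root strings\<close>

lemma kf_add_left: "kf (x + y) z = kf x z + kf y (z::'g::complex_lie_algebra)"
  and kf_add_right: "kf z (x + y) = kf z x + kf z (y::'g::complex_lie_algebra)"
  and kf_diff_left: "kf (x - y) z = kf x z - kf y (z::'g::complex_lie_algebra)"
  and kf_diff_right: "kf z (x - y) = kf z x - kf z (y::'g::complex_lie_algebra)"
  and kf_minus_left: "kf (- x) z = - kf x (z::'g::complex_lie_algebra)"
  and kf_minus_right: "kf z (- x) = - kf z (x::'g::complex_lie_algebra)"
  and kf_scale_left: "kf (r *\<^sub>R x) z = r * kf x (z::'g::complex_lie_algebra)"
  and kf_scale_right: "kf z (r *\<^sub>R x) = r * kf z (x::'g::complex_lie_algebra)"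
  and kf_0_left: "kf 0 x = 0" and kf_0_right: "kf x 0 = 0"
  and kf_sum_left: "kf (sum f I) z = (\<Sum>i\<in>I. kf (f i) z)"
  and kf_sum_right: "kf z (sum f I) = (\<Sum>i\<in>I. kf z (f i))"
  by (simp_all add: kf_def killing_add_left killing_add_right killing_diff_left killing_diff_right
      killing_minus_left killing_minus_right scaleR_scaleC killing_scale_left killing_scale_right
      killing_sum_left killing_sum_right)

lemmas kf_simps = kf_add_left kf_add_right kf_diff_left kf_diff_right kf_minus_left kf_minus_right
  kf_scale_left kf_scale_right kf_0_left kf_0_right

lemma kf_sym: "kf x y = kf y (x::'g::complex_lie_algebra)"
  by (simp add: kf_def killing_sym)

lemma killing_scaleR: "killing (r *\<^sub>R x) y = of_real r * killing x (y::'g::complex_lie_algebra)"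
  by (simp add: scaleR_scaleC killing_scale_left)

text \<open>A weight basis whose weights are identified with elements of \<open>H\<close>: roots, and zero for
  basis vectors in \<open>H\<close>.\<close>

locale root_basis = weight_basis H B "\<lambda>b. killing (t b)"
    for H B :: "'g::complex_simple_lie_algebra set" and t :: "'g \<Rightarrow> 'g" +
  assumes t_H: "b \<in> B \<Longrightarrow> t b \<in> H"

context cartan
begin

lemma root_space_eq: "root_space H \<phi> = weight_space (killing \<phi>)"
  by (simp add: root_space_def weight_space_def)

lemma root_basis_exists:
  assumes "S \<subseteq> weight_vectors" "cvec.independent S"
  shows "\<exists>B t. S \<subseteq> B \<and> root_basis H B t"
proof -
  obtain B w where B: "S \<subseteq> B" "weight_basis H B w" using weight_basis_exists[OF assms] by blast
  interpret weight_basis H B w by (rule B(2))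
  have "\<forall>b\<in>B. \<exists>t. t \<in> H \<and> (\<forall>h\<in>H. w b h = killing t h)"
  proof
    fix b assume b: "b \<in> B"
    then have "b \<noteq> 0" using independent_B cvec.dependent_zero by blast
    then show "\<exists>t. t \<in> H \<and> (\<forall>h\<in>H. w b h = killing t h)"
      using weight_represented[OF B_weight_space[OF b]] by blast
  qed
  from bchoice[OF this] obtain t where t: "\<forall>b\<in>B. t b \<in> H \<and> (\<forall>h\<in>H. w b h = killing (t b) h)" by blast
  have "root_basis H B t"
    by unfold_locales (use t independent_B span_B weight_B in auto)
  then show ?thesis using B by blast
qed

lemma H_eqI:
  assumes "x \<in> H" "y \<in> H" "\<And>h. h \<in> H \<Longrightarrow> killing x h = killing y h"
  shows "x = y"
  using killing_nondegenerate_H[of "x - y"] assms subspace_H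
  by (simp add: killing_diff_left cvec.subspace_diff)

lemma H_add: "x \<in> H \<Longrightarrow> y \<in> H \<Longrightarrow> x + y \<in> H"
  and H_scale: "x \<in> H \<Longrightarrow> c *\<^sub>C x \<in> H"
  and H_scaleR: "x \<in> H \<Longrightarrow> r *\<^sub>R x \<in> H"
  and H_minus: "x \<in> H \<Longrightarrow> - x \<in> H"
  and H_0: "0 \<in> H"
  using subspace_H
  by (auto simp: cvec.subspace_add cvec.subspace_diff cvec.subspace_scale cvec.subspace_neg
      cvec.subspace_0 scaleR_scaleC)

lemma subspace_root_space: "cvec.subspace (root_space H \<phi>)"
  unfolding root_space_eq by (rule subspace_weight_space)

lemma root_space_0: "root_space H 0 = H"
  by (auto simp: root_space_def abelian_H intro: centralizer_H)

lemma lie_root_space: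
  "x \<in> root_space H \<phi> \<Longrightarrow> y \<in> root_space H \<psi> \<Longrightarrow> lie x y \<in> root_space H (\<phi> + \<psi>)"
  unfolding root_space_eq killing_add_left[abs_def] by (rule lie_weight_space)

lemma root_space_unique:
  assumes "x \<in> root_space H \<phi>" "x \<in> root_space H \<psi>" "x \<noteq> 0" "\<phi> \<in> H" "\<psi> \<in> H"
  shows "\<phi> = \<psi>"
proof (rule H_eqI)
  fix h assume "h \<in> H"
  then have "killing \<phi> h *\<^sub>C x = killing \<psi> h *\<^sub>C x" using assms by (simp add: root_space_def)
  then show "killing \<phi> h = killing \<psi> h" using assms by simp
qed (use assms in auto)

lemma lie_opposite_root_spaces:
  assumes x: "x \<in> root_space H \<phi>" and y: "y \<in> root_space H (- \<phi>)" and \<phi>: "\<phi> \<in> H"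
  shows "lie x y = killing x y *\<^sub>C \<phi>"
proof (rule H_eqI)
  show "lie x y \<in> H" using lie_root_space[OF x y] by (simp add: root_space_0)
  show "killing x y *\<^sub>C \<phi> \<in> H" using \<phi> by (rule H_scale)
  fix h assume h: "h \<in> H"
  have "killing (lie x y) h = - killing x (lie h y)"
    by (simp add: killing_invariant lie_antisym[of y h] killing_minus_right)
  also have "\<dots> = killing (killing x y *\<^sub>C \<phi>) h"
    using y h by (simp add: root_space_def killing_scale_right killing_scale_left killing_minus_left
        killing_minus_right mult.commute cvec.scale_minus_left)
  finally show "killing (lie x y) h = killing (killing x y *\<^sub>C \<phi>) h" .
qed

lemma roots_iff: "\<phi> \<in> roots H \<longleftrightarrow> \<phi> \<in> H \<and> \<phi> \<noteq> 0 \<and> (\<exists>x\<in>root_space H \<phi>. x \<noteq> 0)"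
  using cvec.subspace_0[OF subspace_root_space[of \<phi>]] by (auto simp: roots_def)

lemma rootsD: "\<phi> \<in> roots H \<Longrightarrow> \<phi> \<in> H" "\<phi> \<in> roots H \<Longrightarrow> \<phi> \<noteq> 0"
  by (auto simp: roots_def)

lemma opposite_root_vector:
  assumes x: "x \<in> root_space H \<phi>" "x \<noteq> 0" and \<phi>: "\<phi> \<in> H"
  shows "\<exists>y. y \<in> root_space H (- \<phi>) \<and> y \<noteq> 0 \<and> lie x y = \<phi>"
proof -
  obtain y where y: "y \<in> weight_space (\<lambda>h. - killing \<phi> h)" "killing x y = 1"
    using dual_weight_vector[of x "killing \<phi>"] x by (auto simp: root_space_eq)
  then have "y \<in> root_space H (- \<phi>)" by (simp add: root_space_eq killing_minus_left[abs_def])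
  moreover from this have "lie x y = \<phi>" using lie_opposite_root_spaces[OF x(1) _ \<phi>] y by simp
  ultimately show ?thesis using y(2) by auto
qed

lemma root_uminus:
  assumes "\<phi> \<in> roots H" shows "- \<phi> \<in> roots H"
proof -
  obtain x where "x \<in> root_space H \<phi>" "x \<noteq> 0" "\<phi> \<in> H" "\<phi> \<noteq> 0" using assms by (auto simp: roots_iff)
  then show ?thesis using opposite_root_vector[of x \<phi>] by (auto simp: roots_iff H_minus)
qed

end

context root_basis
begin

lemma B_root_space: "b \<in> B \<Longrightarrow> b \<in> root_space H (t b)"
  using B_weight_space by (simp add: root_space_eq)

lemma B_nonzero: "b \<in> B \<Longrightarrow> b \<noteq> 0"
  using independent_B cvec.dependent_zero by blast

lemma t_root: "b \<in> B \<Longrightarrow> t b = 0 \<or> t b \<in> roots H"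
  using B_root_space B_nonzero t_H by (auto simp: roots_iff)

lemma t_unique: "b \<in> B \<Longrightarrow> b \<in> root_space H \<phi> \<Longrightarrow> \<phi> \<in> H \<Longrightarrow> t b = \<phi>"
  by (rule root_space_unique[OF B_root_space _ B_nonzero t_H]) auto

lemma root_vector_in_span:
  assumes x: "x \<in> root_space H \<phi>" and \<phi>: "\<phi> \<in> H" and S: "\<And>b. b \<in> B \<Longrightarrow> t b = \<phi> \<Longrightarrow> b \<in> S"
  shows "x \<in> cvec.span S"
proof (rule weight_vector_in_span[of x "killing \<phi>"])
  show "x \<in> weight_space (killing \<phi>)" using x by (simp add: root_space_eq)
  fix b assume b: "b \<in> B" and "\<And>h. h \<in> H \<Longrightarrow> killing (t b) h = killing \<phi> h"
  then have "t b = \<phi>" using t_H \<phi> by (intro H_eqI) auto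
  then show "b \<in> S" using S b by blast
qed

lemma root_has_basis_vector:
  assumes "\<phi> \<in> roots H"
  shows "\<exists>b\<in>B. t b = \<phi>"
proof (rule ccontr)
  assume no: "\<not> ?thesis"
  obtain x where x: "x \<in> root_space H \<phi>" "x \<noteq> 0" "\<phi> \<in> H" using assms by (auto simp: roots_iff)
  have "x \<in> cvec.span {}" by (rule root_vector_in_span[OF x(1) x(3)]) (use no in auto)
  then show False using x by simp
qed

lemma finite_roots_aux: "finite (roots H)"
proof (rule finite_subset)
  show "roots H \<subseteq> t ` B" using root_has_basis_vector by blast
qed (simp add: finite_B)

lemma weights_proportional_root:
  assumes "\<phi> \<in> roots H" "b \<in> B"
  shows "\<exists>q::real. killing (t b) \<phi> = of_real q * killing \<phi> \<phi>"
proof -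
  obtain x where x: "x \<in> root_space H \<phi>" "x \<noteq> 0" "\<phi> \<in> H" using assms by (auto simp: roots_iff)
  obtain y where y: "y \<in> root_space H (- \<phi>)" "lie x y = \<phi>" using opposite_root_vector[OF x] by blast
  show ?thesis
    using weights_proportional[of x "killing \<phi>" y b] x y assms
    by (simp add: root_space_eq killing_minus_left[abs_def])
qed

text \<open>Proportionality turns the trace formula for \<open>(\<phi>, \<phi>)\<close> into \<open>(\<phi>, \<phi>) = (\<phi>, \<phi>)\<^sup>2 * (\<Sum>q\<^sup>2)\<close>
  with real \<open>q\<close>.\<close>

lemma killing_root_real_aux:
  assumes "\<phi> \<in> roots H"
  shows "\<exists>r>0. killing \<phi> \<phi> = of_real r" "\<psi> \<in> roots H \<Longrightarrow> \<exists>r. killing \<psi> \<phi> = of_real r"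
proof -
  have "\<forall>b\<in>B. \<exists>q::real. killing (t b) \<phi> = of_real q * killing \<phi> \<phi>"
    using weights_proportional_root[OF assms] by blast
  from bchoice[OF this] obtain q :: "'g \<Rightarrow> real"
    where q: "\<And>b. b \<in> B \<Longrightarrow> killing (t b) \<phi> = of_real (q b) * killing \<phi> \<phi>" by blast
  have nz: "killing \<phi> \<phi> \<noteq> 0"
  proof
    assume "killing \<phi> \<phi> = 0"
    then have "\<phi> = 0" using q rootsD[OF assms] by (intro H_weights_zero) auto
    then show False using rootsD[OF assms] by simp
  qed
  have "killing \<phi> \<phi> = (\<Sum>b\<in>B. (of_real (q b) * killing \<phi> \<phi>) * (of_real (q b) * killing \<phi> \<phi>))"
    using rootsD(1)[OF assms] by (subst killing_H) (auto simp: q intro!: sum.cong)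
  also have "\<dots> = of_real (\<Sum>b\<in>B. (q b)\<^sup>2) * (killing \<phi> \<phi>)\<^sup>2"
    by (simp add: sum_distrib_left sum_distrib_right power2_eq_square mult_ac)
  finally have eq: "of_real (\<Sum>b\<in>B. (q b)\<^sup>2) * killing \<phi> \<phi> = 1" using nz
    by (simp add: power2_eq_square del: of_real_sum)
  have "(\<Sum>b\<in>B. (q b)\<^sup>2) \<noteq> 0" using eq by (auto simp del: of_real_sum)
  then have pos: "(\<Sum>b\<in>B. (q b)\<^sup>2) > 0" by (simp add: less_le sum_nonneg)
  have kr: "killing \<phi> \<phi> = of_real (1 / (\<Sum>b\<in>B. (q b)\<^sup>2))"
    using eq pos by (simp add: field_simps del: of_real_sum)
  then show "\<exists>r>0. killing \<phi> \<phi> = of_real r" using pos by (metis zero_less_divide_1_iff)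
  assume "\<psi> \<in> roots H"
  then obtain b where "b \<in> B" "t b = \<psi>" using root_has_basis_vector by blast
  then have "killing \<psi> \<phi> = of_real (q b * (1 / (\<Sum>b\<in>B. (q b)\<^sup>2)))" using q kr by (metis of_real_mult)
  then show "\<exists>r. killing \<psi> \<phi> = of_real r" by blast
qed

end

context cartan
begin

lemma root_basis_ex: "\<exists>B t. root_basis H B t"
  using root_basis_exists[OF empty_subsetI cvec.independent_empty] by blast

lemma finite_roots: "finite (roots H)"
  using root_basis_ex root_basis.finite_roots_aux by blast

lemma kf_root_pos: "\<phi> \<in> roots H \<Longrightarrow> kf \<phi> \<phi> > 0"
  using root_basis_ex root_basis.killing_root_real_aux(1) unfolding kf_def by fastforce

lemma killing_roots: "\<phi> \<in> roots H \<Longrightarrow> \<psi> \<in> roots H \<Longrightarrow> killing \<psi> \<phi> = of_real (kf \<psi> \<phi>)"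
  using root_basis_ex root_basis.killing_root_real_aux(2) unfolding kf_def by (metis Re_complex_of_real)

lemma real_form_root: "\<phi> \<in> roots H \<Longrightarrow> \<phi> \<in> real_form H"
  unfolding real_form_def by (rule span_base)

lemma real_form_subset_H: "x \<in> real_form H \<Longrightarrow> x \<in> H"
  unfolding real_form_def
proof (induction rule: span_induct_alt)
  case (step c x y)
  then show ?case by (intro H_add H_scaleR) (auto dest: rootsD)
qed (rule H_0)

lemma killing_real_form:
  assumes "x \<in> real_form H" "y \<in> real_form H"
  shows "killing x y = of_real (kf x y)"
proof -
  have 1: "killing \<phi> y = of_real (kf \<phi> y)" if \<phi>: "\<phi> \<in> roots H" for \<phi>
    using assms(2) unfolding real_form_def
  proof (induction rule: span_induct_alt)
    case (step c x y)
    then show ?case using killing_roots[OF _ \<phi>] by (simp add: killing_add_right scaleR_scaleC killing_scale_right kf_simps kf_def)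
  qed (simp add: kf_def)
  show ?thesis
    using assms(1) unfolding real_form_def
  proof (induction rule: span_induct_alt)
    case (step c x y)
    then show ?case using 1 by (simp add: killing_add_left killing_scaleR kf_simps)
  qed (simp add: kf_def)
qed

text \<open>For root vectors \<open>x\<close>, \<open>y\<close> with \<open>[x, y] = \<phi>\<close>, the span of \<open>y\<close>, \<open>\<phi>\<close> and the root spaces
  of all positive multiples \<open>k\<phi>\<close> is invariant. The vanishing trace of \<open>ad \<phi>\<close> says that the
  sum of \<open>k\<close> times the dimension of the root space of \<open>k\<phi>\<close> is one.\<close>

lemma root_multiples:
  assumes \<phi>: "\<phi> \<in> roots H"
  shows "\<exists>b. \<forall>x\<in>root_space H \<phi>. \<exists>c. x = c *\<^sub>C b"
    and "k \<ge> 2 \<Longrightarrow> real k *\<^sub>R \<phi> \<notin> roots H"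
proof -
  obtain x where x: "x \<in> root_space H \<phi>" "x \<noteq> 0" "\<phi> \<in> H" "\<phi> \<noteq> 0" using \<phi> by (auto simp: roots_iff)
  obtain y where y: "y \<in> root_space H (- \<phi>)" "y \<noteq> 0" "lie x y = \<phi>"
    using opposite_root_vector[OF x(1-3)] by blast
  have "y \<notin> cvec.span {\<phi>}"
  proof
    assume "y \<in> cvec.span {\<phi>}"
    then have "y \<in> root_space H 0" using x(3) by (auto simp: cvec.span_singleton root_space_0 H_scale)
    then have "- \<phi> = 0" using root_space_unique[OF y(1) _ y(2)] x(3) H_0 H_minus by blast
    then show False using x by simp
  qed
  then have ind: "cvec.independent {y, \<phi>}" using x(4) by (auto simp: cvec.independent_insert)
  have wv: "{y, \<phi>} \<subseteq> weight_vectors"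
    using y(1) x(3) by (auto simp: weight_vectors_def root_space_def abelian_H intro: exI[of _ "\<lambda>_. 0"])
  obtain B t where Bt: "{y, \<phi>} \<subseteq> B" "root_basis H B t" using root_basis_exists[OF wv ind] by blast
  interpret root_basis H B t by (rule Bt(2))
  have ty: "t y = - \<phi>" using Bt y x(3) by (intro t_unique) (auto simp: H_minus)
  have t\<phi>: "t \<phi> = 0" using Bt x(3) by (intro t_unique) (auto simp: root_space_0 H_0)
  define S' where "S' = {b\<in>B. \<exists>k::nat. k \<ge> 1 \<and> t b = real k *\<^sub>R \<phi>}"
  define S where "S = {y, \<phi>} \<union> S'"
  have "\<forall>b\<in>S'. \<exists>k::nat. k \<ge> 1 \<and> t b = real k *\<^sub>R \<phi>" unfolding S'_def by blast
  from bchoice[OF this] obtain m :: "'g \<Rightarrow> nat" where m: "\<And>b. b \<in> S' \<Longrightarrow> m b \<ge> 1 \<and> t b = real (m b) *\<^sub>R \<phi>"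
    by blast
  have in_S: "z \<in> cvec.span S" if "z \<in> root_space H (real k *\<^sub>R \<phi>)" "k \<ge> 1" for z and k :: nat
    using that x(3) by (intro root_vector_in_span[of z "real k *\<^sub>R \<phi>"]) (auto simp: S_def S'_def H_scaleR)
  have S'_space: "b \<in> root_space H (real (m b) *\<^sub>R \<phi>)" if "b \<in> S'" for b
    using m[OF that] B_root_space[of b] that by (auto simp: S'_def)
  have "(\<Sum>b\<in>S. killing (t b) (lie x y)) = 0"
  proof (rule sum_weights_invariant_span)
    show "S \<subseteq> B" using Bt by (auto simp: S_def S'_def)
    show "lie x y \<in> H" using y x by simp
    show "lie x b \<in> cvec.span S" if bS: "b \<in> S" for b
    proof -
      consider "b = y" | "b = \<phi>" | "b \<in> S'" using bS S_def by blast
      then show ?thesis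
      proof cases
        case 1
        then show ?thesis using y by (auto simp: S_def intro: cvec.span_base)
      next
        case 2
        then have "lie x b = - killing \<phi> \<phi> *\<^sub>C x"
          using x lie_antisym[of x \<phi>] by (simp add: root_space_def cvec.scale_minus_left)
        then show ?thesis using in_S[of x 1] x by (simp add: cvec.span_neg cvec.span_scale)
      next
        case 3
        have "lie x b \<in> root_space H (real (m b + 1) *\<^sub>R \<phi>)"
          using lie_root_space[OF x(1) S'_space[OF 3]] by (simp add: scaleR_left_distrib add.commute)
        then show ?thesis by (rule in_S) simp
      qed
    qed
    show "lie y b \<in> cvec.span S" if bS: "b \<in> S" for b
    proof -
      consider "b = y" | "b = \<phi>" | "b \<in> S'" using bS S_def by blast
      then show ?thesis
      proof cases
        case 1
        then show ?thesis by (simp add: lie_self cvec.span_zero)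
      next
        case 2
        then have "lie y b = killing \<phi> \<phi> *\<^sub>C y"
          using y x lie_antisym[of y \<phi>] by (simp add: root_space_def cvec.scale_minus_left killing_minus_left)
        then show ?thesis by (auto simp: S_def intro: cvec.span_scale cvec.span_base)
      next
        case 3
        show ?thesis
        proof (cases "m b = 1")
          case True
          then have "lie b y = killing b y *\<^sub>C \<phi>"
            using lie_opposite_root_spaces[of b \<phi> y] S'_space[OF 3] y x by simp
          then have "lie y b = - (killing b y *\<^sub>C \<phi>)" using lie_antisym[of y b] by simp
          moreover have "\<phi> \<in> cvec.span S" by (rule cvec.span_base) (simp add: S_def)
          ultimately show ?thesis by (simp add: cvec.span_neg cvec.span_scale)
        next
          case False
          then have ge: "m b \<ge> 2" using m[OF 3] by simp
          have "lie y b \<in> root_space H (real (m b - 1) *\<^sub>R \<phi>)"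
            using lie_root_space[OF y(1) S'_space[OF 3]] ge by (simp add: scaleR_left_diff_distrib of_nat_diff)
          then show ?thesis by (rule in_S) (use ge in simp)
        qed
      qed
    qed
  qed
  moreover have "(\<Sum>b\<in>S. killing (t b) \<phi>) = - killing \<phi> \<phi> + (\<Sum>b\<in>S'. killing (t b) \<phi>)"
  proof -
    have "y \<noteq> \<phi>" using ty t\<phi> x by auto
    moreover have "y \<notin> S'"
    proof
      assume "y \<in> S'"
      then have "real (m y) *\<^sub>R \<phi> = - \<phi>" using m[of y] ty by simp
      then have "real (m y + 1) *\<^sub>R \<phi> = 0" by (simp add: scaleR_left_distrib)
      then show False using x by simp
    qed
    moreover have "\<phi> \<notin> S'" using m[of \<phi>] t\<phi> x by auto
    moreover have "finite S'" using finite_B by (simp add: S'_def)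
    ultimately show ?thesis unfolding S_def by (simp add: ty t\<phi> killing_minus_left)
  qed
  moreover have "(\<Sum>b\<in>S'. killing (t b) \<phi>) = of_nat (\<Sum>b\<in>S'. m b) * killing \<phi> \<phi>"
    using m by (simp add: killing_scaleR sum_distrib_right)
  ultimately have "of_nat (\<Sum>b\<in>S'. m b) * killing \<phi> \<phi> = killing \<phi> \<phi>" using y(3) by (simp del: of_nat_sum)
  moreover have "killing \<phi> \<phi> \<noteq> 0" using kf_root_pos[OF \<phi>] by (auto simp: kf_def)
  ultimately have one: "(\<Sum>b\<in>S'. m b) = 1" by (metis mult_cancel_right1 of_nat_eq_1_iff)
  obtain b where b: "b \<in> B" "t b = \<phi>" using root_has_basis_vector[OF \<phi>] by blast
  then have bS': "b \<in> S'" unfolding S'_def by (auto intro: exI[of _ 1])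
  \<comment> \<open>A positive integer-valued function on \<open>S'\<close> with sum one leaves room for a single element.\<close>
  have S'b: "S' = {b}"
  proof (rule ccontr)
    assume "S' \<noteq> {b}"
    then obtain c where c: "c \<in> S'" "c \<noteq> b" using bS' by blast
    have "(\<Sum>b\<in>{b, c}. m b) \<le> (\<Sum>b\<in>S'. m b)"
      using finite_B bS' c by (intro sum_mono2) (auto simp: S'_def)
    then show False using one m[OF bS'] m[OF c(1)] c by simp
  qed
  have "\<exists>c. z = c *\<^sub>C b" if "z \<in> root_space H \<phi>" for z
  proof -
    have "z \<in> cvec.span {b}"
    proof (rule root_vector_in_span[OF that x(3)])
      fix d assume "d \<in> B" "t d = \<phi>"
      then have "d \<in> S'" unfolding S'_def by (auto intro: exI[of _ 1])
      then show "d \<in> {b}" using S'b by simp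
    qed
    then show ?thesis by (auto simp: cvec.span_singleton)
  qed
  then show "\<exists>b. \<forall>x\<in>root_space H \<phi>. \<exists>c. x = c *\<^sub>C b" by blast
  assume k: "k \<ge> 2"
  show "real k *\<^sub>R \<phi> \<notin> roots H"
  proof
    assume "real k *\<^sub>R \<phi> \<in> roots H"
    then obtain d where d: "d \<in> B" "t d = real k *\<^sub>R \<phi>" using root_has_basis_vector by blast
    then have "d \<in> S'" using k unfolding S'_def by (auto intro!: exI[of _ k])
    then have "real k *\<^sub>R \<phi> = 1 *\<^sub>R \<phi>" using S'b d b by simp
    then show False using k x(4) by (simp only: scaleR_cancel_right) simp
  qed
qed

lemma root_space_1dim:
  assumes \<phi>: "\<phi> \<in> roots H" and x: "x \<in> root_space H \<phi>" "x \<noteq> 0" and y: "y \<in> root_space H \<phi>"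
  shows "\<exists>c. y = c *\<^sub>C x"
proof -
  obtain b where b: "\<And>x. x \<in> root_space H \<phi> \<Longrightarrow> \<exists>c. x = c *\<^sub>C b" using root_multiples(1)[OF \<phi>] by blast
  obtain c d where cd: "x = c *\<^sub>C b" "y = d *\<^sub>C b" using b x y by blast
  then have "y = (d / c) *\<^sub>C x" using x by auto
  then show ?thesis ..
qed

end

context root_basis
begin

lemma root_basis_vector_unique:
  assumes "b \<in> B" "c \<in> B" "t b = t c" "t b \<in> roots H"
  shows "b = c"
proof (rule ccontr)
  assume "b \<noteq> c"
  obtain a where a: "c = a *\<^sub>C b"
    using root_space_1dim[OF assms(4) B_root_space[OF assms(1)] B_nonzero[OF assms(1)]]
      B_root_space[OF assms(2)] assms(3) by metis
  then have "coord c c = a * coord b c" by (metis coord_scale)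
  then show False using assms \<open>b \<noteq> c\<close> by (simp add: coord_basis)
qed

definition root_vec :: "'g \<Rightarrow> 'g" where
  "root_vec \<phi> = (SOME b. b \<in> B \<and> t b = \<phi>)"

lemma root_vec: "\<phi> \<in> roots H \<Longrightarrow> root_vec \<phi> \<in> B" "\<phi> \<in> roots H \<Longrightarrow> t (root_vec \<phi>) = \<phi>"
  using root_has_basis_vector[of \<phi>] someI_ex[of "\<lambda>b. b \<in> B \<and> t b = \<phi>"] unfolding root_vec_def by auto

lemma root_vec_t: "b \<in> B \<Longrightarrow> t b \<in> roots H \<Longrightarrow> root_vec (t b) = b"
  using root_basis_vector_unique root_vec by metis

lemma inj_root_vec: "inj_on root_vec (roots H)"
  using root_vec(2) by (metis inj_onI)

text \<open>The segment spans an invariant subspace because \<open>x\<close> kills its top and \<open>y\<close> kills its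
  bottom. As its root spaces are lines, the trace of \<open>ad \<phi>\<close> is an arithmetic series.\<close>

lemma segment_trace:
  fixes m n :: int
  assumes \<phi>: "\<phi> \<in> roots H" and \<beta>: "\<beta> \<in> H"
    and seg: "\<And>k. m \<le> k \<Longrightarrow> k \<le> n \<Longrightarrow> \<beta> + of_int k *\<^sub>R \<phi> \<in> roots H"
    and x: "x \<in> root_space H \<phi>" and y: "y \<in> root_space H (- \<phi>)" and xy: "lie x y = \<phi>"
    and top: "\<And>z. z \<in> root_space H (\<beta> + of_int n *\<^sub>R \<phi>) \<Longrightarrow> lie x z = 0"
    and bot: "\<And>z. z \<in> root_space H (\<beta> + of_int m *\<^sub>R \<phi>) \<Longrightarrow> lie y z = 0"
    and mn: "m \<le> n"
  shows "2 * killing \<beta> \<phi> + of_int (m + n) * killing \<phi> \<phi> = 0"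
proof -
  note \<phi>H = rootsD(1)[OF \<phi>] and \<phi>0 = rootsD(2)[OF \<phi>]
  define f where "f k = root_vec (\<beta> + of_int k *\<^sub>R \<phi>)" for k :: int
  have inj: "inj_on f {m..n}"
  proof (rule inj_onI)
    fix k l assume kl: "k \<in> {m..n}" "l \<in> {m..n}" "f k = f l"
    then have "\<beta> + of_int k *\<^sub>R \<phi> = \<beta> + of_int l *\<^sub>R \<phi>"
      using inj_onD[OF inj_root_vec, of "\<beta> + of_int k *\<^sub>R \<phi>" "\<beta> + of_int l *\<^sub>R \<phi>"] seg f_def by auto
    then show "k = l" using \<phi>0 by simp
  qed
  define S where "S = f ` {m..n}"
  have in_S: "z \<in> cvec.span S" if "z \<in> root_space H (\<beta> + of_int k *\<^sub>R \<phi>)" "m \<le> k" "k \<le> n" for z k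
  proof (rule root_vector_in_span[OF that(1)])
    show "\<beta> + of_int k *\<^sub>R \<phi> \<in> H" using \<beta> \<phi>H by (intro H_add H_scaleR)
    fix b assume "b \<in> B" "t b = \<beta> + of_int k *\<^sub>R \<phi>"
    then have "b = f k" using root_vec_t seg that f_def by metis
    then show "b \<in> S" using that by (simp add: S_def)
  qed
  have f_space: "f k \<in> root_space H (\<beta> + of_int k *\<^sub>R \<phi>)" if "m \<le> k" "k \<le> n" for k
    using seg[OF that] root_vec B_root_space f_def by metis
  have "(\<Sum>b\<in>S. killing (t b) (lie x y)) = 0"
  proof (rule sum_weights_invariant_span)
    show "S \<subseteq> B" using seg root_vec(1) by (auto simp: S_def f_def)
    show "lie x y \<in> H" using xy \<phi>H by simp
    show "lie x b \<in> cvec.span S" if bS: "b \<in> S" for b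
    proof -
      obtain k where k: "m \<le> k" "k \<le> n" "b = f k" using bS by (auto simp: S_def)
      show ?thesis
      proof (cases "k = n")
        case True
        then have "lie x b = 0" using top f_space k by auto
        then show ?thesis by (simp add: cvec.span_zero)
      next
        case False
        have "lie x b \<in> root_space H (\<beta> + of_int (k + 1) *\<^sub>R \<phi>)"
          using lie_root_space[OF x f_space[OF k(1,2)]] k(3) by (simp add: algebra_simps)
        then show ?thesis by (rule in_S) (use k False in auto)
      qed
    qed
    show "lie y b \<in> cvec.span S" if bS: "b \<in> S" for b
    proof -
      obtain k where k: "m \<le> k" "k \<le> n" "b = f k" using bS by (auto simp: S_def)
      show ?thesis
      proof (cases "k = m")
        case True
        then have "lie y b = 0" using bot f_space k by auto
        then show ?thesis by (simp add: cvec.span_zero)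
      next
        case False
        have "lie y b \<in> root_space H (\<beta> + of_int (k - 1) *\<^sub>R \<phi>)"
          using lie_root_space[OF y f_space[OF k(1,2)]] k(3) by (simp add: algebra_simps)
        then show ?thesis by (rule in_S) (use k False in auto)
      qed
    qed
  qed
  then have "0 = (\<Sum>k\<in>{m..n}. killing (t (f k)) \<phi>)"
    unfolding S_def xy by (subst (asm) sum.reindex[OF inj]) simp
  also have "\<dots> = (\<Sum>k\<in>{m..n}. killing \<beta> \<phi> + of_int k * killing \<phi> \<phi>)"
    using seg root_vec(2) by (intro sum.cong) (auto simp: f_def killing_add_left killing_scaleR)
  also have "\<dots> = of_int (n - m + 1) * killing \<beta> \<phi> + of_int (\<Sum>{m..n}) * killing \<phi> \<phi>"
    using mn by (simp add: sum.distrib sum_distrib_right)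
  finally have "0 = 2 * (of_int (n - m + 1) * killing \<beta> \<phi> + of_int (\<Sum>{m..n}) * killing \<phi> \<phi>)" by simp
  also have "\<dots> = of_int (n - m + 1) * (2 * killing \<beta> \<phi>) + of_int (2 * \<Sum>{m..n}) * killing \<phi> \<phi>"
    by (simp add: algebra_simps)
  also have "2 * \<Sum>{m..n} = (n - m + 1) * (m + n)"
    using mn
  proof (induction n rule: int_ge_induct)
    case base
    show ?case by simp
  next
    case (step i)
    have "{m..i + 1} = insert (i + 1) {m..i}" using step by auto
    then show ?case using step by (simp add: algebra_simps)
  qed
  finally have "of_int (n - m + 1) * (2 * killing \<beta> \<phi> + of_int (m + n) * killing \<phi> \<phi>) = 0"
    by (simp add: algebra_simps)
  moreover have "of_int (n - m + 1) \<noteq> (0::complex)" using mn unfolding of_int_eq_0_iff by linarith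
  ultimately show ?thesis using mult_eq_0_iff by blast
qed

end

context cartan
begin

lemma nonroot_space_zero:
  "z \<in> root_space H \<gamma> \<Longrightarrow> \<gamma> \<in> H \<Longrightarrow> \<gamma> \<noteq> 0 \<Longrightarrow> \<gamma> \<notin> roots H \<Longrightarrow> z = 0"
  by (auto simp: roots_iff)

lemma root_line_nonzero:
  assumes \<beta>: "\<beta> \<in> roots H" and \<phi>: "\<phi> \<in> roots H" and ne: "\<beta> \<noteq> \<phi>" "\<beta> \<noteq> - \<phi>"
  shows "\<beta> + of_int k *\<^sub>R \<phi> \<noteq> 0"
proof
  assume "\<beta> + of_int k *\<^sub>R \<phi> = 0"
  then have b: "\<beta> = of_int (- k) *\<^sub>R \<phi>" by (simp add: add_eq_0_iff2)
  consider "k = 0" | "k = 1" | "k = -1" | "k \<le> -2" | "k \<ge> 2" by linarith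
  then show False
  proof cases
    case 4
    then have "\<beta> = real (nat (- k)) *\<^sub>R \<phi>" using b by simp
    then show False using root_multiples(2)[OF \<phi>, of "nat (- k)"] \<beta> 4 by simp
  next
    case 5
    then have "- \<beta> = real (nat k) *\<^sub>R \<phi>" using b by simp
    then show False using root_multiples(2)[OF \<phi>, of "nat k"] root_uminus[OF \<beta>] 5 by simp
  qed (use b ne rootsD(2)[OF \<beta>] in auto)
qed

lemma string_space_zero:
  assumes \<beta>: "\<beta> \<in> roots H" and \<phi>: "\<phi> \<in> roots H" and ne: "\<beta> \<noteq> \<phi>" "\<beta> \<noteq> - \<phi>"
    and "z \<in> root_space H (\<beta> + of_int k *\<^sub>R \<phi>)" "\<beta> + of_int k *\<^sub>R \<phi> \<notin> roots H"
  shows "z = 0"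
  using assms root_line_nonzero[OF \<beta> \<phi> ne, of k]
  by (intro nonroot_space_zero[of z "\<beta> + of_int k *\<^sub>R \<phi>"]) (auto intro: H_add H_scaleR rootsD)

lemma string_end:
  assumes \<phi>: "\<phi> \<noteq> 0" and \<beta>: "\<beta> \<in> roots H"
  shows "\<exists>q::nat. (\<forall>k\<le>q. \<beta> + real k *\<^sub>R \<phi> \<in> roots H) \<and> \<beta> + real (Suc q) *\<^sub>R \<phi> \<notin> roots H"
proof -
  have "inj (\<lambda>n::nat. \<beta> + real n *\<^sub>R \<phi>)" using \<phi> by (auto simp: inj_def)
  then have "\<not> range (\<lambda>n::nat. \<beta> + real n *\<^sub>R \<phi>) \<subseteq> roots H"
    using finite_roots by (metis finite_subset finite_imageD infinite_UNIV_nat)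
  then have ex: "\<exists>n::nat. \<beta> + real n *\<^sub>R \<phi> \<notin> roots H" by blast
  define n where "n = (LEAST n::nat. \<beta> + real n *\<^sub>R \<phi> \<notin> roots H)"
  have n: "\<beta> + real n *\<^sub>R \<phi> \<notin> roots H" unfolding n_def by (rule LeastI_ex[OF ex])
  have less: "\<beta> + real k *\<^sub>R \<phi> \<in> roots H" if "k < n" for k
    using not_less_Least[of k "\<lambda>n. \<beta> + real n *\<^sub>R \<phi> \<notin> roots H"] that unfolding n_def by blast
  have "n \<noteq> 0" using n \<beta> by (intro notI) simp
  then obtain q where "n = Suc q" using not0_implies_Suc by blast
  then show ?thesis using n less by (auto intro!: exI[of _ q])
qed

lemma segment_trace_kf:
  fixes m n :: int
  assumes \<phi>: "\<phi> \<in> roots H" and \<beta>: "\<beta> \<in> roots H" and ne: "\<beta> \<noteq> \<phi>" "\<beta> \<noteq> - \<phi>"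
    and seg: "\<And>k. m \<le> k \<Longrightarrow> k \<le> n \<Longrightarrow> \<beta> + of_int k *\<^sub>R \<phi> \<in> roots H" and mn: "m \<le> n"
    and x: "x \<in> root_space H \<phi>" "x \<noteq> 0"
    and top: "\<And>z. z \<in> root_space H (\<beta> + of_int n *\<^sub>R \<phi>) \<Longrightarrow> lie x z = 0"
    and bot: "\<beta> + of_int (m - 1) *\<^sub>R \<phi> \<notin> roots H"
  shows "2 * kf \<beta> \<phi> = - of_int (m + n) * kf \<phi> \<phi>"
proof -
  obtain y where y: "y \<in> root_space H (- \<phi>)" "lie x y = \<phi>"
    using opposite_root_vector[OF x rootsD(1)[OF \<phi>]] by blast
  obtain B t where "root_basis H B t" using root_basis_ex by blast
  then interpret root_basis H B t .
  have "2 * killing \<beta> \<phi> + of_int (m + n) * killing \<phi> \<phi> = 0"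
  proof (rule segment_trace[OF \<phi> rootsD(1)[OF \<beta>] seg x(1) y top _ mn])
    fix z assume z: "z \<in> root_space H (\<beta> + of_int m *\<^sub>R \<phi>)"
    have "lie y z \<in> root_space H (\<beta> + of_int (m - 1) *\<^sub>R \<phi>)"
      using lie_root_space[OF y(1) z] by (simp add: algebra_simps)
    then show "lie y z = 0"
      using bot by (rule string_space_zero[OF \<beta> \<phi> ne])
  qed
  then have "of_real (2 * kf \<beta> \<phi> + of_int (m + n) * kf \<phi> \<phi>) = (0::complex)"
    by (simp add: killing_roots \<beta> \<phi>)
  then have "2 * kf \<beta> \<phi> + of_int (m + n) * kf \<phi> \<phi> = 0" by (simp only: of_real_eq_0_iff)
  then show ?thesis by (simp add: algebra_simps)
qed

text \<open>A maximal segment through \<open>\<beta>\<close> is invariant, and its trace identity locates \<open>\<beta>\<close> within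
  it.\<close>

lemma root_string:
  assumes \<phi>: "\<phi> \<in> roots H" and \<beta>: "\<beta> \<in> roots H" and ne: "\<beta> \<noteq> \<phi>" "\<beta> \<noteq> - \<phi>"
  shows "\<exists>r q::nat. (\<forall>k. - int r \<le> k \<and> k \<le> int q \<longrightarrow> \<beta> + of_int k *\<^sub>R \<phi> \<in> roots H)
    \<and> \<beta> - (real r + 1) *\<^sub>R \<phi> \<notin> roots H \<and> \<beta> + (real q + 1) *\<^sub>R \<phi> \<notin> roots H
    \<and> 2 * kf \<beta> \<phi> = (real r - real q) * kf \<phi> \<phi>"
proof -
  note \<phi>0 = rootsD(2)[OF \<phi>]
  obtain q :: nat where q: "\<And>k. k \<le> q \<Longrightarrow> \<beta> + real k *\<^sub>R \<phi> \<in> roots H" "\<beta> + real (Suc q) *\<^sub>R \<phi> \<notin> roots H"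
    using string_end[OF \<phi>0 \<beta>] by blast
  obtain r :: nat where r: "\<And>k. k \<le> r \<Longrightarrow> \<beta> + real k *\<^sub>R (- \<phi>) \<in> roots H" "\<beta> + real (Suc r) *\<^sub>R (- \<phi>) \<notin> roots H"
    using string_end[OF _ \<beta>, of "- \<phi>"] \<phi>0 by auto
  have seg: "\<beta> + of_int k *\<^sub>R \<phi> \<in> roots H" if "- int r \<le> k" "k \<le> int q" for k
  proof (cases "k \<ge> 0")
    case True
    then show ?thesis using q(1)[of "nat k"] that by simp
  next
    case False
    then show ?thesis using r(1)[of "nat (- k)"] that by simp
  qed
  obtain x where x: "x \<in> root_space H \<phi>" "x \<noteq> 0" using \<phi> by (auto simp: roots_iff)
  have "2 * kf \<beta> \<phi> = - of_int (- int r + int q) * kf \<phi> \<phi>"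
  proof (rule segment_trace_kf[OF \<phi> \<beta> ne seg _ x])
    show "\<beta> + of_int (- int r - 1) *\<^sub>R \<phi> \<notin> roots H" using r(2) by (simp add: algebra_simps)
    fix z assume z: "z \<in> root_space H (\<beta> + of_int (int q) *\<^sub>R \<phi>)"
    have "lie x z \<in> root_space H (\<beta> + of_int (int q + 1) *\<^sub>R \<phi>)"
      using lie_root_space[OF x(1) z] by (simp add: algebra_simps)
    moreover have "\<beta> + of_int (int q + 1) *\<^sub>R \<phi> \<notin> roots H" using q(2) by (simp add: add.commute)
    ultimately show "lie x z = 0"
      by (rule string_space_zero[OF \<beta> \<phi> ne])
  qed auto
  then show ?thesis using seg q(2) r(2)
    by (intro exI[of _ r] exI[of _ q]) (auto simp: algebra_simps)
qed

text \<open>If the bracket vanished, the part of the root string below \<open>\<beta>\<close> would be invariant by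
  itself, and its trace identity would contradict that of the full string.\<close>

lemma lie_root_vectors_nonzero:
  assumes \<phi>: "\<phi> \<in> roots H" and \<beta>: "\<beta> \<in> roots H" and sum: "\<phi> + \<beta> \<in> roots H"
    and x: "x \<in> root_space H \<phi>" "x \<noteq> 0" and z: "z \<in> root_space H \<beta>" "z \<noteq> 0"
  shows "lie x z \<noteq> 0"
proof
  assume xz: "lie x z = 0"
  have ne: "\<beta> \<noteq> \<phi>" "\<beta> \<noteq> - \<phi>"
    using sum root_multiples(2)[OF \<phi>, of 2] rootsD(2)[OF sum] by (auto simp: scaleR_2)
  obtain r q :: nat where rq: "\<And>k. - int r \<le> k \<Longrightarrow> k \<le> int q \<Longrightarrow> \<beta> + of_int k *\<^sub>R \<phi> \<in> roots H"
      "\<beta> - (real r + 1) *\<^sub>R \<phi> \<notin> roots H" "\<beta> + (real q + 1) *\<^sub>R \<phi> \<notin> roots H"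
      "2 * kf \<beta> \<phi> = (real r - real q) * kf \<phi> \<phi>"
    using root_string[OF \<phi> \<beta> ne] by blast
  have "q \<noteq> 0" using rq(3) sum by (intro notI) (simp add: add.commute)
  \<comment> \<open>The segment from \<open>\<beta> - r\<phi>\<close> up to \<open>\<beta>\<close>, invariant because \<open>x\<close> kills the root space of \<open>\<beta>\<close>.\<close>
  have "2 * kf \<beta> \<phi> = - of_int (- int r + 0) * kf \<phi> \<phi>"
  proof (rule segment_trace_kf[OF \<phi> \<beta> ne rq(1) _ x])
    fix u assume "u \<in> root_space H (\<beta> + of_int 0 *\<^sub>R \<phi>)"
    then obtain c where "u = c *\<^sub>C z" using root_space_1dim[OF \<beta> z] by auto
    then show "lie x u = 0" using xz by (simp add: lie_scaleC_right)
  qed (use rq(2) in \<open>auto simp: algebra_simps\<close>)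
  then have "real q * kf \<phi> \<phi> = 0" using rq(4) by (simp add: algebra_simps)
  then show False using \<open>q \<noteq> 0\<close> kf_root_pos[OF \<phi>] by simp
qed

lemma cartan_integer:
  assumes \<phi>: "\<phi> \<in> roots H" and \<beta>: "\<beta> \<in> roots H"
  shows "\<exists>n::int. 2 * kf \<beta> \<phi> = of_int n * kf \<phi> \<phi> \<and> \<beta> - of_int n *\<^sub>R \<phi> \<in> roots H"
proof -
  consider "\<beta> = \<phi>" | "\<beta> = - \<phi>" | "\<beta> \<noteq> \<phi>" "\<beta> \<noteq> - \<phi>" by blast
  then show ?thesis
  proof cases
    case 1
    then show ?thesis using root_uminus[OF \<phi>] by (intro exI[of _ 2]) (auto simp: scaleR_2)
  next
    case 2
    then show ?thesis using \<phi> by (intro exI[of _ "-2"]) (auto simp: scaleR_2 kf_simps)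
  next
    case 3
    obtain r q :: nat where rq: "\<And>k. - int r \<le> k \<Longrightarrow> k \<le> int q \<Longrightarrow> \<beta> + of_int k *\<^sub>R \<phi> \<in> roots H"
      "2 * kf \<beta> \<phi> = (real r - real q) * kf \<phi> \<phi>"
    using root_string[OF \<phi> \<beta> 3] by blast
    show ?thesis using rq(2) rq(1)[of "int q - int r"]
      by (intro exI[of _ "int r - int q"]) (auto simp: algebra_simps)
  qed
qed

lemma root_add:
  assumes \<phi>: "\<phi> \<in> roots H" and \<beta>: "\<beta> \<in> roots H" and neg: "kf \<beta> \<phi> < 0" and ne: "\<beta> \<noteq> - \<phi>"
  shows "\<beta> + \<phi> \<in> roots H"
proof -
  have ne': "\<beta> \<noteq> \<phi>" using neg kf_root_pos[OF \<phi>] by auto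
  obtain r q :: nat where rq: "\<And>k. - int r \<le> k \<Longrightarrow> k \<le> int q \<Longrightarrow> \<beta> + of_int k *\<^sub>R \<phi> \<in> roots H"
      "2 * kf \<beta> \<phi> = (real r - real q) * kf \<phi> \<phi>"
    using root_string[OF \<phi> \<beta> ne' ne] by blast
  have "(real r - real q) * kf \<phi> \<phi> < 0" using rq(2) neg by simp
  then have "real r - real q < 0" using kf_root_pos[OF \<phi>] by (simp add: mult_less_0_iff)
  then show ?thesis using rq(1)[of 1] by simp
qed

lemma root_diff:
  assumes \<phi>: "\<phi> \<in> roots H" and \<beta>: "\<beta> \<in> roots H" and pos: "kf \<beta> \<phi> > 0" and ne: "\<beta> \<noteq> \<phi>"
  shows "\<beta> - \<phi> \<in> roots H"
  using root_add[OF root_uminus[OF \<phi>] \<beta>] pos ne by (simp add: kf_simps)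

text \<open>This is the trace formula for the form, each root space contributing once.\<close>

lemma kf_sum_roots:
  assumes x: "x \<in> real_form H" and y: "y \<in> real_form H"
  shows "kf x y = (\<Sum>\<phi>\<in>roots H. kf \<phi> x * kf \<phi> y)"
proof -
  obtain B t where "root_basis H B t" using root_basis_ex by blast
  then interpret root_basis H B t .
  have "of_real (kf x y) = killing x y" using killing_real_form x y by simp
  also have "\<dots> = (\<Sum>b\<in>B. killing (t b) x * killing (t b) y)"
    using x y real_form_subset_H by (intro killing_H) auto
  also have "\<dots> = (\<Sum>b\<in>root_vec ` roots H. killing (t b) x * killing (t b) y)"
  proof (rule sum.mono_neutral_right[OF finite_B])
    show "root_vec ` roots H \<subseteq> B" using root_vec by auto
    show "\<forall>b\<in>B - root_vec ` roots H. killing (t b) x * killing (t b) y = 0"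
      using t_root root_vec_t by (metis DiffD1 DiffD2 imageI killing_0(1) mult_zero_left)
  qed
  also have "\<dots> = (\<Sum>\<phi>\<in>roots H. of_real (kf \<phi> x) * of_real (kf \<phi> y))"
    by (subst sum.reindex[OF inj_root_vec])
      (auto simp: root_vec killing_real_form real_form_root x y intro!: sum.cong)
  also have "\<dots> = of_real (\<Sum>\<phi>\<in>roots H. kf \<phi> x * kf \<phi> y)" by simp
  finally show ?thesis by (simp only: of_real_eq_iff)
qed

text \<open>Roots \<open>\<alpha>\<close> in \<open>D\<close> and \<open>\<gamma>\<close> outside \<open>D\<close> have no root as their sum, because \<open>\<alpha> + \<gamma>\<close> would
  be orthogonal neither to \<open>\<alpha>\<close> nor to \<open>\<gamma>\<close>. Hence \<open>D\<close> and its root spaces span a nonzero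
  ideal, which misses the root vectors for roots outside \<open>D\<close>.\<close>

lemma roots_irreducible:
  assumes D: "D \<subseteq> roots H" "D \<noteq> {}"
    and orth: "\<And>\<alpha> \<beta>. \<alpha> \<in> D \<Longrightarrow> \<beta> \<in> roots H - D \<Longrightarrow> kf \<alpha> \<beta> = 0"
  shows "D = roots H"
proof (rule ccontr)
  assume "D \<noteq> roots H"
  then obtain \<beta> where \<beta>: "\<beta> \<in> roots H" "\<beta> \<notin> D" using D by blast
  obtain B t where "root_basis H B t" using root_basis_ex by blast
  then interpret root_basis H B t .
  have kill0: "killing \<alpha> \<gamma> = 0" if "\<alpha> \<in> D" "\<gamma> \<in> roots H" "\<gamma> \<notin> D" for \<alpha> \<gamma>
    using orth[of \<alpha> \<gamma>] killing_roots[of \<gamma> \<alpha>] that D by auto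
  have D_neg: "- \<alpha> \<in> D" if "\<alpha> \<in> D" for \<alpha>
  proof (rule ccontr)
    assume "- \<alpha> \<notin> D"
    then have "kf \<alpha> (- \<alpha>) = 0" using that root_uminus D by (intro orth) auto
    then show False using kf_root_pos[of \<alpha>] that D by (auto simp: kf_simps)
  qed
  have mixed: "\<alpha> + \<gamma> \<notin> roots H" if "\<alpha> \<in> D" "\<gamma> \<in> roots H" "\<gamma> \<notin> D" for \<alpha> \<gamma>
  proof
    assume r: "\<alpha> + \<gamma> \<in> roots H"
    have ag: "kf \<alpha> \<gamma> = 0" using orth that by blast
    have pos: "kf \<alpha> \<alpha> > 0" "kf \<gamma> \<gamma> > 0" using kf_root_pos that D by auto
    show False
    proof (cases "\<alpha> + \<gamma> \<in> D")
      case True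
      then have "kf (\<alpha> + \<gamma>) \<gamma> = 0" using orth that by blast
      then show False using ag pos by (simp add: kf_simps)
    next
      case False
      then have "kf \<alpha> (\<alpha> + \<gamma>) = 0" using orth that r by blast
      then show False using ag pos by (simp add: kf_simps)
    qed
  qed
  define I where "I = cvec.span (D \<union> (\<Union>\<alpha>\<in>D. root_space H \<alpha>))"
  have rsI: "u \<in> I" if "u \<in> root_space H \<alpha>" "\<alpha> \<in> D" for u \<alpha>
    using that unfolding I_def by (auto intro!: cvec.span_base)
  have DI: "\<alpha> \<in> I" if "\<alpha> \<in> D" for \<alpha>
    using that unfolding I_def by (auto intro!: cvec.span_base)
  have gen: "lie b g \<in> I" if b: "b \<in> B" and g: "g \<in> D \<union> (\<Union>\<alpha>\<in>D. root_space H \<alpha>)" for b g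
    using g
  proof
    assume gD: "g \<in> D"
    then have "lie b g = - killing (t b) g *\<^sub>C b"
      using B_root_space[OF b] lie_antisym[of b g] D rootsD(1) by (auto simp: root_space_def cvec.scale_minus_left)
    moreover have "killing (t b) g *\<^sub>C b \<in> I"
    proof -
      consider "t b = 0" | "t b \<in> D" | "t b \<in> roots H" "t b \<notin> D" using t_root[OF b] by blast
      then show ?thesis
      proof cases
        case 2
        then show ?thesis using rsI[OF B_root_space[OF b]] unfolding I_def by (intro cvec.span_scale)
      next
        case 3
        then show ?thesis using kill0[OF gD 3] by (simp add: killing_sym[of "t b"] I_def cvec.span_zero)
      qed (simp add: I_def cvec.span_zero)
    qed
    ultimately show ?thesis unfolding I_def by (simp add: cvec.span_neg cvec.scale_minus_left)
  next
    assume "g \<in> (\<Union>\<alpha>\<in>D. root_space H \<alpha>)"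
    then obtain \<alpha> where \<alpha>: "\<alpha> \<in> D" "g \<in> root_space H \<alpha>" by blast
    have \<alpha>H: "\<alpha> \<in> H" "\<alpha> \<in> roots H" using \<alpha> D rootsD by auto
    have bg: "lie b g \<in> root_space H (t b + \<alpha>)" by (rule lie_root_space[OF B_root_space[OF b] \<alpha>(2)])
    consider "t b = 0" | "t b = - \<alpha>" | "t b \<in> D" "t b \<noteq> - \<alpha>" | "t b \<in> roots H" "t b \<notin> D" using t_root[OF b] by blast
    then show ?thesis
    proof cases
      case 1
      then show ?thesis using bg \<alpha> rsI by simp
    next
      case 2
      then have "lie g b = killing g b *\<^sub>C \<alpha>"
        using lie_opposite_root_spaces[OF \<alpha>(2) _ \<alpha>H(1)] B_root_space[OF b] by simp
      then have "lie b g = - (killing g b *\<^sub>C \<alpha>)" using lie_antisym[of b g] by simp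
      then show ?thesis using DI[OF \<alpha>(1)] unfolding I_def by (simp add: cvec.span_neg cvec.span_scale)
    next
      case 3
      show ?thesis
      proof (cases "t b + \<alpha> \<in> roots H")
        case True
        have "t b + \<alpha> \<in> D"
        proof (rule ccontr)
          assume n: "t b + \<alpha> \<notin> D"
          have "- t b + (t b + \<alpha>) \<in> roots H" using \<alpha>H by simp
          then show False using mixed[OF D_neg[OF 3(1)] True n] by blast
        qed
        then show ?thesis using bg rsI by blast
      next
        case False
        then have "lie b g = 0"
          using bg 3 \<alpha>H t_H[OF b] by (intro nonroot_space_zero[OF bg]) (auto intro: H_add simp: add_eq_0_iff2)
        then show ?thesis by (simp add: I_def cvec.span_zero)
      qed
    next
      case 4
      have "t b \<noteq> - \<alpha>" using D_neg[OF \<alpha>(1)] 4 by auto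
      then have "lie b g = 0"
        using mixed[OF \<alpha>(1) 4] \<alpha>H t_H[OF b]
        by (intro nonroot_space_zero[OF bg]) (auto intro: H_add simp: add_eq_0_iff2 add.commute)
      then show ?thesis by (simp add: I_def cvec.span_zero)
    qed
  qed
  have "lie b u \<in> I" if b: "b \<in> B" and u: "u \<in> I" for b u
    using u unfolding I_def
  proof (induction rule: cvec.span_induct_alt)
    case (step c y z)
    then show ?case using gen[OF b step(1)] unfolding I_def
      by (simp add: lie_add_right lie_scaleC_right cvec.span_add cvec.span_scale)
  qed (simp add: cvec.span_zero)
  then have "lie x u \<in> I" if "u \<in> I" for x u
    using that unfolding I_def
    by (subst expand[of x, symmetric])
      (auto simp: lie_sum_left lie_scaleC_left intro!: cvec.span_sum cvec.span_scale)
  then have "lie_ideal I"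
    unfolding lie_ideal_def I_def by (auto simp: cvec.span_zero cvec.span_add cvec.span_scale)
  then have "I = {0} \<or> I = UNIV" by (rule simple)
  moreover obtain \<alpha> where "\<alpha> \<in> D" using D by blast
  then have "\<alpha> \<in> I" "\<alpha> \<noteq> 0" using DI D rootsD by auto
  ultimately have IU: "I = UNIV" by blast
  have van: "coord u (root_vec \<beta>) = 0" if "u \<in> I" for u
    using that unfolding I_def
  proof (induction rule: cvec.span_induct_alt)
    case (step c y z)
    have "coord y (root_vec \<beta>) = 0"
    proof (rule ccontr)
      assume nz: "coord y (root_vec \<beta>) \<noteq> 0"
      have "\<exists>\<gamma>\<in>insert 0 D. y \<in> root_space H \<gamma>" using step(1) D rootsD(1) by (auto simp: root_space_0)
      then obtain \<gamma> where \<gamma>: "\<gamma> \<in> insert 0 D" "y \<in> root_space H \<gamma>" by blast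
      have "\<gamma> \<in> H" using \<gamma> D rootsD(1) H_0 by auto
      have "killing \<beta> h = killing \<gamma> h" if "h \<in> H" for h
        using component_weight[OF _ nz that, of "killing \<gamma>"] \<gamma> root_vec(2)[OF \<beta>(1)] by (simp add: root_space_eq)
      then have "\<beta> = \<gamma>" using \<open>\<gamma> \<in> H\<close> \<beta> rootsD(1) by (intro H_eqI) auto
      then show False using \<gamma> \<beta> rootsD(2) by auto
    qed
    then show ?case using step by (simp add: coord_add coord_scale)
  qed (simp add: cvec.representation_zero)
  have "coord (root_vec \<beta>) (root_vec \<beta>) = 0" by (rule van) (simp add: IU)
  then show False using root_vec(1)[OF \<beta>(1)] by (simp add: coord_basis)
qed

end

section \<open>Simple roots and the highest root\<close>

context cartan
begin

lemma roots_nonempty: "roots H \<noteq> {}"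
proof
  assume empty: "roots H = {}"
  obtain B t where "root_basis H B t" using root_basis_ex by blast
  then interpret root_basis H B t .
  obtain h where h: "h \<in> H" "h \<noteq> 0" using H_nonzero by blast
  have "h = 0" using h(1) t_root empty by (intro H_weights_zero) auto
  then show False using h by simp
qed

definition srefl :: "'g \<Rightarrow> 'g \<Rightarrow> 'g" where
  "srefl \<alpha> x = x - (2 * kf x \<alpha> / kf \<alpha> \<alpha>) *\<^sub>R \<alpha>"

lemma srefl_root:
  assumes "\<alpha> \<in> roots H" "\<beta> \<in> roots H"
  shows "srefl \<alpha> \<beta> \<in> roots H"
proof -
  obtain n :: int where n: "2 * kf \<beta> \<alpha> = of_int n * kf \<alpha> \<alpha>" "\<beta> - of_int n *\<^sub>R \<alpha> \<in> roots H"
    using cartan_integer[OF assms] by blast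
  then show ?thesis using kf_root_pos[OF assms(1)] by (simp add: srefl_def)
qed

lemma kf_srefl:
  assumes "\<alpha> \<in> roots H"
  shows "kf (srefl \<alpha> x) (srefl \<alpha> y) = kf x y" "kf (srefl \<alpha> x) y = kf x (srefl \<alpha> y)"
    "srefl \<alpha> (srefl \<alpha> x) = x" "kf \<alpha> (srefl \<alpha> x) = - kf \<alpha> x" "srefl \<alpha> \<alpha> = - \<alpha>"
proof -
  have c: "kf \<alpha> \<alpha> \<noteq> 0" using kf_root_pos[OF assms] by simp
  have sym: "kf \<alpha> y = kf y \<alpha>" for y by (rule kf_sym)
  show "kf (srefl \<alpha> x) (srefl \<alpha> y) = kf x y" "kf (srefl \<alpha> x) y = kf x (srefl \<alpha> y)"
    "kf \<alpha> (srefl \<alpha> x) = - kf \<alpha> x"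
    unfolding srefl_def kf_simps sym[of x] sym[of y] using c by simp_all
  show "srefl \<alpha> \<alpha> = - \<alpha>" using c by (simp add: srefl_def scaleR_2)
  have "2 * kf (srefl \<alpha> x) \<alpha> / kf \<alpha> \<alpha> = - (2 * kf x \<alpha> / kf \<alpha> \<alpha>)"
    unfolding srefl_def kf_simps using c by simp
  then show "srefl \<alpha> (srefl \<alpha> x) = x"
    by (subst srefl_def) (simp add: srefl_def)
qed

end

text \<open>Used with \<open>f\<close> the value at \<open>2\<rho>\<close>, which plays the role of the height of a root.\<close>

lemma finite_real_induct:
  fixes f :: "'a \<Rightarrow> real"
  assumes fin: "\<And>a. a \<in> S \<Longrightarrow> finite {b\<in>S. f b < f a}"
    and step: "\<And>a. a \<in> S \<Longrightarrow> (\<And>b. b \<in> S \<Longrightarrow> f b < f a \<Longrightarrow> Q b) \<Longrightarrow> Q a"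
    and a: "a \<in> S"
  shows "Q a"
  using a
proof (induction "card {b\<in>S. f b < f a}" arbitrary: a rule: less_induct)
  case less
  show ?case
  proof (rule step[OF less.prems])
    fix b assume b: "b \<in> S" "f b < f a"
    then have "{c\<in>S. f c < f b} \<subset> {b\<in>S. f b < f a}" by auto
    then have "card {c\<in>S. f c < f b} < card {b\<in>S. f b < f a}"
      by (rule psubset_card_mono[OF fin[OF less.prems]])
    then show "Q b" using less.hyps b by blast
  qed
qed

locale simple_system = cartan H for H :: "'g::complex_simple_lie_algebra set" +
  fixes P :: "'g set"
  assumes simple_P: "simple_roots H P"
begin

abbreviation "N \<equiv> nonneg_comb P"
abbreviation "R \<equiv> roots H"
abbreviation "Rp \<equiv> pos_roots H P"
abbreviation "\<psi> \<equiv> highest_root H P"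

lemma P_root: "\<alpha> \<in> P \<Longrightarrow> \<alpha> \<in> R"
  and independent_P: "independent P"
  and pos_or_neg_N: "\<phi> \<in> R \<Longrightarrow> \<phi> \<in> N \<or> - \<phi> \<in> N"
  using simple_P unfolding simple_roots_def by auto

lemma finite_P: "finite P"
  using finite_roots P_root by (meson finite_subset subsetI)

lemma P_coeff_unique:
  assumes "(\<Sum>\<alpha>\<in>P. r \<alpha> *\<^sub>R \<alpha>) = (\<Sum>\<alpha>\<in>P. s \<alpha> *\<^sub>R \<alpha>)" "\<alpha> \<in> P"
  shows "r \<alpha> = s \<alpha>"
proof -
  have "(\<Sum>\<alpha>\<in>P. (r \<alpha> - s \<alpha>) *\<^sub>R \<alpha>) = 0" using assms(1) by (simp add: scaleR_left_diff_distrib sum_subtractf)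
  then have "r \<alpha> - s \<alpha> = 0"
    by (rule real_vector.independentD[OF independent_P finite_P subset_refl _ assms(2)])
  then show ?thesis by simp
qed

lemma N_E:
  assumes "x \<in> N" obtains n :: "'g \<Rightarrow> nat" where "x = (\<Sum>\<alpha>\<in>P. real (n \<alpha>) *\<^sub>R \<alpha>)"
  using assms unfolding nonneg_comb_def by blast

lemma N_I: "x = (\<Sum>\<alpha>\<in>P. real (n \<alpha>) *\<^sub>R \<alpha>) \<Longrightarrow> x \<in> N"
  unfolding nonneg_comb_def by blast

lemma N_0: "0 \<in> N"
  by (rule N_I[of _ "\<lambda>_. 0"]) simp

lemma N_add: assumes "x \<in> N" "y \<in> N" shows "x + y \<in> N"
proof -
  obtain n m :: "'g \<Rightarrow> nat" where "x = (\<Sum>\<alpha>\<in>P. real (n \<alpha>) *\<^sub>R \<alpha>)" "y = (\<Sum>\<alpha>\<in>P. real (m \<alpha>) *\<^sub>R \<alpha>)"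
    using assms by (elim N_E)
  then show ?thesis by (intro N_I[of _ "\<lambda>\<alpha>. n \<alpha> + m \<alpha>"]) (simp add: scaleR_left_distrib sum.distrib)
qed

lemma N_scale: "x \<in> N \<Longrightarrow> real k *\<^sub>R x \<in> N"
  by (induction k) (auto simp: N_0 scaleR_left_distrib intro: N_add)

lemma simple_coeff: "\<alpha> \<in> P \<Longrightarrow> \<alpha> = (\<Sum>\<beta>\<in>P. (if \<beta> = \<alpha> then 1 else 0) *\<^sub>R \<beta>)"
  using finite_P by (simp add: if_distrib[of "\<lambda>c. c *\<^sub>R _"] cong: if_cong)

lemma P_N: "\<alpha> \<in> P \<Longrightarrow> \<alpha> \<in> N"
  using simple_coeff[of \<alpha>] by (intro N_I[of _ "\<lambda>\<beta>. if \<beta> = \<alpha> then 1 else 0"]) (simp add: if_distrib cong: if_cong)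

lemma N_antisym: assumes "x \<in> N" "- x \<in> N" shows "x = 0"
proof -
  obtain n m :: "'g \<Rightarrow> nat" where nm: "x = (\<Sum>\<alpha>\<in>P. real (n \<alpha>) *\<^sub>R \<alpha>)" "- x = (\<Sum>\<alpha>\<in>P. real (m \<alpha>) *\<^sub>R \<alpha>)"
    using assms by (elim N_E)
  have "(\<Sum>\<alpha>\<in>P. (real (n \<alpha>) + real (m \<alpha>)) *\<^sub>R \<alpha>) = x + - x"
    unfolding nm(2) by (subst nm(1)) (simp add: scaleR_left_distrib sum.distrib)
  then have "(\<Sum>\<alpha>\<in>P. (real (n \<alpha>) + real (m \<alpha>)) *\<^sub>R \<alpha>) = (\<Sum>\<alpha>\<in>P. 0 *\<^sub>R \<alpha>)" by simp
  from P_coeff_unique[OF this] have "n \<alpha> = 0" if "\<alpha> \<in> P" for \<alpha> using that by fastforce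
  then show ?thesis using nm by simp
qed

lemma N_below_simple:
  assumes "x \<in> N" "c *\<^sub>R \<alpha> - x \<in> N" "\<alpha> \<in> P"
  shows "\<exists>k::nat. x = real k *\<^sub>R \<alpha> \<and> real k \<le> c"
proof -
  obtain n m :: "'g \<Rightarrow> nat" where nm: "x = (\<Sum>\<alpha>\<in>P. real (n \<alpha>) *\<^sub>R \<alpha>)"
      "c *\<^sub>R \<alpha> - x = (\<Sum>\<alpha>\<in>P. real (m \<alpha>) *\<^sub>R \<alpha>)"
    using assms by (elim N_E)
  have "c *\<^sub>R \<alpha> = (\<Sum>\<alpha>\<in>P. real (m \<alpha>) *\<^sub>R \<alpha>) + (\<Sum>\<alpha>\<in>P. real (n \<alpha>) *\<^sub>R \<alpha>)"
    using nm by (metis diff_add_cancel)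
  also have "\<dots> = (\<Sum>\<alpha>\<in>P. (real (m \<alpha>) + real (n \<alpha>)) *\<^sub>R \<alpha>)"
    by (simp add: scaleR_left_distrib sum.distrib)
  finally have "(\<Sum>\<beta>\<in>P. (if \<beta> = \<alpha> then c else 0) *\<^sub>R \<beta>) = (\<Sum>\<alpha>\<in>P. (real (m \<alpha>) + real (n \<alpha>)) *\<^sub>R \<alpha>)"
    using assms(3) finite_P by (simp add: if_distrib[of "\<lambda>c. c *\<^sub>R _"] cong: if_cong)
  from P_coeff_unique[OF this] have co: "(if \<beta> = \<alpha> then c else 0) = real (m \<beta>) + real (n \<beta>)" if "\<beta> \<in> P" for \<beta>
    using that by simp
  have "n \<beta> = 0" if "\<beta> \<in> P" "\<beta> \<noteq> \<alpha>" for \<beta> using co[OF that(1)] that by simp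
  then have "x = (\<Sum>\<beta>\<in>P. if \<beta> = \<alpha> then real (n \<alpha>) *\<^sub>R \<alpha> else 0)"
    unfolding nm(1) by (intro sum.cong) auto
  then have "x = real (n \<alpha>) *\<^sub>R \<alpha>" using assms(3) finite_P by simp
  moreover have "real (n \<alpha>) \<le> c" using co[OF assms(3)] by simp
  ultimately show ?thesis by blast
qed

lemma pos_rootsD: "\<phi> \<in> Rp \<Longrightarrow> \<phi> \<in> R" "\<phi> \<in> Rp \<Longrightarrow> \<phi> \<in> N"
  by (auto simp: pos_roots_def)

lemma pos_or_neg: "\<phi> \<in> R \<Longrightarrow> \<phi> \<in> Rp \<or> - \<phi> \<in> Rp"
  using pos_or_neg_N root_uminus by (auto simp: pos_roots_def)

lemma not_pos_and_neg: "\<phi> \<in> Rp \<Longrightarrow> - \<phi> \<notin> Rp"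
  using N_antisym[of \<phi>] rootsD(2) by (auto simp: pos_roots_def)

lemma P_pos: "\<alpha> \<in> P \<Longrightarrow> \<alpha> \<in> Rp"
  by (simp add: pos_roots_def P_root P_N)

lemma finite_pos_roots: "finite Rp"
  using finite_roots by (simp add: pos_roots_def)

lemma pos_below_simple:
  assumes "\<phi> \<in> Rp" "c *\<^sub>R \<alpha> - \<phi> \<in> N" "\<alpha> \<in> P"
  shows "\<phi> = \<alpha>"
proof -
  obtain k :: nat where k: "\<phi> = real k *\<^sub>R \<alpha>" using N_below_simple assms pos_rootsD by blast
  have "\<not> k \<ge> 2" using root_multiples(2)[OF P_root[OF assms(3)], of k] k pos_rootsD(1)[OF assms(1)] by auto
  moreover have "k \<noteq> 0" using k rootsD(2)[OF pos_rootsD(1)[OF assms(1)]] by auto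
  ultimately have "k = 1" by simp
  then show ?thesis using k by simp
qed

text \<open>The reflection changes only the coefficient of \<open>\<alpha>\<close>. A positive root that becomes
  negative has therefore no other nonzero coefficient, so it is a multiple of \<open>\<alpha>\<close>.\<close>

lemma simple_reflection_permutes:
  assumes "\<alpha> \<in> P" "\<phi> \<in> Rp" "\<phi> \<noteq> \<alpha>"
  shows "srefl \<alpha> \<phi> \<in> Rp" "srefl \<alpha> \<phi> \<noteq> \<alpha>"
proof -
  have r: "srefl \<alpha> \<phi> \<in> R" using srefl_root P_root pos_rootsD assms by blast
  show "srefl \<alpha> \<phi> \<in> Rp"
  proof (rule ccontr)
    assume "srefl \<alpha> \<phi> \<notin> Rp"
    then have "- srefl \<alpha> \<phi> \<in> N" using pos_or_neg[OF r] pos_rootsD by blast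
    then have "(2 * kf \<phi> \<alpha> / kf \<alpha> \<alpha>) *\<^sub>R \<alpha> - \<phi> \<in> N" by (simp add: srefl_def)
    then show False using pos_below_simple assms by blast
  qed
  show "srefl \<alpha> \<phi> \<noteq> \<alpha>"
  proof
    assume "srefl \<alpha> \<phi> = \<alpha>"
    then have "\<phi> = - \<alpha>" using kf_srefl(3,5)[OF P_root[OF assms(1)]] by metis
    then show False using not_pos_and_neg[OF assms(2)] P_pos[OF assms(1)] by simp
  qed
qed

definition two_rho :: 'g where
  "two_rho = 2 *\<^sub>R rho H P"

lemma two_rho_sum: "two_rho = (\<Sum>\<phi>\<in>Rp. \<phi>)"
  by (simp add: two_rho_def rho_def)

text \<open>The reflection in \<open>\<alpha>\<close> permutes the positive roots other than \<open>\<alpha>\<close> and negates their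
  products with \<open>\<alpha>\<close>, so that these cancel in the sum.\<close>

lemma kf_two_rho_simple:
  assumes \<alpha>: "\<alpha> \<in> P"
  shows "kf \<alpha> two_rho = kf \<alpha> \<alpha>"
proof -
  note \<alpha>R = P_root[OF \<alpha>]
  have "bij_betw (srefl \<alpha>) (Rp - {\<alpha>}) (Rp - {\<alpha>})"
    by (rule bij_betw_byWitness[of _ "srefl \<alpha>"])
      (use simple_reflection_permutes[OF \<alpha>] kf_srefl(3)[OF \<alpha>R] in auto)
  then have "(\<Sum>\<phi>\<in>Rp - {\<alpha>}. kf \<alpha> \<phi>) = (\<Sum>\<phi>\<in>Rp - {\<alpha>}. kf \<alpha> (srefl \<alpha> \<phi>))"
    by (rule sum.reindex_bij_betw[symmetric])
  then have "(\<Sum>\<phi>\<in>Rp - {\<alpha>}. kf \<alpha> \<phi>) = 0" by (simp add: kf_srefl(4)[OF \<alpha>R] sum_negf)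
  then show ?thesis
    unfolding two_rho_sum kf_sum_right
    using sum.remove[OF finite_pos_roots P_pos[OF \<alpha>], of "kf \<alpha>"] by simp
qed

lemma two_rho_real_form: "two_rho \<in> real_form H"
  unfolding two_rho_sum real_form_def by (intro span_sum span_base) (auto dest: pos_rootsD)

lemma N_kf_nonneg:
  assumes "x \<in> N" "\<And>\<alpha>. \<alpha> \<in> P \<Longrightarrow> kf \<alpha> y \<ge> 0"
  shows "kf x y \<ge> 0"
  using assms(1) by (elim N_E) (auto simp: kf_sum_left kf_simps assms(2) intro!: sum_nonneg)

lemma N_two_rho_pos:
  assumes "x \<in> N" "x \<noteq> 0"
  shows "kf x two_rho > 0"
proof -
  obtain n :: "'g \<Rightarrow> nat" where n: "x = (\<Sum>\<alpha>\<in>P. real (n \<alpha>) *\<^sub>R \<alpha>)" using assms by (elim N_E)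
  have "\<exists>\<alpha>\<in>P. n \<alpha> \<noteq> 0"
  proof (rule ccontr)
    assume "\<not> ?thesis"
    then have "x = 0" unfolding n by simp
    then show False using assms by simp
  qed
  then obtain \<alpha> where \<alpha>: "\<alpha> \<in> P" "n \<alpha> \<noteq> 0" by blast
  have pos: "kf \<beta> \<beta> > 0" if "\<beta> \<in> P" for \<beta> using kf_root_pos P_root that by blast
  have "kf x two_rho = (\<Sum>\<alpha>\<in>P. real (n \<alpha>) * kf \<alpha> \<alpha>)"
    unfolding n kf_sum_left by (simp add: kf_simps kf_two_rho_simple)
  also have "\<dots> > 0" using \<alpha> pos finite_P by (intro sum_pos2[of P \<alpha>]) (auto simp: less_imp_le)
  finally show ?thesis .
qed

lemma pos_root_two_rho: "\<phi> \<in> Rp \<Longrightarrow> kf \<phi> two_rho > 0"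
  using N_two_rho_pos rootsD(2) by (simp add: pos_roots_def)

lemma N_pairs_positively:
  assumes "x \<in> N" "kf x y > 0"
  shows "\<exists>\<alpha>\<in>P. kf \<alpha> y > 0"
proof (rule ccontr)
  assume *: "\<not> ?thesis"
  have "kf x (- y) \<ge> 0" by (rule N_kf_nonneg[OF assms(1)]) (use * in \<open>auto simp: kf_simps not_less\<close>)
  then show False using assms(2) by (simp add: kf_simps)
qed

lemma pos_minus_simple:
  assumes "\<phi> \<in> Rp" "\<alpha> \<in> P" "\<phi> - \<alpha> \<in> R"
  shows "\<phi> - \<alpha> \<in> Rp"
proof (rule ccontr)
  assume "\<phi> - \<alpha> \<notin> Rp"
  then have "1 *\<^sub>R \<alpha> - \<phi> \<in> N" using pos_or_neg[OF assms(3)] pos_rootsD by force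
  then have "\<phi> = \<alpha>" using pos_below_simple assms by blast
  then show False using assms(3) rootsD(2) by auto
qed

lemma nonsimple_pos_root:
  assumes "\<phi> \<in> Rp" "\<phi> \<notin> P"
  shows "\<exists>\<alpha>\<in>P. kf \<alpha> \<phi> > 0 \<and> \<phi> - \<alpha> \<in> Rp"
proof -
  obtain \<alpha> where \<alpha>: "\<alpha> \<in> P" "kf \<alpha> \<phi> > 0"
    using N_pairs_positively[of \<phi> \<phi>] kf_root_pos pos_rootsD assms by blast
  then have "\<phi> - \<alpha> \<in> R" using root_diff[of \<alpha> \<phi>] assms P_root pos_rootsD by (auto simp: kf_sym[of \<phi>])
  then show ?thesis using pos_minus_simple assms \<alpha> by blast
qed

lemma simple_obtuse:
  assumes "\<alpha> \<in> P" "\<beta> \<in> P" "\<alpha> \<noteq> \<beta>"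
  shows "kf \<alpha> \<beta> \<le> 0"
proof (rule ccontr)
  assume "\<not> ?thesis"
  then have "\<alpha> - \<beta> \<in> R" using root_diff[of \<beta> \<alpha>] assms P_root by auto
  then have "\<alpha> - \<beta> \<in> Rp" using pos_minus_simple[of \<alpha> \<beta>] assms P_pos by auto
  then have "1 *\<^sub>R \<alpha> - \<beta> \<in> N" using pos_rootsD by simp
  then show False using pos_below_simple[OF P_pos[OF assms(2)] _ assms(1)] assms(3) by blast
qed

lemma kf_span_zero:
  assumes "x \<in> span J" "\<And>\<alpha>. \<alpha> \<in> J \<Longrightarrow> kf \<alpha> y = 0"
  shows "kf x y = 0"
  using assms(1)
proof (induction rule: span_induct_alt)
  case (step c a z)
  then show ?case using assms(2) by (simp add: kf_simps)
qed (simp add: kf_simps)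

text \<open>Induction on the height. The critical case is \<open>\<phi> - \<alpha>\<close> in one span and \<open>\<alpha>\<close> in the other
  one: then \<open>\<phi> - 2\<alpha>\<close> is the reflection of \<open>\<phi>\<close> in \<open>\<alpha>\<close>, again a positive root, and the
  induction hypothesis for it leaves only the possibility that \<open>\<phi>\<close> lies in the span of \<open>\<alpha>\<close>'s
  part.\<close>

lemma orthogonal_splitting:
  assumes JK: "J \<union> K = P" "\<And>\<alpha> \<beta>. \<alpha> \<in> J \<Longrightarrow> \<beta> \<in> K \<Longrightarrow> kf \<alpha> \<beta> = 0" and \<phi>: "\<phi> \<in> Rp"
  shows "\<phi> \<in> span J \<or> \<phi> \<in> span K"
proof (rule finite_real_induct[of "Rp" "\<lambda>\<phi>. kf \<phi> two_rho"])
  show "finite {b\<in>Rp. kf b two_rho < kf a two_rho}" for a using finite_pos_roots by simp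
  show "\<phi> \<in> Rp" by (rule \<phi>)
  fix \<phi> assume \<phi>: "\<phi> \<in> Rp" and IH: "\<And>b. b \<in> Rp \<Longrightarrow> kf b two_rho < kf \<phi> two_rho \<Longrightarrow> b \<in> span J \<or> b \<in> span K"
  have mixed: "\<phi> \<in> span J \<or> \<phi> \<in> span K"
    if JK: "\<And>\<alpha> \<beta>. \<alpha> \<in> J \<Longrightarrow> \<beta> \<in> K \<Longrightarrow> kf \<alpha> \<beta> = 0"
      and IH: "\<And>b. b \<in> Rp \<Longrightarrow> kf b two_rho < kf \<phi> two_rho \<Longrightarrow> b \<in> span J \<or> b \<in> span K"
      and \<alpha>: "\<alpha> \<in> P" "\<alpha> \<in> K" "\<phi> \<noteq> \<alpha>" "\<phi> - \<alpha> \<in> Rp" "\<phi> - \<alpha> \<in> span J"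
    for J K \<alpha>
  proof -
    have apos: "kf \<alpha> \<alpha> > 0" using kf_root_pos P_root \<alpha> by blast
    have z: "kf (\<phi> - \<alpha>) \<alpha> = 0" using kf_span_zero[OF \<alpha>(5)] JK \<alpha> by blast
    then have s: "srefl \<alpha> \<phi> = (\<phi> - \<alpha>) - \<alpha>" using apos by (simp add: srefl_def kf_simps scaleR_2)
    then have g: "(\<phi> - \<alpha>) - \<alpha> \<in> Rp" using simple_reflection_permutes(1)[OF \<alpha>(1) \<phi> \<alpha>(3)] by simp
    have "kf ((\<phi> - \<alpha>) - \<alpha>) two_rho < kf \<phi> two_rho" using kf_two_rho_simple[OF \<alpha>(1)] apos by (simp add: kf_simps)
    from IH[OF g this] show ?thesis
    proof
      assume "(\<phi> - \<alpha>) - \<alpha> \<in> span J"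
      then have "\<alpha> \<in> span J" using \<alpha>(5) by (metis diff_diff_eq2 diff_add_cancel add_diff_cancel_left' span_diff)
      then have "kf \<alpha> \<alpha> = 0" using kf_span_zero JK \<alpha> by blast
      then show ?thesis using apos by simp
    next
      assume *: "(\<phi> - \<alpha>) - \<alpha> \<in> span K"
      have "(\<phi> - \<alpha>) - \<alpha> + \<alpha> + \<alpha> \<in> span K"
        by (rule span_add[OF span_add[OF * span_base[OF \<alpha>(2)]] span_base[OF \<alpha>(2)]])
      then show ?thesis by simp
    qed
  qed
  show "\<phi> \<in> span J \<or> \<phi> \<in> span K"
  proof (cases "\<phi> \<in> P")
    case True
    then show ?thesis using JK(1) by (auto intro: span_base)
  next
    case False
    obtain \<alpha> where \<alpha>: "\<alpha> \<in> P" "kf \<alpha> \<phi> > 0" "\<phi> - \<alpha> \<in> Rp" using nonsimple_pos_root[OF \<phi> False] by blast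
    have "kf \<alpha> \<alpha> > 0" using kf_root_pos P_root \<alpha> by blast
    then have less: "kf (\<phi> - \<alpha>) two_rho < kf \<phi> two_rho" using kf_two_rho_simple[OF \<alpha>(1)] by (simp add: kf_simps)
    have ne: "\<phi> \<noteq> \<alpha>" using False \<alpha> by auto
    have join: "\<phi> \<in> span S" if "\<phi> - \<alpha> \<in> span S" "\<alpha> \<in> S" for S
      using span_add[OF that(1) span_base[OF that(2)]] by simp
    from IH[OF \<alpha>(3) less] JK(1) \<alpha>(1)
    consider "\<phi> - \<alpha> \<in> span J" "\<alpha> \<in> J" | "\<phi> - \<alpha> \<in> span J" "\<alpha> \<in> K"
      | "\<phi> - \<alpha> \<in> span K" "\<alpha> \<in> J" | "\<phi> - \<alpha> \<in> span K" "\<alpha> \<in> K" by blast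
    then show ?thesis
    proof cases
      case 2
      then show ?thesis using mixed[of J K \<alpha>] JK(2) IH \<alpha> ne by blast
    next
      case 3
      have "kf a b = 0" if "a \<in> K" "b \<in> J" for a b using JK(2)[OF that(2,1)] by (simp add: kf_sym)
      moreover have "b \<in> span K \<or> b \<in> span J" if "b \<in> Rp" "kf b two_rho < kf \<phi> two_rho" for b
        using IH[OF that] by blast
      ultimately have "\<phi> \<in> span K \<or> \<phi> \<in> span J" using mixed[of K J \<alpha>] \<alpha> ne 3 by blast
      then show ?thesis by blast
    qed (use join in auto)
  qed
qed

definition maximal_root :: "'g \<Rightarrow> bool" where
  "maximal_root \<mu> \<longleftrightarrow> \<mu> \<in> R \<and> (\<forall>\<gamma>\<in>R. \<gamma> - \<mu> \<in> N \<longrightarrow> \<gamma> = \<mu>)"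

lemma below_maximal_root:
  assumes "\<phi> \<in> R"
  shows "\<exists>\<mu>. maximal_root \<mu> \<and> \<mu> - \<phi> \<in> N"
proof -
  let ?U = "{\<gamma>\<in>R. \<gamma> - \<phi> \<in> N}"
  have fin: "finite ?U" using finite_roots by simp
  have "\<phi> \<in> ?U" using assms N_0 by simp
  then have "finite ((\<lambda>\<gamma>. kf \<gamma> two_rho) ` ?U)" "(\<lambda>\<gamma>. kf \<gamma> two_rho) ` ?U \<noteq> {}" using fin by auto
  then have "Max ((\<lambda>\<gamma>. kf \<gamma> two_rho) ` ?U) \<in> (\<lambda>\<gamma>. kf \<gamma> two_rho) ` ?U" by (rule Max_in)
  then obtain \<mu> where \<mu>: "\<mu> \<in> ?U" "kf \<mu> two_rho = Max ((\<lambda>\<gamma>. kf \<gamma> two_rho) ` ?U)" by auto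
  have "\<gamma> = \<mu>" if \<gamma>: "\<gamma> \<in> R" "\<gamma> - \<mu> \<in> N" for \<gamma>
  proof (rule ccontr)
    assume "\<gamma> \<noteq> \<mu>"
    then have "kf (\<gamma> - \<mu>) two_rho > 0" using N_two_rho_pos \<gamma> by simp
    moreover have "\<gamma> \<in> ?U" using N_add[of "\<gamma> - \<mu>" "\<mu> - \<phi>"] \<gamma> \<mu>(1) by simp
    then have "kf \<gamma> two_rho \<le> kf \<mu> two_rho" unfolding \<mu>(2) using fin by (intro Max_ge) auto
    ultimately show False by (simp add: kf_simps)
  qed
  then show ?thesis using \<mu>(1) unfolding maximal_root_def by blast
qed

lemma maximal_root_dominant:
  assumes \<mu>: "maximal_root \<mu>" and \<alpha>: "\<alpha> \<in> P"
  shows "kf \<alpha> \<mu> \<ge> 0"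
proof (rule ccontr)
  assume neg: "\<not> kf \<alpha> \<mu> \<ge> 0"
  have \<mu>R: "\<mu> \<in> R" using \<mu> by (simp add: maximal_root_def)
  show False
  proof (cases "\<mu> = - \<alpha>")
    case True
    then have "\<alpha> - \<mu> \<in> N" using N_add[OF P_N[OF \<alpha>] P_N[OF \<alpha>]] by simp
    then have "\<alpha> = \<mu>" using \<mu> P_root[OF \<alpha>] by (simp add: maximal_root_def)
    then show False using neg kf_root_pos[OF \<mu>R] by simp
  next
    case False
    then have "\<mu> + \<alpha> \<in> R" using root_add[OF P_root[OF \<alpha>] \<mu>R] neg by (simp add: kf_sym[of \<mu>])
    moreover have "(\<mu> + \<alpha>) - \<mu> \<in> N" using P_N[OF \<alpha>] by simp
    ultimately have "\<mu> + \<alpha> = \<mu>" using \<mu> unfolding maximal_root_def by blast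
    then show False using rootsD(2)[OF P_root[OF \<alpha>]] by simp
  qed
qed

lemma dominant_root_pos:
  assumes "\<mu> \<in> R" "\<And>\<alpha>. \<alpha> \<in> P \<Longrightarrow> kf \<alpha> \<mu> \<ge> 0"
  shows "\<mu> \<in> N"
proof (rule ccontr)
  assume "\<mu> \<notin> N"
  then have "kf (- \<mu>) \<mu> \<ge> 0" using pos_or_neg_N[OF assms(1)] N_kf_nonneg assms(2) by blast
  then show False using kf_root_pos[OF assms(1)] by (simp add: kf_simps)
qed

text \<open>A simple root that does not occur has nonpositive products with those that do, but a
  nonnegative one with \<open>\<mu>\<close>. So it is orthogonal to all simple roots that occur, which
  irreducibility rules out.\<close>

lemma maximal_root_full_support:
  assumes \<mu>: "maximal_root \<mu>" and n: "\<mu> = (\<Sum>\<alpha>\<in>P. real (n \<alpha>) *\<^sub>R \<alpha>)" and \<alpha>: "\<alpha> \<in> P"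
  shows "n \<alpha> > 0"
proof (rule ccontr)
  assume n0: "\<not> n \<alpha> > 0"
  define J K where "J = {\<beta>\<in>P. n \<beta> > 0}" and "K = {\<beta>\<in>P. n \<beta> = 0}"
  have \<mu>R: "\<mu> \<in> R" using \<mu> by (simp add: maximal_root_def)
  have orth: "kf \<beta> \<gamma> = 0" if "\<beta> \<in> J" "\<gamma> \<in> K" for \<beta> \<gamma>
  proof -
    have le: "real (n \<delta>) * kf \<delta> \<gamma> \<le> 0" if "\<delta> \<in> P" for \<delta>
      using simple_obtuse[of \<delta> \<gamma>] that \<open>\<gamma> \<in> K\<close> by (cases "\<delta> = \<gamma>") (auto simp: K_def mult_nonneg_nonpos)
    have "0 \<le> kf \<mu> \<gamma>" using maximal_root_dominant[OF \<mu>, of \<gamma>] \<open>\<gamma> \<in> K\<close> by (simp add: K_def kf_sym[of \<mu>])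
    also have "\<dots> = (\<Sum>\<delta>\<in>P. real (n \<delta>) * kf \<delta> \<gamma>)" by (subst n) (simp add: kf_sum_left kf_simps)
    finally have "(\<Sum>\<delta>\<in>P. - (real (n \<delta>) * kf \<delta> \<gamma>)) \<le> 0" by (simp add: sum_negf)
    moreover have "(\<Sum>\<delta>\<in>P. - (real (n \<delta>) * kf \<delta> \<gamma>)) \<ge> 0" using le by (intro sum_nonneg) auto
    ultimately have "(\<Sum>\<delta>\<in>P. - (real (n \<delta>) * kf \<delta> \<gamma>)) = 0" by simp
    moreover have "- (real (n \<delta>) * kf \<delta> \<gamma>) \<ge> 0" if "\<delta> \<in> P" for \<delta> using le[OF that] by simp
    ultimately have "\<forall>\<delta>\<in>P. - (real (n \<delta>) * kf \<delta> \<gamma>) = 0"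
      by (intro iffD1[OF sum_nonneg_eq_0_iff[OF finite_P, of "\<lambda>\<delta>. - (real (n \<delta>) * kf \<delta> \<gamma>)"]])
    then show ?thesis using \<open>\<beta> \<in> J\<close> by (auto simp: J_def)
  qed
  have JK: "J \<union> K = P" by (auto simp: J_def K_def)
  have split: "\<phi> \<in> span J \<or> \<phi> \<in> span K" if "\<phi> \<in> R" for \<phi>
    using pos_or_neg[OF that] orthogonal_splitting[OF JK orth] span_neg[of "- \<phi>"] by auto
  have spans: "kf x y = 0" if "x \<in> span J" "y \<in> span K" for x y
  proof (rule kf_span_zero[OF that(1)])
    fix a assume a: "a \<in> J"
    have "kf y a = 0" by (rule kf_span_zero[OF that(2)]) (simp add: kf_sym[of _ a] orth a)
    then show "kf a y = 0" by (simp add: kf_sym)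
  qed
  have "{\<phi>\<in>R. \<phi> \<in> span J} = R"
  proof (rule roots_irreducible)
    have "\<mu> = (\<Sum>\<alpha>\<in>J. real (n \<alpha>) *\<^sub>R \<alpha>)"
      unfolding n J_def using finite_P by (intro sum.mono_neutral_right) auto
    also have "\<dots> \<in> span J" by (intro span_sum span_scale span_base)
    finally show "{\<phi>\<in>R. \<phi> \<in> span J} \<noteq> {}" using \<mu>R by blast
  qed (use split spans in blast)+
  then have "\<alpha> \<in> span J" using P_root[OF \<alpha>] by blast
  moreover have "\<alpha> \<in> span K" using \<alpha> n0 by (intro span_base) (simp add: K_def)
  ultimately have "kf \<alpha> \<alpha> = 0" by (rule spans)
  then show False using kf_root_pos[OF P_root[OF \<alpha>]] by simp
qed

text \<open>By dominance of \<open>\<mu>\<close> and full support of \<open>\<nu>\<close>, the product of two maximal roots is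
  positive; if they were distinct, their difference would be a root, making them comparable.\<close>

lemma maximal_root_unique:
  assumes \<mu>: "maximal_root \<mu>" and \<nu>: "maximal_root \<nu>"
  shows "\<mu> = \<nu>"
proof (rule ccontr)
  assume ne: "\<mu> \<noteq> \<nu>"
  have R: "\<mu> \<in> R" "\<nu> \<in> R" using assms by (auto simp: maximal_root_def)
  have N: "\<mu> \<in> N" "\<nu> \<in> N"
    using dominant_root_pos[OF R(1) maximal_root_dominant[OF \<mu>]] dominant_root_pos[OF R(2) maximal_root_dominant[OF \<nu>]] by auto
  obtain n :: "'g \<Rightarrow> nat" where n: "\<nu> = (\<Sum>\<alpha>\<in>P. real (n \<alpha>) *\<^sub>R \<alpha>)" using N(2) by (elim N_E)
  obtain \<alpha> where \<alpha>: "\<alpha> \<in> P" "kf \<alpha> \<mu> > 0" using N_pairs_positively[OF N(1) kf_root_pos[OF R(1)]] by blast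
  have "kf \<nu> \<mu> = (\<Sum>\<alpha>\<in>P. real (n \<alpha>) * kf \<alpha> \<mu>)" by (subst n) (simp add: kf_sum_left kf_simps)
  also have "\<dots> > 0"
    using \<alpha> maximal_root_full_support[OF \<nu> n \<alpha>(1)] maximal_root_dominant[OF \<mu>] finite_P
    by (intro sum_pos2[of P \<alpha>]) auto
  finally have "\<nu> - \<mu> \<in> R" using root_diff[OF R] ne by simp
  then have "\<nu> - \<mu> \<in> N \<or> \<mu> - \<nu> \<in> N" using pos_or_neg_N by fastforce
  then show False using \<mu> \<nu> R ne unfolding maximal_root_def by metis
qed

lemma highest_root: "\<psi> \<in> R" "\<phi> \<in> R \<Longrightarrow> \<psi> - \<phi> \<in> N"
  and highest_root_maximal: "maximal_root \<psi>"
proof -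
  obtain \<mu> where \<mu>: "maximal_root \<mu>" using below_maximal_root roots_nonempty by blast
  have top: "\<mu> \<in> R \<and> (\<forall>\<phi>\<in>R. \<mu> - \<phi> \<in> N)"
    using below_maximal_root maximal_root_unique[OF \<mu>] \<mu> unfolding maximal_root_def[of \<mu>] by blast
  have "\<psi> = \<mu>"
    unfolding highest_root_def
  proof (rule the_equality)
    show "\<mu> \<in> R \<and> (\<forall>\<phi>\<in>R. \<mu> - \<phi> \<in> N)" by (rule top)
    fix \<nu> assume "\<nu> \<in> R \<and> (\<forall>\<phi>\<in>R. \<nu> - \<phi> \<in> N)"
    then have "\<nu> - \<mu> \<in> N" "\<nu> \<in> R" using top by auto
    then show "\<nu> = \<mu>" using \<mu> by (simp add: maximal_root_def)
  qed
  then show "\<psi> \<in> R" "\<phi> \<in> R \<Longrightarrow> \<psi> - \<phi> \<in> N" "maximal_root \<psi>" using top \<mu> by auto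
qed

lemma highest_root_dominant: "\<alpha> \<in> P \<Longrightarrow> kf \<alpha> \<psi> \<ge> 0"
  by (rule maximal_root_dominant[OF highest_root_maximal])

lemma highest_root_pos: "\<psi> \<in> Rp"
  using dominant_root_pos[OF highest_root(1) highest_root_dominant] highest_root(1) by (simp add: pos_roots_def)

lemma root_add_highest: "\<phi> \<in> R \<Longrightarrow> \<phi> + \<psi> \<in> N"
  using highest_root(2)[OF root_uminus] by (simp add: add.commute)

text \<open>For larger \<open>c\<close> the reflection \<open>\<phi> - c\<psi>\<close> of \<open>\<phi>\<close> is a root, so that \<open>\<phi> - (c - 1)\<psi>\<close> and
  hence \<open>\<phi> - \<psi>\<close> are nonnegative combinations of simple roots.\<close>

lemma highest_root_pairing:
  assumes "\<phi> \<in> R" "\<phi> \<noteq> \<psi>" "2 * kf \<phi> \<psi> = of_int c * kf \<psi> \<psi>"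
  shows "c \<le> 1"
proof (rule ccontr)
  assume "\<not> c \<le> 1"
  then have c: "c \<ge> 2" by simp
  obtain n :: int where n: "2 * kf \<phi> \<psi> = of_int n * kf \<psi> \<psi>" "\<phi> - of_int n *\<^sub>R \<psi> \<in> R"
    using cartan_integer[OF highest_root(1) assms(1)] by blast
  have "n = c" using n(1) assms(3) kf_root_pos[OF highest_root(1)] by simp
  then have "(\<phi> - of_int c *\<^sub>R \<psi>) + \<psi> \<in> N" using n(2) root_add_highest by blast
  moreover have "real (nat (c - 2)) *\<^sub>R \<psi> \<in> N" using highest_root_pos pos_rootsD by (intro N_scale) auto
  ultimately have "((\<phi> - of_int c *\<^sub>R \<psi>) + \<psi>) + real (nat (c - 2)) *\<^sub>R \<psi> \<in> N" by (rule N_add)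
  also have "((\<phi> - of_int c *\<^sub>R \<psi>) + \<psi>) + real (nat (c - 2)) *\<^sub>R \<psi> = \<phi> - \<psi>"
    using c by (simp add: scaleR_left_diff_distrib scaleR_2)
  finally have "\<phi> - \<psi> = 0" using highest_root(2)[OF assms(1)] by (intro N_antisym) auto
  then show False using assms(2) by simp
qed

lemma pos_kf_highest: "\<phi> \<in> N \<Longrightarrow> kf \<phi> \<psi> \<ge> 0"
  using N_kf_nonneg highest_root_dominant by blast

lemma sum_roots_pos:
  fixes f :: "'g \<Rightarrow> real"
  assumes "\<And>\<phi>. f (- \<phi>) = f \<phi>"
  shows "(\<Sum>\<phi>\<in>R. f \<phi>) = 2 * (\<Sum>\<phi>\<in>Rp. f \<phi>)"
proof -
  have "R = Rp \<union> uminus ` Rp"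
    using pos_or_neg pos_rootsD(1) root_uminus by (auto simp: image_iff) (metis minus_minus)
  moreover have "Rp \<inter> uminus ` Rp = {}" using not_pos_and_neg by auto
  ultimately have "(\<Sum>\<phi>\<in>R. f \<phi>) = (\<Sum>\<phi>\<in>Rp. f \<phi>) + (\<Sum>\<phi>\<in>uminus ` Rp. f \<phi>)"
    using sum.union_disjoint[OF finite_pos_roots finite_imageI[OF finite_pos_roots], of uminus f] by simp
  also have "(\<Sum>\<phi>\<in>uminus ` Rp. f \<phi>) = (\<Sum>\<phi>\<in>Rp. f \<phi>)"
    by (subst sum.reindex) (auto simp: assms)
  finally show ?thesis by simp
qed

text \<open>The left-hand side is the Casimir eigenvalue of the adjoint representation. A positive
  root \<open>\<phi> \<noteq> \<psi>\<close> has Cartan integer 0 or 1 with \<open>\<psi>\<close>, so it contributes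
  \<open>(\<phi>, \<psi>)\<^sup>2 = (\<phi>, \<psi>)(\<psi>, \<psi>)/2\<close> to the expansion of \<open>(\<psi>, \<psi>)\<close> over all roots; summation
  produces \<open>(\<psi>, 2\<rho>)\<close>.\<close>

lemma highest_root_two_rho: "kf \<psi> two_rho + kf \<psi> \<psi> = 1"
proof -
  let ?c = "kf \<psi> \<psi>"
  have pos: "?c > 0" by (rule kf_root_pos[OF highest_root(1)])
  have sq: "(kf \<phi> \<psi>)\<^sup>2 = kf \<phi> \<psi> * ?c / 2" if \<phi>: "\<phi> \<in> Rp - {\<psi>}" for \<phi>
  proof -
    have R: "\<phi> \<in> R" "\<phi> \<noteq> \<psi>" "\<phi> \<in> N" using \<phi> pos_rootsD by auto
    obtain c :: int where c: "2 * kf \<phi> \<psi> = of_int c * ?c" using cartan_integer[OF highest_root(1) R(1)] by blast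
    have "c \<le> 1" using highest_root_pairing R c by blast
    moreover have "of_int c * ?c \<ge> 0" using pos_kf_highest[OF R(3)] c by simp
    then have "c \<ge> 0" using pos by (simp add: zero_le_mult_iff)
    ultimately have "c = 0 \<or> c = 1" by auto
    then show ?thesis
    proof
      assume "c = 1"
      then have "kf \<phi> \<psi> = ?c / 2" using c by simp
      then show ?thesis by (simp add: power2_eq_square)
    qed (use c in auto)
  qed
  have "?c = (\<Sum>\<phi>\<in>R. (kf \<phi> \<psi>)\<^sup>2)"
    by (subst kf_sum_roots) (auto simp: real_form_root highest_root(1) power2_eq_square)
  also have "\<dots> = 2 * (\<Sum>\<phi>\<in>Rp. (kf \<phi> \<psi>)\<^sup>2)" by (rule sum_roots_pos) (simp add: kf_simps)
  also have "(\<Sum>\<phi>\<in>Rp. (kf \<phi> \<psi>)\<^sup>2) = ?c\<^sup>2 + (\<Sum>\<phi>\<in>Rp - {\<psi>}. (kf \<phi> \<psi>)\<^sup>2)"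
    by (rule sum.remove[OF finite_pos_roots highest_root_pos])
  also have "(\<Sum>\<phi>\<in>Rp - {\<psi>}. (kf \<phi> \<psi>)\<^sup>2) = (\<Sum>\<phi>\<in>Rp - {\<psi>}. kf \<phi> \<psi>) * ?c / 2"
    unfolding sum_distrib_right sum_divide_distrib by (rule sum.cong[OF refl sq])
  also have "(\<Sum>\<phi>\<in>Rp - {\<psi>}. kf \<phi> \<psi>) = kf \<psi> two_rho - ?c"
    using sum.remove[OF finite_pos_roots highest_root_pos, of "\<lambda>\<phi>. kf \<phi> \<psi>"]
    by (subst kf_sym) (simp add: two_rho_sum kf_sum_left)
  finally have "?c = 2 * (?c\<^sup>2 + (kf \<psi> two_rho - ?c) * ?c / 2)" .
  then have "?c = 2 * ?c * ?c + (kf \<psi> two_rho - ?c) * ?c" by (simp add: power2_eq_square)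
  then have "?c * 1 = ?c * (kf \<psi> two_rho + ?c)" by (simp add: algebra_simps)
  then show ?thesis using pos by (metis mult_left_cancel less_irrefl)
qed

end

section \<open>Affine roots and the affine Weyl group\<close>

lemma word_prod_Nil [simp]: "word_prod [] = id"
  and word_prod_Cons [simp]: "word_prod (r # ws) = r \<circ> word_prod ws"
  by (simp_all add: word_prod_def)

lemma word_prod_append: "word_prod (ws @ vs) = word_prod ws \<circ> word_prod vs"
  by (induction ws) (simp_all add: o_assoc)

text \<open>The pair \<open>(\<phi>, k)\<close> stands for the affine function \<open>(\<phi>, x) + k\<close> of \<open>x\<close>.\<close>

type_synonym 'a affine_root = "'a \<times> int"

context simple_system
begin

definition affine_roots :: "'g affine_root set" where
  "affine_roots = R \<times> UNIV"

text \<open>The complex version of the value makes sense on the whole Lie algebra, on which the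
  affine Weyl group acts; the real version compares signs on the real form.\<close>

definition ev :: "'g affine_root \<Rightarrow> 'g \<Rightarrow> complex" where
  "ev a v = killing (fst a) v + of_int (snd a)"

definition evr :: "'g affine_root \<Rightarrow> 'g \<Rightarrow> real" where
  "evr a v = kf (fst a) v + of_int (snd a)"

definition neg :: "'g affine_root \<Rightarrow> 'g affine_root" where
  "neg a = (- fst a, - snd a)"

definition arefl :: "'g affine_root \<Rightarrow> 'g \<Rightarrow> 'g" where
  "arefl a = reflection (fst a) (- snd a)"

text \<open>As \<open>|(\<phi>, 2\<rho>)| < 1\<close>, these are the affine roots that are positive at \<open>2\<rho>\<close>, and hence on
  the interior of the fundamental alcove.\<close>

definition pos :: "'g affine_root \<Rightarrow> bool" where
  "pos a \<longleftrightarrow> snd a > 0 \<or> snd a = 0 \<and> fst a \<in> Rp"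

lemma affine_roots_iff: "a \<in> affine_roots \<longleftrightarrow> fst a \<in> R"
  by (cases a) (simp add: affine_roots_def)

lemma ev_neg: "ev (neg a) v = - ev a v" and evr_neg: "evr (neg a) v = - evr a v"
  and neg_neg [simp]: "neg (neg a) = a" and neg_affine_root: "a \<in> affine_roots \<Longrightarrow> neg a \<in> affine_roots"
  by (simp_all add: ev_def evr_def neg_def killing_minus_left kf_simps affine_roots_iff root_uminus)

lemma coroot_uminus: "coroot (- \<phi>) = - coroot (\<phi>::'g)"
  by (simp add: coroot_def kf_simps)

lemma arefl_eq: "arefl a v = v - ev a v *\<^sub>C coroot (fst a)"
  by (simp add: arefl_def reflection_def ev_def)

lemma arefl_neg: "arefl (neg a) = arefl a"
  by (rule ext) (simp add: arefl_eq ev_neg coroot_uminus, simp add: neg_def coroot_uminus cvec.scale_minus_left)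

lemma ev_real:
  assumes "a \<in> affine_roots" "v \<in> real_form H"
  shows "ev a v = of_real (evr a v)"
  using assms by (simp add: ev_def evr_def affine_roots_iff killing_real_form real_form_root)

lemma ev_inj:
  assumes "\<And>v. ev a v = ev b v"
  shows "a = b"
proof -
  have k: "snd a = snd b" using assms[of 0] by (simp add: ev_def)
  then have "killing (fst a - fst b) v = 0" for v using assms[of v] by (simp add: ev_def killing_diff_left)
  then have "fst a - fst b = 0" by (rule killing_nondegenerate)
  then show ?thesis using k by (simp add: prod_eq_iff)
qed

lemma evr_two_rho_bound:
  assumes "\<phi> \<in> R"
  shows "\<bar>kf \<phi> two_rho\<bar> < 1"
proof -
  have le: "kf \<phi> two_rho < 1" if "\<phi> \<in> R" for \<phi>
  proof -
    have "kf (\<psi> - \<phi>) two_rho \<ge> 0"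
      using N_two_rho_pos[OF highest_root(2)[OF that]] by (cases "\<psi> - \<phi> = 0") (auto simp: kf_simps)
    then show ?thesis using highest_root_two_rho kf_root_pos[OF highest_root(1)] by (simp add: kf_simps)
  qed
  from le[OF assms] le[OF root_uminus[OF assms]] show ?thesis by (simp add: kf_simps abs_less_iff)
qed

lemma pos_iff_evr:
  assumes "a \<in> affine_roots"
  shows "pos a \<longleftrightarrow> evr a two_rho > 0" "\<not> pos a \<longleftrightarrow> evr a two_rho < 0"
proof -
  have R: "fst a \<in> R" using assms by (simp add: affine_roots_iff)
  note b = evr_two_rho_bound[OF R]
  have 1: "evr a two_rho > 0" if "pos a"
  proof (cases "snd a > 0")
    case True
    then have "real_of_int (snd a) \<ge> 1" by simp
    then show ?thesis using b unfolding evr_def by linarith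
  next
    case False
    then show ?thesis using that pos_root_two_rho by (auto simp: pos_def evr_def)
  qed
  have 2: "evr a two_rho < 0" if "\<not> pos a"
  proof (cases "snd a < 0")
    case True
    then have "real_of_int (snd a) \<le> -1" by simp
    then show ?thesis using b unfolding evr_def by linarith
  next
    case False
    then have "snd a = 0" "- fst a \<in> Rp" using that pos_or_neg[OF R] by (auto simp: pos_def)
    then show ?thesis using pos_root_two_rho[of "- fst a"] by (simp add: evr_def kf_simps)
  qed
  show "pos a \<longleftrightarrow> evr a two_rho > 0" "\<not> pos a \<longleftrightarrow> evr a two_rho < 0" using 1 2 by force+
qed

lemma pos_neg: "a \<in> affine_roots \<Longrightarrow> pos (neg a) \<longleftrightarrow> \<not> pos a"
  using pos_iff_evr[of a] pos_iff_evr[of "neg a"] neg_affine_root[of a] by (simp add: evr_neg)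

text \<open>What is needed of a group element: affine roots pull back along \<open>\<sigma>\<close> to affine roots of
  the same length, and \<open>\<sigma>\<close> conjugates the corresponding reflections into each other. The
  equations hold on the whole Lie algebra, where equality of group elements is tested.\<close>

definition compatible :: "('g \<Rightarrow> 'g) \<Rightarrow> bool" where
  "compatible \<sigma> \<longleftrightarrow> \<sigma> ` real_form H \<subseteq> real_form H \<and>
    (\<forall>a\<in>affine_roots. \<exists>a'\<in>affine_roots. (\<forall>v. ev a (\<sigma> v) = ev a' v) \<and>
       arefl a \<circ> \<sigma> = \<sigma> \<circ> arefl a' \<and> kf (fst a) (fst a) = kf (fst a') (fst a'))"

lemma compatible_real_form: "compatible \<sigma> \<Longrightarrow> v \<in> real_form H \<Longrightarrow> \<sigma> v \<in> real_form H"
  by (auto simp: compatible_def)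

lemma compatible_pull:
  assumes "compatible \<sigma>" "a \<in> affine_roots"
  obtains a' where "a' \<in> affine_roots" "\<And>v. ev a (\<sigma> v) = ev a' v" "arefl a \<circ> \<sigma> = \<sigma> \<circ> arefl a'"
    "kf (fst a) (fst a) = kf (fst a') (fst a')" "\<And>v. v \<in> real_form H \<Longrightarrow> evr a (\<sigma> v) = evr a' v"
proof -
  obtain a' where a': "a' \<in> affine_roots" "\<And>v. ev a (\<sigma> v) = ev a' v" "arefl a \<circ> \<sigma> = \<sigma> \<circ> arefl a'"
    "kf (fst a) (fst a) = kf (fst a') (fst a')" using assms unfolding compatible_def by blast
  have "evr a (\<sigma> v) = evr a' v" if "v \<in> real_form H" for v
  proof -
    have "(of_real (evr a (\<sigma> v)) :: complex) = of_real (evr a' v)"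
      using a'(2)[of v] ev_real[OF assms(2) compatible_real_form[OF assms(1) that]] ev_real[OF a'(1) that] by simp
    then show ?thesis by (simp only: of_real_eq_iff)
  qed
  then show ?thesis using a' that by blast
qed

lemma compatible_id: "compatible id"
  unfolding compatible_def by auto

lemma compatible_comp:
  assumes \<sigma>: "compatible \<sigma>" and \<tau>: "compatible \<tau>"
  shows "compatible (\<sigma> \<circ> \<tau>)"
  unfolding compatible_def
proof (intro conjI ballI)
  show "(\<sigma> \<circ> \<tau>) ` real_form H \<subseteq> real_form H"
    using compatible_real_form[OF \<sigma>] compatible_real_form[OF \<tau>] by auto
  fix a assume a: "a \<in> affine_roots"
  obtain b where b: "b \<in> affine_roots" "\<And>v. ev a (\<sigma> v) = ev b v" "arefl a \<circ> \<sigma> = \<sigma> \<circ> arefl b"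
    "kf (fst a) (fst a) = kf (fst b) (fst b)" using compatible_pull[OF \<sigma> a] by metis
  obtain c where c: "c \<in> affine_roots" "\<And>v. ev b (\<tau> v) = ev c v" "arefl b \<circ> \<tau> = \<tau> \<circ> arefl c"
    "kf (fst b) (fst b) = kf (fst c) (fst c)" using compatible_pull[OF \<tau> b(1)] by metis
  have "arefl a \<circ> (\<sigma> \<circ> \<tau>) = (\<sigma> \<circ> \<tau>) \<circ> arefl c" using b(3) c(3) by (metis o_assoc)
  then show "\<exists>a'\<in>affine_roots. (\<forall>v. ev a ((\<sigma> \<circ> \<tau>) v) = ev a' v) \<and>
       arefl a \<circ> (\<sigma> \<circ> \<tau>) = \<sigma> \<circ> \<tau> \<circ> arefl a' \<and> kf (fst a) (fst a) = kf (fst a') (fst a')"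
    using b c by (intro bexI[of _ c]) auto
qed

lemma killing_coroot:
  assumes \<beta>: "\<beta> \<in> R" and \<phi>: "\<phi> \<in> R" and n: "2 * kf \<phi> \<beta> = of_int n * kf \<beta> \<beta>"
  shows "killing \<phi> (coroot \<beta>) = of_int n"
proof -
  have "killing \<phi> (coroot \<beta>) = of_real (2 * kf \<phi> \<beta> / kf \<beta> \<beta>)"
    by (simp add: coroot_def scaleR_scaleC killing_scale_right killing_roots \<beta> \<phi>)
  also have "2 * kf \<phi> \<beta> / kf \<beta> \<beta> = of_int n" using n kf_root_pos[OF \<beta>] by (simp add: field_simps)
  finally show ?thesis by simp
qed

text \<open>With \<open>n\<close> the Cartan integer, \<open>a'\<close> is the reflection of \<open>(\<phi>, k)\<close> in \<open>(\<beta>, m)\<close>.\<close>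

lemma arefl_action:
  fixes k m :: int
  assumes \<beta>: "\<beta> \<in> R" and \<phi>: "\<phi> \<in> R" and n: "2 * kf \<phi> \<beta> = of_int n * kf \<beta> \<beta>"
  defines "a' \<equiv> (\<phi> - of_int n *\<^sub>R \<beta>, k - n * m)"
  shows "ev (\<phi>, k) (arefl (\<beta>, m) v) = ev a' v"
    and "arefl (\<phi>, k) \<circ> arefl (\<beta>, m) = arefl (\<beta>, m) \<circ> arefl a'"
    and "kf (fst a') (fst a') = kf \<phi> \<phi>" and "a' \<in> affine_roots"
proof -
  have c: "kf \<beta> \<beta> > 0" "kf \<phi> \<phi> > 0" using kf_root_pos \<beta> \<phi> by auto
  have s: "srefl \<beta> \<phi> = \<phi> - of_int n *\<^sub>R \<beta>" using n c by (simp add: srefl_def)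
  show a'R: "a' \<in> affine_roots" using srefl_root[OF \<beta> \<phi>] by (simp add: affine_roots_iff a'_def s)
  show len: "kf (fst a') (fst a') = kf \<phi> \<phi>" using kf_srefl(1)[OF \<beta>, of \<phi> \<phi>] by (simp add: a'_def s)
  have ev: "ev (\<phi>, k) (arefl (\<beta>, m) v) = ev a' v" for v
    unfolding arefl_eq
    by (simp add: ev_def a'_def killing_diff_left killing_diff_right killing_scale_right killing_coroot[OF \<beta> \<phi> n]
        killing_scaleR) (simp add: distrib_left mult.commute)
  show "ev (\<phi>, k) (arefl (\<beta>, m) v) = ev a' v" by (rule ev)
  show "arefl (\<phi>, k) \<circ> arefl (\<beta>, m) = arefl (\<beta>, m) \<circ> arefl a'"
  proof
    fix v
    have "killing \<beta> (coroot (fst a')) = of_real (2 / kf \<phi> \<phi> * (kf \<beta> \<phi> - of_int n * kf \<beta> \<beta>))"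
      by (simp add: coroot_def len) (simp add: a'_def scaleR_scaleC killing_scale_right killing_diff_right killing_roots \<beta> \<phi>)
    also have "\<dots> = of_real (- (of_int n * kf \<beta> \<beta> / kf \<phi> \<phi>))"
      using n c by (simp add: kf_sym[of \<beta> \<phi>] field_simps)
    finally have kb: "killing \<beta> (coroot (fst a')) = of_real (- (of_int n * kf \<beta> \<beta> / kf \<phi> \<phi>))" .
    have "killing \<beta> (coroot (fst a')) *\<^sub>C coroot \<beta> = (- (of_int n * kf \<beta> \<beta> / kf \<phi> \<phi>)) *\<^sub>R coroot \<beta>"
      unfolding kb scaleR_scaleC ..
    also have "\<dots> = (- (2 / kf \<phi> \<phi>) * of_int n) *\<^sub>R \<beta>" using c by (simp add: coroot_def)
    also have "\<dots> = coroot (fst a') - coroot \<phi>"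
      by (simp add: coroot_def len) (simp add: a'_def scaleR_right_diff_distrib)
    finally have cor: "coroot (fst a') - killing \<beta> (coroot (fst a')) *\<^sub>C coroot \<beta> = coroot \<phi>" by simp
    have "(arefl (\<beta>, m) \<circ> arefl a') v
      = arefl (\<beta>, m) v - ev a' v *\<^sub>C (coroot (fst a') - killing \<beta> (coroot (fst a')) *\<^sub>C coroot \<beta>)"
      by (simp add: arefl_eq ev_def[of "(\<beta>, m)"] killing_diff_right killing_scale_right
          cvec.scale_right_diff_distrib cvec.scale_left_diff_distrib cvec.scale_left_distrib algebra_simps)
    also have "\<dots> = (arefl (\<phi>, k) \<circ> arefl (\<beta>, m)) v"
      unfolding cor by (simp add: arefl_eq[of "(\<phi>, k)"] ev)
    finally show "(arefl (\<phi>, k) \<circ> arefl (\<beta>, m)) v = (arefl (\<beta>, m) \<circ> arefl a') v" by simp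
  qed
qed

lemma real_form_diff: "x \<in> real_form H \<Longrightarrow> y \<in> real_form H \<Longrightarrow> x - y \<in> real_form H"
  and real_form_scale: "x \<in> real_form H \<Longrightarrow> r *\<^sub>R x \<in> real_form H"
  unfolding real_form_def by (auto intro: span_add span_diff span_scale)

lemma arefl_real:
  assumes "a \<in> affine_roots" "v \<in> real_form H"
  shows "arefl a v = v - evr a v *\<^sub>R coroot (fst a)"
  using assms by (simp add: arefl_eq ev_real scaleR_scaleC)

lemma compatible_refl:
  assumes b: "b \<in> affine_roots"
  shows "compatible (arefl b)"
  unfolding compatible_def
proof (intro conjI ballI)
  show "arefl b ` real_form H \<subseteq> real_form H"
  proof clarify
    fix v assume v: "v \<in> real_form H"
    have "fst b \<in> R" using b by (simp add: affine_roots_iff)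
    then show "arefl b v \<in> real_form H"
      unfolding arefl_real[OF b v] coroot_def by (intro real_form_diff v real_form_scale) (rule real_form_root)
  qed
  fix a assume a: "a \<in> affine_roots"
  obtain \<beta> m \<phi> k where eq: "b = (\<beta>, m)" "a = (\<phi>, k)" by fastforce
  have R: "\<beta> \<in> R" "\<phi> \<in> R" using a b by (auto simp: eq affine_roots_iff)
  obtain n :: int where n: "2 * kf \<phi> \<beta> = of_int n * kf \<beta> \<beta>" using cartan_integer[OF R] by blast
  from arefl_action[OF R n, of k m] show "\<exists>a'\<in>affine_roots. (\<forall>v. ev a (arefl b v) = ev a' v) \<and>
       arefl a \<circ> arefl b = arefl b \<circ> arefl a' \<and> kf (fst a) (fst a) = kf (fst a') (fst a')"
    unfolding eq by auto
qed

lemma arefl_involution: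
  assumes "a \<in> affine_roots"
  shows "arefl a \<circ> arefl a = id"
proof
  fix v
  have R: "fst a \<in> R" using assms by (simp add: affine_roots_iff)
  have "killing (fst a) (coroot (fst a)) = 2" using killing_coroot[OF R R, of 2] by simp
  then have "ev a (arefl a v) = - ev a v"
    by (simp add: arefl_eq ev_def killing_diff_right killing_scale_right)
  then show "(arefl a \<circ> arefl a) v = id v" by (subst o_apply, subst arefl_eq) (simp add: arefl_eq cvec.scale_minus_left)
qed

text \<open>The affine functions that define the walls of the fundamental alcove, positive on its
  interior.\<close>

definition simple_affine :: "'g affine_root set" where
  "simple_affine = insert (- \<psi>, 1) ((\<lambda>\<alpha>. (\<alpha>, 0)) ` P)"

lemma simple_reflections_eq: "simple_reflections H P = arefl ` simple_affine"
proof -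
  have "reflection \<psi> 1 = arefl (- \<psi>, 1)"
    using arefl_neg[of "(\<psi>, -1)"] by (simp add: neg_def arefl_def)
  then show ?thesis unfolding simple_reflections_def simple_affine_def
    by (simp add: arefl_def image_image Setcompr_eq_image)
qed

lemma simple_affine_root: "s \<in> simple_affine \<Longrightarrow> s \<in> affine_roots"
  by (auto simp: simple_affine_def affine_roots_iff P_root root_uminus highest_root(1))

lemma simple_affine_pos: "s \<in> simple_affine \<Longrightarrow> pos s"
  by (auto simp: simple_affine_def pos_def P_pos)

text \<open>This common normalization of \<open>2\<rho>\<close> with respect to linear and affine walls makes all
  crossings of hyperplanes contribute in the same way.\<close>

lemma simple_affine_evr: "s \<in> simple_affine \<Longrightarrow> evr s two_rho = kf (fst s) (fst s)"
  using highest_root_two_rho by (auto simp: simple_affine_def evr_def kf_two_rho_simple kf_simps)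

text \<open>For a linear wall this is the corresponding fact about positive roots. Reflection in
  the affine wall changes the level of \<open>(\<phi>, k)\<close> by a Cartan integer of \<open>\<psi>\<close>, which is at most
  one in absolute value unless \<open>\<phi> = \<plusminus>\<psi>\<close>.\<close>

lemma simple_reflection_pos:
  assumes s: "s \<in> simple_affine" and a: "a \<in> affine_roots" "pos a" "a \<noteq> s"
  shows "evr a (arefl s two_rho) > 0"
proof -
  obtain \<beta> m \<phi> k where eq: "s = (\<beta>, m)" "a = (\<phi>, k)" by fastforce
  have R: "\<beta> \<in> R" "\<phi> \<in> R" using a simple_affine_root[OF s] by (auto simp: eq affine_roots_iff)
  obtain n :: int where n: "2 * kf \<phi> \<beta> = of_int n * kf \<beta> \<beta>" using cartan_integer[OF R] by blast
  define a' where "a' = (\<phi> - of_int n *\<^sub>R \<beta>, k - n * m)"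
  note ra = arefl_action[OF R n, of k m, folded a'_def]
  have c: "kf \<beta> \<beta> > 0" using kf_root_pos R by auto
  have s': "srefl \<beta> \<phi> = \<phi> - of_int n *\<^sub>R \<beta>" using n c by (simp add: srefl_def)
  have "pos a'"
  proof -
    consider "\<beta> \<in> P" "m = 0" | "\<beta> = - \<psi>" "m = 1" using s by (auto simp: eq simple_affine_def)
    then show ?thesis
    proof cases
      case 1
      then show ?thesis using simple_reflection_permutes(1)[of \<beta> \<phi>] a by (auto simp: pos_def eq a'_def s')
    next
      case 2
      show ?thesis
      proof (cases "\<phi> = - \<psi>")
        case True
        then have n2: "n = 2" using n c 2 by simp
        have "k \<noteq> 1" using a(3) True 2 eq by auto
        moreover have "k > 0" using a(2) True not_pos_and_neg[of \<psi>] highest_root_pos by (auto simp: pos_def eq)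
        ultimately have "k \<ge> 2" by simp
        moreover have "\<phi> - of_int n *\<^sub>R \<beta> = \<psi>" using True 2 n2 by (simp add: scaleR_2)
        ultimately show ?thesis using highest_root_pos n2 2 by (auto simp: pos_def a'_def)
      next
        case False
        then have "- \<phi> \<noteq> \<psi>" by (metis minus_minus)
        moreover have "2 * kf (- \<phi>) \<psi> = of_int n * kf \<psi> \<psi>" using n 2 by (simp add: kf_simps)
        ultimately have n1: "n \<le> 1" by (rule highest_root_pairing[OF root_uminus[OF R(2)]])
        have k0: "k \<ge> 0" using a(2) by (auto simp: pos_def eq)
        show ?thesis
        proof (cases "n = 1")
          case True
          then have "kf \<phi> \<psi> < 0" using n c 2 by (simp add: kf_simps)
          then have "\<phi> \<notin> N" using pos_kf_highest[of \<phi>] by auto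
          then have "k \<ge> 1" using a(2) pos_rootsD by (auto simp: pos_def eq)
          moreover have "\<phi> + \<psi> \<in> Rp" using root_add_highest[OF R(2)] ra(4) True 2
            by (auto simp: pos_roots_def a'_def affine_roots_iff)
          ultimately show ?thesis using True 2 by (auto simp: pos_def a'_def)
        next
          case False
          then have "n = 0 \<or> n < 0" using n1 by auto
          then show ?thesis using a(2) k0 2 by (auto simp: pos_def a'_def eq)
        qed
      qed
    qed
  qed
  then have "evr a' two_rho > 0" using pos_iff_evr ra(4) by blast
  moreover have "of_real (evr a (arefl s two_rho)) = (of_real (evr a' two_rho) :: complex)"
    using ra(1)[of two_rho] ev_real[OF a(1)] ev_real[OF ra(4) two_rho_real_form]
      compatible_real_form[OF compatible_refl[OF simple_affine_root[OF s]] two_rho_real_form] by (simp add: eq)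
  ultimately show ?thesis by (simp only: of_real_eq_iff)
qed

lemma simple_reflection_own: "s \<in> simple_affine \<Longrightarrow> evr s (arefl s two_rho) < 0"
proof -
  assume s: "s \<in> simple_affine"
  note sR = simple_affine_root[OF s]
  have R: "fst s \<in> R" using sR by (simp add: affine_roots_iff)
  have "kf (fst s) (coroot (fst s)) = 2" using kf_root_pos[OF R] by (simp add: coroot_def kf_simps)
  then have "evr s (arefl s two_rho) = - evr s two_rho"
    by (simp add: arefl_real[OF sR two_rho_real_form] evr_def kf_simps)
  then show ?thesis using kf_root_pos[OF R] simple_affine_evr[OF s] by simp
qed

section \<open>Inversions and length\<close>

text \<open>The group generated by the reflections in the walls of the fundamental alcove; it
  turns out to be the affine Weyl group.\<close>

definition alcove_group :: "('g \<Rightarrow> 'g) set" where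
  "alcove_group = {word_prod ws | ws. set ws \<subseteq> simple_reflections H P}"

lemma alcove_groupI: "set ws \<subseteq> simple_reflections H P \<Longrightarrow> word_prod ws \<in> alcove_group"
  by (auto simp: alcove_group_def)

lemma alcove_group_id: "id \<in> alcove_group"
  using alcove_groupI[of "[]"] by simp

lemma alcove_group_comp: "\<sigma> \<in> alcove_group \<Longrightarrow> \<tau> \<in> alcove_group \<Longrightarrow> \<sigma> \<circ> \<tau> \<in> alcove_group"
proof -
  assume "\<sigma> \<in> alcove_group" "\<tau> \<in> alcove_group"
  then obtain ws vs where "\<sigma> = word_prod ws" "set ws \<subseteq> simple_reflections H P"
    "\<tau> = word_prod vs" "set vs \<subseteq> simple_reflections H P" by (auto simp: alcove_group_def)
  then show ?thesis using alcove_groupI[of "ws @ vs"] by (simp add: word_prod_append)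
qed

lemma alcove_group_refl: "s \<in> simple_affine \<Longrightarrow> arefl s \<in> alcove_group"
  using alcove_groupI[of "[arefl s]"] by (simp add: simple_reflections_eq)

lemma word_inverse:
  assumes "set ws \<subseteq> simple_reflections H P"
  shows "word_prod ws \<circ> word_prod (rev ws) = id"
  using assms
proof (induction ws)
  case (Cons r ws)
  then obtain s where s: "s \<in> simple_affine" "r = arefl s" by (auto simp: simple_reflections_eq)
  have "word_prod (r # ws) \<circ> word_prod (rev (r # ws)) = r \<circ> (word_prod ws \<circ> word_prod (rev ws)) \<circ> r"
    by (simp add: word_prod_append o_assoc)
  also have "word_prod ws \<circ> word_prod (rev ws) = id" by (rule Cons.IH) (use Cons.prems in simp)
  also have "r \<circ> id \<circ> r = id" using s arefl_involution[OF simple_affine_root[OF s(1)]] by simp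
  finally show ?case .
qed simp

lemma alcove_group_inverse:
  assumes "\<sigma> \<in> alcove_group"
  obtains \<tau> where "\<tau> \<in> alcove_group" "\<sigma> \<circ> \<tau> = id" "\<tau> \<circ> \<sigma> = id"
proof -
  obtain ws where ws: "\<sigma> = word_prod ws" "set ws \<subseteq> simple_reflections H P" using assms by (auto simp: alcove_group_def)
  have "word_prod (rev ws) \<in> alcove_group" using ws by (intro alcove_groupI) simp
  moreover have "word_prod (rev ws) \<circ> \<sigma> = id" using word_inverse[of "rev ws"] ws by simp
  ultimately show ?thesis using word_inverse[OF ws(2)] ws(1) that by blast
qed

lemma alcove_group_compatible: "\<sigma> \<in> alcove_group \<Longrightarrow> compatible \<sigma>"
proof -
  have "compatible (word_prod ws)" if "set ws \<subseteq> simple_reflections H P" for ws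
    using that
  proof (induction ws)
    case (Cons r ws)
    then obtain s where "s \<in> simple_affine" "r = arefl s" by (auto simp: simple_reflections_eq)
    then show ?case
      using Cons compatible_comp[OF compatible_refl[OF simple_affine_root], of s "word_prod ws"] by (simp del: o_apply)
  qed (simp add: compatible_id)
  then show "\<sigma> \<in> alcove_group \<Longrightarrow> compatible \<sigma>" by (auto simp: alcove_group_def)
qed

lemma alcove_group_push:
  assumes \<sigma>: "\<sigma> \<in> alcove_group" and s: "s \<in> affine_roots"
  obtains c where "c \<in> affine_roots" "\<And>v. ev c (\<sigma> v) = ev s v" "arefl c \<circ> \<sigma> = \<sigma> \<circ> arefl s"
    "kf (fst c) (fst c) = kf (fst s) (fst s)"
proof -
  obtain \<tau> where \<tau>: "\<tau> \<in> alcove_group" "\<sigma> \<circ> \<tau> = id" "\<tau> \<circ> \<sigma> = id" using alcove_group_inverse[OF \<sigma>] .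
  obtain c where c: "c \<in> affine_roots" "\<And>v. ev s (\<tau> v) = ev c v"
    using compatible_pull[OF alcove_group_compatible[OF \<tau>(1)] s] by metis
  have ev: "ev c (\<sigma> v) = ev s v" for v using c(2)[of "\<sigma> v"] \<tau>(3) by (metis comp_apply id_apply)
  obtain d where d: "d \<in> affine_roots" "\<And>v. ev c (\<sigma> v) = ev d v" "arefl c \<circ> \<sigma> = \<sigma> \<circ> arefl d"
    "kf (fst c) (fst c) = kf (fst d) (fst d)"
    using compatible_pull[OF alcove_group_compatible[OF \<sigma>] c(1)] by metis
  have "d = s" using d(2) ev by (intro ev_inj) simp
  then show ?thesis using that c(1) ev d by blast
qed

text \<open>One affine root for each hyperplane that separates the fundamental alcove, represented
  by its interior point \<open>2\<rho>\<close>, from its image under \<open>\<sigma>\<close>.\<close>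

definition Inv :: "('g \<Rightarrow> 'g) \<Rightarrow> 'g affine_root set" where
  "Inv \<sigma> = {a\<in>affine_roots. pos a \<and> evr a (\<sigma> two_rho) < 0}"

lemma finite_Inv: "finite (Inv \<sigma>)"
proof -
  define M where "M = (\<Sum>\<phi>\<in>R. \<bar>kf \<phi> (\<sigma> two_rho)\<bar>)"
  have "Inv \<sigma> \<subseteq> R \<times> {0..\<lceil>M\<rceil>}"
  proof
    fix a assume a: "a \<in> Inv \<sigma>"
    then have R: "fst a \<in> R" by (simp add: Inv_def affine_roots_iff)
    have "\<bar>kf (fst a) (\<sigma> two_rho)\<bar> \<le> M" unfolding M_def using finite_roots R by (intro member_le_sum) auto
    then have "real_of_int (snd a) \<le> M" using a by (auto simp: Inv_def evr_def)
    then have "snd a \<le> \<lceil>M\<rceil>" by (simp add: le_ceiling_iff)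
    moreover have "snd a \<ge> 0" using a by (auto simp: Inv_def pos_def)
    ultimately show "a \<in> R \<times> {0..\<lceil>M\<rceil>}" using R by (cases a) auto
  qed
  then show ?thesis using finite_roots by (meson finite_SigmaI finite_atLeastAtMost_int finite_subset)
qed

lemma Inv_id: "Inv id = {}" and Inv_ident: "Inv (\<lambda>x. x) = {}"
  using pos_iff_evr by (force simp: Inv_def)+

text \<open>The images of the fundamental alcove under \<open>\<sigma>\<close> and \<open>\<sigma> \<circ> arefl s\<close> are adjacent. The
  hyperplane between them is that of \<open>c\<close>, the image of \<open>s\<close> under \<open>\<sigma>\<close>; it is crossed outwards
  or inwards according to the sign of \<open>c\<close>.\<close>

lemma Inv_step:
  assumes \<sigma>: "\<sigma> \<in> alcove_group" and s: "s \<in> simple_affine"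
    and c: "c \<in> affine_roots" "\<And>v. ev c (\<sigma> v) = ev s v"
  shows "pos c \<Longrightarrow> c \<notin> Inv \<sigma> \<and> Inv (\<sigma> \<circ> arefl s) = insert c (Inv \<sigma>)"
    and "\<not> pos c \<Longrightarrow> neg c \<in> Inv \<sigma> \<and> Inv (\<sigma> \<circ> arefl s) = Inv \<sigma> - {neg c}"
proof -
  note \<sigma>c = alcove_group_compatible[OF \<sigma>]
  note sR = simple_affine_root[OF s]
  obtain \<tau> where \<tau>: "\<sigma> \<circ> \<tau> = id" using alcove_group_inverse[OF \<sigma>] by metis
  have cancel: "a = b" if "\<And>v. ev a (\<sigma> v) = ev b (\<sigma> v)" for a b
  proof (rule ev_inj)
    fix v
    show "ev a v = ev b v" using that[of "\<tau> v"] \<tau> by (metis comp_apply id_apply)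
  qed
  note srf = compatible_real_form[OF compatible_refl[OF sR] two_rho_real_form]
  obtain c' where c': "\<And>v. ev c (\<sigma> v) = ev c' v" "\<And>v. v \<in> real_form H \<Longrightarrow> evr c (\<sigma> v) = evr c' v"
    using compatible_pull[OF \<sigma>c c(1)] by metis
  have "c' = s" using c' c(2) by (intro ev_inj) simp
  then have evc: "evr c (\<sigma> v) = evr s v" if "v \<in> real_form H" for v using c'(2) that by simp
  have spos: "evr s two_rho > 0" using pos_iff_evr(1)[OF sR] simple_affine_pos[OF s] by simp
  have ow: "evr s (arefl s two_rho) < 0" by (rule simple_reflection_own[OF s])
  have other: "evr a (\<sigma> (arefl s two_rho)) < 0 \<longleftrightarrow> evr a (\<sigma> two_rho) < 0"
    if a: "a \<in> affine_roots" "a \<noteq> c" "a \<noteq> neg c" for a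
  proof -
    obtain a' where a': "a' \<in> affine_roots" "\<And>v. ev a (\<sigma> v) = ev a' v"
        "\<And>v. v \<in> real_form H \<Longrightarrow> evr a (\<sigma> v) = evr a' v"
      using compatible_pull[OF \<sigma>c a(1)] by metis
    have ne: "a' \<noteq> s" using cancel[of a c] a'(2) c(2) a(2) by auto
    have ne': "neg a' \<noteq> s"
    proof
      assume "neg a' = s"
      then have "a' = neg s" by (metis neg_neg)
      then have "a = neg c" using a'(2) c(2) by (intro cancel) (simp add: ev_neg)
      then show False using a(3) by simp
    qed
    show ?thesis
    proof (cases "pos a'")
      case True
      then show ?thesis
        using simple_reflection_pos[OF s a'(1) True ne] pos_iff_evr(1)[OF a'(1)] a'(3)[OF srf] a'(3)[OF two_rho_real_form]
        by simp
    next
      case False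
      then have "pos (neg a')" using pos_neg a' by blast
      then have "evr (neg a') (arefl s two_rho) > 0"
        using simple_reflection_pos[OF s neg_affine_root[OF a'(1)] _ ne'] by blast
      then show ?thesis using False pos_iff_evr(2)[OF a'(1)] a'(3)[OF srf] a'(3)[OF two_rho_real_form]
        by (simp add: evr_neg)
    qed
  qed
  have same: "a \<in> Inv (\<sigma> \<circ> arefl s) \<longleftrightarrow> a \<in> Inv \<sigma>" if "a \<noteq> c" "a \<noteq> neg c" for a
    using other[OF _ that] by (auto simp: Inv_def)
  have cc: "c \<in> Inv (\<sigma> \<circ> arefl s) \<longleftrightarrow> pos c" "c \<notin> Inv \<sigma>"
    using c(1) evc[OF srf] evc[OF two_rho_real_form] ow spos by (auto simp: Inv_def)
  have nc: "neg c \<in> Inv \<sigma> \<longleftrightarrow> \<not> pos c" "neg c \<notin> Inv (\<sigma> \<circ> arefl s)"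
    using neg_affine_root[OF c(1)] pos_neg[OF c(1)] evc[OF srf] evc[OF two_rho_real_form] ow spos
    by (auto simp: Inv_def evr_neg)
  have "a \<in> Inv (\<sigma> \<circ> arefl s) \<longleftrightarrow> a \<in> insert c (Inv \<sigma>)" if "pos c" for a
    by (cases "a = c"; cases "a = neg c") (use same[of a] cc nc that in auto)
  then show "pos c \<Longrightarrow> c \<notin> Inv \<sigma> \<and> Inv (\<sigma> \<circ> arefl s) = insert c (Inv \<sigma>)"
    using cc by blast
  have "a \<in> Inv (\<sigma> \<circ> arefl s) \<longleftrightarrow> a \<in> Inv \<sigma> - {neg c}" if "\<not> pos c" for a
    by (cases "a = c"; cases "a = neg c") (use same[of a] cc nc that in auto)
  then show "\<not> pos c \<Longrightarrow> neg c \<in> Inv \<sigma> \<and> Inv (\<sigma> \<circ> arefl s) = Inv \<sigma> - {neg c}"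
    using nc by blast
qed

text \<open>For odd \<open>f\<close> the two directions of crossing give the same formula.\<close>

lemma sum_Inv_step:
  fixes f :: "'g affine_root \<Rightarrow> 'b::ab_group_add"
  assumes \<sigma>: "\<sigma> \<in> alcove_group" and s: "s \<in> simple_affine"
    and c: "c \<in> affine_roots" "\<And>v. ev c (\<sigma> v) = ev s v" and odd: "\<And>a. f (neg a) = - f a"
  shows "sum f (Inv (\<sigma> \<circ> arefl s)) = sum f (Inv \<sigma>) + f c"
proof (cases "pos c")
  case True
  then show ?thesis using Inv_step(1)[OF \<sigma> s c] finite_Inv[of \<sigma>] by (simp add: add.commute)
next
  case False
  then have *: "neg c \<in> Inv \<sigma>" "Inv (\<sigma> \<circ> arefl s) = Inv \<sigma> - {neg c}" using Inv_step(2)[OF \<sigma> s c] by auto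
  then show ?thesis using sum.remove[OF finite_Inv[of \<sigma>] *(1), of f] by (simp add: odd)
qed

lemma word_split_last:
  assumes "set (ws @ [r]) \<subseteq> simple_reflections H P"
  obtains s where "s \<in> simple_affine" "r = arefl s" "set ws \<subseteq> simple_reflections H P"
    "word_prod (ws @ [r]) = word_prod ws \<circ> arefl s" "word_prod ws \<in> alcove_group"
proof -
  obtain s where "s \<in> simple_affine" "r = arefl s" using assms by (auto simp: simple_reflections_eq)
  then show ?thesis using assms that alcove_groupI[of ws] by (simp add: word_prod_append)
qed

text \<open>A letter of the word crosses the hyperplane of \<open>c = (\<beta>, k)\<close>. The affine function \<open>c\<close>
  has at the current image \<open>y\<close> of \<open>2\<rho>\<close> the value \<open>(\<beta>, \<beta>)\<close> that a simple one has at \<open>2\<rho>\<close>, so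
  \<open>y\<close> moves to \<open>y - 2\<beta>\<close>, and \<open>|y|\<^sup>2\<close> changes by \<open>4(\<beta>, \<beta>) - 4(\<beta>, y) = 4k\<close>.\<close>

lemma image_two_rho:
  assumes "\<sigma> \<in> alcove_group"
  shows "\<sigma> two_rho = two_rho - (\<Sum>a\<in>Inv \<sigma>. 2 *\<^sub>R fst a)"
    and "kf (\<sigma> two_rho) (\<sigma> two_rho) = kf two_rho two_rho + (\<Sum>a\<in>Inv \<sigma>. 4 * of_int (snd a))"
proof -
  have *: "\<sigma> two_rho = two_rho - (\<Sum>a\<in>Inv \<sigma>. 2 *\<^sub>R fst a) \<and>
      kf (\<sigma> two_rho) (\<sigma> two_rho) = kf two_rho two_rho + (\<Sum>a\<in>Inv \<sigma>. 4 * of_int (snd a))"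
    if "set ws \<subseteq> simple_reflections H P" "\<sigma> = word_prod ws" for ws \<sigma>
    using that
  proof (induction ws arbitrary: \<sigma> rule: rev_induct)
    case Nil
    then show ?case by (simp add: Inv_id Inv_ident)
  next
    case (snoc r ws)
    obtain s where s: "s \<in> simple_affine" "set ws \<subseteq> simple_reflections H P"
      "word_prod (ws @ [r]) = word_prod ws \<circ> arefl s" "word_prod ws \<in> alcove_group"
      using word_split_last[OF snoc.prems(1)] by metis
    define \<tau> where "\<tau> = word_prod ws"
    have \<tau>: "\<tau> \<in> alcove_group" "\<sigma> = \<tau> \<circ> arefl s" using s snoc.prems by (auto simp: \<tau>_def)
    obtain c where c: "c \<in> affine_roots" "\<And>v. ev c (\<tau> v) = ev s v" "arefl c \<circ> \<tau> = \<tau> \<circ> arefl s"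
      "kf (fst c) (fst c) = kf (fst s) (fst s)" using alcove_group_push[OF \<tau>(1) simple_affine_root[OF s(1)]] by metis
    let ?y = "\<tau> two_rho"
    have yV: "?y \<in> real_form H"
      by (rule compatible_real_form[OF alcove_group_compatible[OF \<tau>(1)] two_rho_real_form])
    have "(of_real (evr c ?y) :: complex) = of_real (evr s two_rho)"
      using c(2)[of two_rho] ev_real[OF c(1) yV] ev_real[OF simple_affine_root[OF s(1)] two_rho_real_form] by simp
    then have e: "evr c ?y = kf (fst c) (fst c)" using simple_affine_evr[OF s(1)] c(4) by (simp only: of_real_eq_iff)
    have pos: "kf (fst c) (fst c) > 0" using kf_root_pos c(1) by (simp add: affine_roots_iff)
    have "\<sigma> two_rho = arefl c ?y" using c(3) \<tau>(2) by (metis comp_apply)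
    also have "\<dots> = ?y - 2 *\<^sub>R fst c" using arefl_real[OF c(1) yV] e pos by (simp add: coroot_def)
    finally have y': "\<sigma> two_rho = ?y - 2 *\<^sub>R fst c" .
    have "kf (\<sigma> two_rho) (\<sigma> two_rho) = kf ?y ?y - 4 * kf (fst c) ?y + 4 * kf (fst c) (fst c)"
      unfolding y' by (simp add: kf_simps kf_sym[of ?y "fst c"])
    also have "kf (fst c) (fst c) = kf (fst c) ?y + of_int (snd c)" using e by (simp add: evr_def)
    finally have n': "kf (\<sigma> two_rho) (\<sigma> two_rho) = kf ?y ?y + 4 * of_int (snd c)" by simp
    have "(\<Sum>a\<in>Inv \<sigma>. 2 *\<^sub>R fst a) = (\<Sum>a\<in>Inv \<tau>. 2 *\<^sub>R fst a) + 2 *\<^sub>R fst c"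
      unfolding \<tau>(2) by (rule sum_Inv_step[OF \<tau>(1) s(1) c(1,2)]) (simp add: neg_def)
    moreover have "(\<Sum>a\<in>Inv \<sigma>. 4 * of_int (snd a)) = (\<Sum>a\<in>Inv \<tau>. 4 * of_int (snd a)) + (4 * of_int (snd c) :: real)"
      unfolding \<tau>(2) by (rule sum_Inv_step[OF \<tau>(1) s(1) c(1,2)]) (simp add: neg_def)
    moreover have IH: "?y = two_rho - (\<Sum>a\<in>Inv \<tau>. 2 *\<^sub>R fst a)"
      "kf ?y ?y = kf two_rho two_rho + (\<Sum>a\<in>Inv \<tau>. 4 * of_int (snd a))"
      using snoc.IH[OF s(2) \<tau>_def] by auto
    moreover have "\<sigma> two_rho = two_rho - ((\<Sum>a\<in>Inv \<tau>. 2 *\<^sub>R fst a) + 2 *\<^sub>R fst c)"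
      unfolding y' by (subst IH(1)) (rule diff_diff_eq)
    ultimately show ?case using n' by (intro conjI) (simp only:, linarith)
  qed
  obtain ws where "set ws \<subseteq> simple_reflections H P" "\<sigma> = word_prod ws" using assms by (auto simp: alcove_group_def)
  from *[OF this] show "\<sigma> two_rho = two_rho - (\<Sum>a\<in>Inv \<sigma>. 2 *\<^sub>R fst a)"
    "kf (\<sigma> two_rho) (\<sigma> two_rho) = kf two_rho two_rho + (\<Sum>a\<in>Inv \<sigma>. 4 * of_int (snd a))" by auto
qed

text \<open>The word loses the letter that crosses the hyperplane of \<open>a\<close>.\<close>

lemma exchange:
  assumes "set ws \<subseteq> simple_reflections H P" "a \<in> Inv (word_prod ws)"
  shows "\<exists>ws'. set ws' \<subseteq> simple_reflections H P \<and> Suc (length ws') = length ws \<and> arefl a \<circ> word_prod ws = word_prod ws'"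
  using assms
proof (induction ws rule: rev_induct)
  case Nil
  then show ?case by (simp add: Inv_id Inv_ident)
next
  case (snoc r ws)
  obtain s where s: "s \<in> simple_affine" "r = arefl s" "set ws \<subseteq> simple_reflections H P"
    "word_prod (ws @ [r]) = word_prod ws \<circ> arefl s" "word_prod ws \<in> alcove_group"
    using word_split_last[OF snoc.prems(1)] by metis
  obtain c where c: "c \<in> affine_roots" "\<And>v. ev c (word_prod ws v) = ev s v" "arefl c \<circ> word_prod ws = word_prod ws \<circ> arefl s"
    using alcove_group_push[OF s(5) simple_affine_root[OF s(1)]] by metis
  show ?case
  proof (cases "a \<in> Inv (word_prod ws)")
    case True
    then obtain ws' where ws': "set ws' \<subseteq> simple_reflections H P" "Suc (length ws') = length ws"
      "arefl a \<circ> word_prod ws = word_prod ws'" using snoc.IH s(3) by blast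
    have "arefl a \<circ> word_prod (ws @ [r]) = word_prod (ws' @ [r])"
      unfolding word_prod_append o_assoc ws'(3) ..
    then show ?thesis using ws' snoc.prems(1) by (intro exI[of _ "ws' @ [r]"]) auto
  next
    case False
    moreover have "a \<in> Inv (word_prod ws \<circ> arefl s)" using snoc.prems(2) unfolding s(4) .
    ultimately have ac: "a = c" by (cases "pos c") (use Inv_step[OF s(5,1) c(1,2)] in blast)+
    have "arefl a \<circ> word_prod (ws @ [r]) = (arefl c \<circ> word_prod ws) \<circ> arefl s" unfolding s(4) ac by (rule o_assoc)
    also have "\<dots> = word_prod ws \<circ> (arefl s \<circ> arefl s)" unfolding c(3) by (rule o_assoc[symmetric])
    also have "\<dots> = word_prod ws" unfolding arefl_involution[OF simple_affine_root[OF s(1)]] by (rule comp_id)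
    finally show ?thesis using s(3) by auto
  qed
qed

text \<open>Each letter crosses a new hyperplane unless it crosses back over an earlier one; in
  the latter case the exchange property deletes both letters.\<close>

lemma reduced_or_shorter:
  assumes "set ws \<subseteq> simple_reflections H P"
  shows "card (Inv (word_prod ws)) = length ws \<or>
    (\<exists>ws'. set ws' \<subseteq> simple_reflections H P \<and> length ws' < length ws \<and> word_prod ws' = word_prod ws)"
  using assms
proof (induction ws rule: rev_induct)
  case Nil
  then show ?case by (simp add: Inv_id Inv_ident)
next
  case (snoc r ws)
  obtain s where s: "s \<in> simple_affine" "r = arefl s" "set ws \<subseteq> simple_reflections H P"
    "word_prod (ws @ [r]) = word_prod ws \<circ> arefl s" "word_prod ws \<in> alcove_group"
    using word_split_last[OF snoc.prems(1)] by metis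
  obtain c where c: "c \<in> affine_roots" "\<And>v. ev c (word_prod ws v) = ev s v" "arefl c \<circ> word_prod ws = word_prod ws \<circ> arefl s"
    using alcove_group_push[OF s(5) simple_affine_root[OF s(1)]] by metis
  from snoc.IH[OF s(3)] show ?case
  proof
    assume len: "card (Inv (word_prod ws)) = length ws"
    show ?thesis
    proof (cases "pos c")
      case True
      then have "Inv (word_prod (ws @ [r])) = insert c (Inv (word_prod ws))" "c \<notin> Inv (word_prod ws)"
        unfolding s(4) using Inv_step(1)[OF s(5,1) c(1,2)] by blast+
      then have "card (Inv (word_prod (ws @ [r]))) = length (ws @ [r])" using len finite_Inv by simp
      then show ?thesis ..
    next
      case False
      then have "neg c \<in> Inv (word_prod ws)" using Inv_step(2)[OF s(5,1) c(1,2)] by blast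
      then obtain ws' where ws': "set ws' \<subseteq> simple_reflections H P" "Suc (length ws') = length ws"
        "arefl (neg c) \<circ> word_prod ws = word_prod ws'" using exchange s(3) by blast
      then have "word_prod ws' = word_prod (ws @ [r])" unfolding s(4) c(3)[symmetric] arefl_neg by simp
      then show ?thesis using ws' by (intro disjI2 exI[of _ ws']) auto
    qed
  next
    assume "\<exists>ws'. set ws' \<subseteq> simple_reflections H P \<and> length ws' < length ws \<and> word_prod ws' = word_prod ws"
    then obtain ws' where "set ws' \<subseteq> simple_reflections H P" "length ws' < length ws" "word_prod ws' = word_prod ws" by blast
    then show ?thesis using snoc.prems by (intro disjI2 exI[of _ "ws' @ [r]"]) (auto simp: word_prod_append)
  qed
qed

lemma coxeter_length_eq:
  assumes "\<sigma> \<in> alcove_group"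
  shows "coxeter_length H P \<sigma> = card (Inv \<sigma>)"
proof -
  let ?Q = "\<lambda>k. \<exists>ws. length ws = k \<and> set ws \<subseteq> simple_reflections H P \<and> word_prod ws = \<sigma>"
  have "\<exists>k. ?Q k" using assms by (auto simp: alcove_group_def)
  then have "?Q (coxeter_length H P \<sigma>)" unfolding coxeter_length_def by (rule LeastI_ex)
  then obtain ws where ws: "length ws = coxeter_length H P \<sigma>" "set ws \<subseteq> simple_reflections H P" "word_prod ws = \<sigma>" by blast
  have "\<not> length ws' < length ws" if "set ws' \<subseteq> simple_reflections H P" "word_prod ws' = \<sigma>" for ws'
  proof -
    have "?Q (length ws')" using that by blast
    then have "coxeter_length H P \<sigma> \<le> length ws'" unfolding coxeter_length_def by (rule Least_le)
    then show ?thesis using ws(1) by simp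
  qed
  then show ?thesis using reduced_or_shorter[OF ws(2)] ws by metis
qed

text \<open>The element \<open>\<tau>\<^sup>-\<^sup>1\<sigma>\<close> fixes \<open>2\<rho>\<close>; so it has no inversions, and its length is zero.\<close>

lemma alcove_group_determined:
  assumes \<sigma>: "\<sigma> \<in> alcove_group" and \<tau>: "\<tau> \<in> alcove_group" and eq: "\<sigma> two_rho = \<tau> two_rho"
  shows "\<sigma> = \<tau>"
proof -
  obtain \<tau>' where \<tau>': "\<tau>' \<in> alcove_group" "\<tau> \<circ> \<tau>' = id" "\<tau>' \<circ> \<tau> = id" using alcove_group_inverse[OF \<tau>] .
  let ?\<rho> = "\<tau>' \<circ> \<sigma>"
  have \<rho>: "?\<rho> \<in> alcove_group" using alcove_group_comp \<tau>'(1) \<sigma> by blast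
  have "?\<rho> two_rho = two_rho" using eq \<tau>'(3) by (metis comp_apply id_apply)
  then have "Inv ?\<rho> = {}" using pos_iff_evr by (force simp: Inv_def)
  then have l: "coxeter_length H P ?\<rho> = 0" using coxeter_length_eq[OF \<rho>] by simp
  let ?Q = "\<lambda>k. \<exists>ws. length ws = k \<and> set ws \<subseteq> simple_reflections H P \<and> word_prod ws = ?\<rho>"
  have "\<exists>k. ?Q k" using \<rho> by (auto simp: alcove_group_def)
  then have "?Q (coxeter_length H P ?\<rho>)" unfolding coxeter_length_def by (rule LeastI_ex)
  then obtain ws where "length ws = 0" "word_prod ws = ?\<rho>" unfolding l by blast
  then have id: "?\<rho> = id" by (metis length_0_conv word_prod_Nil)
  have "\<sigma> = (\<tau> \<circ> \<tau>') \<circ> \<sigma>" unfolding \<tau>'(2) by (rule id_comp[symmetric])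
  also have "\<dots> = \<tau> \<circ> ?\<rho>" by (rule o_assoc[symmetric])
  also have "\<dots> = \<tau>" unfolding id by (rule comp_id)
  finally show ?thesis .
qed

end

section \<open>The affine Weyl group and Casimir eigenvalues\<close>

context simple_system
begin

text \<open>This exhibits \<open>(\<phi>, k)\<close> as \<open>k(1 - \<psi>) + (\<phi> + k\<psi>)\<close>, a nonnegative combination of simple
  affine roots.\<close>

lemma pos_affine_N:
  assumes "a \<in> affine_roots" "pos a"
  shows "fst a + of_int (snd a) *\<^sub>R \<psi> \<in> N" "snd a \<ge> 0"
proof -
  have R: "fst a \<in> R" using assms(1) by (simp add: affine_roots_iff)
  show "snd a \<ge> 0" using assms(2) by (auto simp: pos_def)
  show "fst a + of_int (snd a) *\<^sub>R \<psi> \<in> N"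
  proof (cases "snd a > 0")
    case True
    have "(fst a + \<psi>) + real (nat (snd a - 1)) *\<^sub>R \<psi> \<in> N"
      by (rule N_add[OF root_add_highest[OF R] N_scale[OF pos_rootsD(2)[OF highest_root_pos]]])
    also have "(fst a + \<psi>) + real (nat (snd a - 1)) *\<^sub>R \<psi> = fst a + of_int (snd a) *\<^sub>R \<psi>"
      using True by (simp add: scaleR_left_diff_distrib)
    finally show ?thesis .
  next
    case False
    then show ?thesis using assms(2) pos_rootsD by (auto simp: pos_def)
  qed
qed

text \<open>The linear part of \<open>a\<close> is a nonnegative combination of those of the simple affine
  roots, and its square is positive.\<close>

lemma pos_affine_pairs_simple:
  assumes a: "a \<in> affine_roots" "pos a"
  shows "\<exists>s\<in>simple_affine. kf (fst s) (fst a) > 0"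
proof (rule ccontr)
  let ?\<phi> = "fst a"
  assume no: "\<not> ?thesis"
  then have P: "kf \<alpha> ?\<phi> \<le> 0" if "\<alpha> \<in> P" for \<alpha>
    using that by (force simp: simple_affine_def)
  have "kf (- \<psi>) ?\<phi> \<le> 0" using no by (force simp: simple_affine_def)
  then have \<psi>: "kf \<psi> ?\<phi> \<ge> 0" by (simp add: kf_simps)
  have "kf (?\<phi> + of_int (snd a) *\<^sub>R \<psi>) (- ?\<phi>) \<ge> 0"
    by (rule N_kf_nonneg[OF pos_affine_N(1)[OF a]]) (use P in \<open>simp add: kf_simps\<close>)
  moreover have "of_int (snd a) * kf \<psi> ?\<phi> \<ge> 0" using \<psi> pos_affine_N(2)[OF a] by simp
  ultimately show False using kf_root_pos[of ?\<phi>] a by (simp add: kf_simps affine_roots_iff)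
qed

text \<open>Induction on the value at \<open>2\<rho>\<close>. A positive affine root that is not simple pairs
  positively with a simple one, whose reflection takes it to a positive affine root with a
  smaller value; the two reflections are conjugate.\<close>

lemma arefl_alcove_group:
  assumes "a \<in> affine_roots"
  shows "arefl a \<in> alcove_group"
proof -
  have posc: "arefl a \<in> alcove_group" if "a \<in> {a\<in>affine_roots. pos a}" for a
    using _ _ that
  proof (rule finite_real_induct[where f = "\<lambda>a. evr a two_rho"])
    fix a
    have "{b \<in> {a \<in> affine_roots. pos a}. evr b two_rho < evr a two_rho} \<subseteq> R \<times> {0..\<lceil>evr a two_rho + 1\<rceil>}"
    proof
      fix b assume b: "b \<in> {b \<in> {a \<in> affine_roots. pos a}. evr b two_rho < evr a two_rho}"
      then have R: "fst b \<in> R" by (simp add: affine_roots_iff)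
      have "real_of_int (snd b) \<le> evr a two_rho + 1"
        using b evr_two_rho_bound[OF R] by (auto simp: evr_def)
      then have "snd b \<le> \<lceil>evr a two_rho + 1\<rceil>"
        using le_of_int_ceiling[of "evr a two_rho + 1"] by linarith
      moreover have "snd b \<ge> 0" using b by (auto simp: pos_def)
      ultimately show "b \<in> R \<times> {0..\<lceil>evr a two_rho + 1\<rceil>}" using R by (cases b) auto
    qed
    then show "finite {b \<in> {a \<in> affine_roots. pos a}. evr b two_rho < evr a two_rho}"
      using finite_roots by (meson finite_SigmaI finite_atLeastAtMost_int finite_subset)
  next
    fix a assume a: "a \<in> {a \<in> affine_roots. pos a}"
      and IH: "\<And>b. b \<in> {a \<in> affine_roots. pos a} \<Longrightarrow> evr b two_rho < evr a two_rho \<Longrightarrow> arefl b \<in> alcove_group"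
    obtain \<phi> k where eq: "a = (\<phi>, k)" by fastforce
    have \<phi>: "\<phi> \<in> R" using a by (simp add: eq affine_roots_iff)
    show "arefl a \<in> alcove_group"
    proof (cases "a \<in> simple_affine")
      case True
      then show ?thesis by (rule alcove_group_refl)
    next
      case False
      obtain s where s: "s \<in> simple_affine" "kf (fst s) \<phi> > 0"
        using pos_affine_pairs_simple[of a] a by (auto simp: eq)
      obtain \<beta> m where seq: "s = (\<beta>, m)" by fastforce
      have \<beta>: "\<beta> \<in> R" using simple_affine_root[OF s(1)] by (simp add: seq affine_roots_iff)
      obtain n :: int where n: "2 * kf \<phi> \<beta> = of_int n * kf \<beta> \<beta>" using cartan_integer[OF \<beta> \<phi>] by blast
      define a' where "a' = (\<phi> - of_int n *\<^sub>R \<beta>, k - n * m)"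
      note ra = arefl_action[OF \<beta> \<phi> n, of k m, folded a'_def]
      have "of_int n * kf \<beta> \<beta> > 0" using n s(2) by (simp add: seq kf_sym)
      then have npos: "n > 0" using kf_root_pos[OF \<beta>] by (simp add: zero_less_mult_iff)
      have srf: "arefl s two_rho \<in> real_form H"
        by (rule compatible_real_form[OF compatible_refl[OF simple_affine_root[OF s(1)]] two_rho_real_form])
      have "(of_real (evr a (arefl s two_rho)) :: complex) = of_real (evr a' two_rho)"
        using ra(1)[of two_rho] a ev_real[OF _ srf, of a] ev_real[OF ra(4) two_rho_real_form] by (simp add: eq seq)
      then have e: "evr a (arefl s two_rho) = evr a' two_rho" by (simp only: of_real_eq_iff)
      have "evr a' two_rho > 0" using simple_reflection_pos[OF s(1), of a] a False s(1) e by auto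
      then have p: "a' \<in> {a \<in> affine_roots. pos a}" using pos_iff_evr(1)[OF ra(4)] ra(4) by simp
      have "evr a' two_rho = evr a two_rho - of_int n * evr s two_rho"
        by (simp add: a'_def eq seq evr_def kf_simps algebra_simps)
      moreover have "evr s two_rho > 0" using pos_iff_evr(1)[OF simple_affine_root] simple_affine_pos s(1) by blast
      ultimately have "evr a' two_rho < evr a two_rho" using npos by simp
      from IH[OF p this] have "arefl a' \<in> alcove_group" .
      then have "arefl s \<circ> arefl a' \<circ> arefl s \<in> alcove_group"
        using alcove_group_refl[OF s(1)] alcove_group_comp by blast
      also have "arefl s \<circ> arefl a' \<circ> arefl s = arefl a \<circ> (arefl s \<circ> arefl s)"
        using ra(2) unfolding eq[symmetric] seq[symmetric] by (metis o_assoc)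
      also have "\<dots> = arefl a"
        unfolding arefl_involution[OF simple_affine_root[OF s(1)]] by (rule comp_id)
      finally show ?thesis .
    qed
  qed
  show ?thesis
  proof (cases "pos a")
    case True
    then show ?thesis using posc assms by simp
  next
    case False
    then have "arefl (neg a) \<in> alcove_group" using posc assms neg_affine_root pos_neg by simp
    then show ?thesis by (simp add: arefl_neg)
  qed
qed

lemma reflection_alcove_group: "\<phi> \<in> R \<Longrightarrow> reflection \<phi> n \<in> alcove_group"
  using arefl_alcove_group[of "(\<phi>, - n)"] by (simp add: arefl_def affine_roots_iff)

lemma translation_coroot:
  assumes "\<phi> \<in> R"
  shows "reflection \<phi> n \<circ> reflection \<phi> 0 = (\<lambda>v. of_int n *\<^sub>R coroot \<phi> + v)"
proof
  fix v
  have "killing \<phi> (coroot \<phi>) = 2" using killing_coroot[OF assms assms, of 2] by simp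
  then show "(reflection \<phi> n \<circ> reflection \<phi> 0) v = of_int n *\<^sub>R coroot \<phi> + v"
    by (simp add: reflection_def killing_diff_right killing_scale_right scaleR_scaleC
        cvec.scale_left_diff_distrib cvec.scale_minus_left algebra_simps)
qed

lemma affine_weyl_subset: "affine_weyl H P \<subseteq> alcove_group"
proof
  fix \<sigma> assume "\<sigma> \<in> affine_weyl H P"
  then obtain \<gamma> w where \<sigma>: "\<sigma> = (\<lambda>x. \<gamma> + w x)" "\<gamma> \<in> coroot_lattice P" "w \<in> weyl_group H"
    by (auto simp: affine_weyl_def)
  have "word_prod ws \<in> alcove_group" if "set ws \<subseteq> {reflection \<phi> 0 | \<phi>. \<phi> \<in> R}" for ws
    using that
  proof (induction ws)
    case Nil
    show ?case using alcove_group_id[unfolded id_def] by simp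
  next
    case (Cons r ws)
    have "r \<in> alcove_group" using Cons.prems reflection_alcove_group by auto
    moreover have "word_prod ws \<in> alcove_group" using Cons by simp
    ultimately show ?case unfolding word_prod_Cons by (rule alcove_group_comp)
  qed
  then have w: "w \<in> alcove_group" using \<sigma>(3) by (auto simp: weyl_group_def)
  obtain n :: "'g \<Rightarrow> int" where n: "\<gamma> = (\<Sum>\<alpha>\<in>P. real_of_int (n \<alpha>) *\<^sub>R coroot \<alpha>)"
    using \<sigma>(2) by (auto simp: coroot_lattice_def)
  have "(\<lambda>v. (\<Sum>\<alpha>\<in>Q. real_of_int (n \<alpha>) *\<^sub>R coroot \<alpha>) + v) \<in> alcove_group" if "finite Q" "Q \<subseteq> P" for Q
    using that
  proof (induction Q rule: finite_induct)
    case empty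
    show ?case using alcove_group_id by (simp add: id_def)
  next
    case (insert \<alpha> Q)
    have "(\<lambda>v. of_int (n \<alpha>) *\<^sub>R coroot \<alpha> + v) \<in> alcove_group"
      using insert.prems P_root reflection_alcove_group alcove_group_comp translation_coroot[of \<alpha> "n \<alpha>"]
      by (metis insert_subset)
    moreover have "(\<lambda>v. (\<Sum>\<alpha>\<in>Q. real_of_int (n \<alpha>) *\<^sub>R coroot \<alpha>) + v) \<in> alcove_group"
      using insert by simp
    ultimately have "(\<lambda>v. of_int (n \<alpha>) *\<^sub>R coroot \<alpha> + v) \<circ> (\<lambda>v. (\<Sum>\<alpha>\<in>Q. real_of_int (n \<alpha>) *\<^sub>R coroot \<alpha>) + v) \<in> alcove_group"
      by (rule alcove_group_comp)
    then show ?case using insert.hyps by (simp add: o_def add.assoc)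
  qed
  from this[OF finite_P order_refl] have "(\<lambda>v. \<gamma> + v) \<in> alcove_group" unfolding n .
  then have "(\<lambda>v. \<gamma> + v) \<circ> w \<in> alcove_group" using w by (rule alcove_group_comp)
  then show "\<sigma> \<in> alcove_group" unfolding \<sigma>(1) by (simp add: o_def)
qed

lemma coroot_lattice_combine:
  assumes "x \<in> coroot_lattice P" "y \<in> coroot_lattice P"
  shows "x + of_int k *\<^sub>R y \<in> coroot_lattice P"
proof -
  obtain n m :: "'g \<Rightarrow> int" where "x = (\<Sum>\<alpha>\<in>P. real_of_int (n \<alpha>) *\<^sub>R coroot \<alpha>)"
    "y = (\<Sum>\<alpha>\<in>P. real_of_int (m \<alpha>) *\<^sub>R coroot \<alpha>)" using assms by (auto simp: coroot_lattice_def)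
  then have "x + of_int k *\<^sub>R y = (\<Sum>\<alpha>\<in>P. real_of_int (n \<alpha> + k * m \<alpha>) *\<^sub>R coroot \<alpha>)"
    by (simp add: scaleR_left_distrib sum.distrib scaleR_sum_right)
  then show ?thesis unfolding coroot_lattice_def by (auto intro!: exI[of _ "\<lambda>\<alpha>. n \<alpha> + k * m \<alpha>"])
qed

lemma coroot_lattice_0: "0 \<in> coroot_lattice P"
  unfolding coroot_lattice_def by (auto intro!: exI[of _ "\<lambda>_. 0"])

lemma coroot_lattice_simple: "\<alpha> \<in> P \<Longrightarrow> coroot \<alpha> \<in> coroot_lattice P"
  unfolding coroot_lattice_def using finite_P
  by (auto intro!: exI[of _ "\<lambda>\<beta>. if \<beta> = \<alpha> then 1 else 0"] simp: if_distrib[of "\<lambda>c. real_of_int c *\<^sub>R _"] cong: if_cong)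

text \<open>Induction on the height: reflecting \<open>\<phi>\<close> in a simple \<open>\<alpha>\<close> changes its coroot by an
  integral multiple of that of \<open>\<alpha>\<close>.\<close>

lemma coroot_in_lattice:
  assumes "\<phi> \<in> Rp"
  shows "coroot \<phi> \<in> coroot_lattice P"
proof (rule finite_real_induct[of Rp "\<lambda>\<phi>. kf \<phi> two_rho" "\<lambda>\<phi>. coroot \<phi> \<in> coroot_lattice P"])
  show "finite {b\<in>Rp. kf b two_rho < kf a two_rho}" for a using finite_pos_roots by simp
  show "\<phi> \<in> Rp" by (rule assms)
  fix \<phi> assume \<phi>: "\<phi> \<in> Rp" and IH: "\<And>b. b \<in> Rp \<Longrightarrow> kf b two_rho < kf \<phi> two_rho \<Longrightarrow> coroot b \<in> coroot_lattice P"
  show "coroot \<phi> \<in> coroot_lattice P"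
  proof (cases "\<phi> \<in> P")
    case True
    then show ?thesis by (rule coroot_lattice_simple)
  next
    case False
    obtain \<alpha> where \<alpha>: "\<alpha> \<in> P" "kf \<alpha> \<phi> > 0" using nonsimple_pos_root[OF \<phi> False] by blast
    have R: "\<alpha> \<in> R" "\<phi> \<in> R" using P_root \<alpha> pos_rootsD \<phi> by auto
    have c: "kf \<alpha> \<alpha> > 0" "kf \<phi> \<phi> > 0" using kf_root_pos R by auto
    have "\<phi> \<noteq> \<alpha>" using False \<alpha> by auto
    then have s: "srefl \<alpha> \<phi> \<in> Rp" by (rule simple_reflection_permutes(1)[OF \<alpha>(1) \<phi>])
    have "kf (srefl \<alpha> \<phi>) two_rho < kf \<phi> two_rho"
      using \<alpha>(2) c kf_two_rho_simple[OF \<alpha>(1)] by (simp add: srefl_def kf_simps kf_sym[of \<phi> \<alpha>])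
    from IH[OF s this] have l: "coroot (srefl \<alpha> \<phi>) \<in> coroot_lattice P" .
    obtain m :: int where m: "2 * kf \<alpha> \<phi> = of_int m * kf \<phi> \<phi>" using cartan_integer[OF R(2,1)] by blast
    have "coroot (srefl \<alpha> \<phi>) = (2 / kf \<phi> \<phi>) *\<^sub>R srefl \<alpha> \<phi>" by (simp add: coroot_def kf_srefl(1)[OF R(1)])
    also have "\<dots> = coroot \<phi> - ((2 * kf \<alpha> \<phi> / kf \<phi> \<phi>) * (2 / kf \<alpha> \<alpha>)) *\<^sub>R \<alpha>"
      by (simp add: srefl_def coroot_def scaleR_right_diff_distrib kf_sym[of \<phi> \<alpha>] mult.commute)
    also have "(2 * kf \<alpha> \<phi> / kf \<phi> \<phi>) = of_int m" using m c by (simp add: field_simps)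
    finally have "coroot \<phi> = coroot (srefl \<alpha> \<phi>) + of_int m *\<^sub>R coroot \<alpha>" by (simp add: coroot_def)
    then show ?thesis using coroot_lattice_combine[OF l coroot_lattice_simple[OF \<alpha>(1)]] by simp
  qed
qed

lemma coroot_in_lattice_root:
  assumes "\<phi> \<in> R"
  shows "coroot \<phi> \<in> coroot_lattice P"
proof (cases "\<phi> \<in> Rp")
  case True
  then show ?thesis by (rule coroot_in_lattice)
next
  case False
  then have "coroot (- \<phi>) \<in> coroot_lattice P" using pos_or_neg[OF assms] coroot_in_lattice by blast
  from coroot_lattice_combine[OF coroot_lattice_0 this, of "-1"] show ?thesis by (simp add: coroot_uminus)
qed

lemma root_pairs_lattice_integrally:
  assumes "\<phi> \<in> R" "\<gamma> \<in> coroot_lattice P"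
  shows "\<exists>k::int. killing \<phi> \<gamma> = of_int k"
proof -
  obtain n :: "'g \<Rightarrow> int" where n: "\<gamma> = (\<Sum>\<alpha>\<in>P. real_of_int (n \<alpha>) *\<^sub>R coroot \<alpha>)"
    using assms(2) by (auto simp: coroot_lattice_def)
  have "\<forall>\<alpha>\<in>P. \<exists>k::int. killing \<phi> (coroot \<alpha>) = of_int k"
    using cartan_integer[OF P_root assms(1)] killing_coroot[OF P_root assms(1)] by blast
  from bchoice[OF this] obtain m :: "'g \<Rightarrow> int" where m: "\<forall>\<alpha>\<in>P. killing \<phi> (coroot \<alpha>) = of_int (m \<alpha>)" by blast
  have "killing \<phi> \<gamma> = of_int (\<Sum>\<alpha>\<in>P. n \<alpha> * m \<alpha>)"
    unfolding n killing_sum_right using m by (simp add: scaleR_scaleC killing_scale_right)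
  then show ?thesis ..
qed

lemma alcove_group_subset: "alcove_group \<subseteq> affine_weyl H P"
proof -
  have step: "arefl a \<circ> \<sigma> \<in> affine_weyl H P" if a: "a \<in> affine_roots" and s: "\<sigma> \<in> affine_weyl H P" for a \<sigma>
  proof -
    obtain \<gamma> w where \<sigma>: "\<sigma> = (\<lambda>x. \<gamma> + w x)" "\<gamma> \<in> coroot_lattice P" "w \<in> weyl_group H"
      using s by (auto simp: affine_weyl_def)
    have R: "fst a \<in> R" using a by (simp add: affine_roots_iff)
    obtain k :: int where k: "killing (fst a) \<gamma> = of_int k" using root_pairs_lattice_integrally[OF R \<sigma>(2)] by blast
    obtain ws where ws: "w = word_prod ws" "set ws \<subseteq> {reflection \<phi> 0 | \<phi>. \<phi> \<in> R}" using \<sigma>(3) by (auto simp: weyl_group_def)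
    have "reflection (fst a) 0 \<circ> w = word_prod (reflection (fst a) 0 # ws)" using ws by simp
    moreover have "set (reflection (fst a) 0 # ws) \<subseteq> {reflection \<phi> 0 | \<phi>. \<phi> \<in> R}" using ws(2) R by auto
    ultimately have w': "reflection (fst a) 0 \<circ> w \<in> weyl_group H" unfolding weyl_group_def by blast
    have \<gamma>': "\<gamma> + of_int (- snd a - k) *\<^sub>R coroot (fst a) \<in> coroot_lattice P"
      by (rule coroot_lattice_combine[OF \<sigma>(2) coroot_in_lattice_root[OF R]])
    have "arefl a \<circ> \<sigma> = (\<lambda>x. (\<gamma> + of_int (- snd a - k) *\<^sub>R coroot (fst a)) + (reflection (fst a) 0 \<circ> w) x)"
      unfolding \<sigma>(1)
      by (rule ext) (simp add: arefl_def reflection_def killing_add_right k scaleR_scaleC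
          cvec.scale_left_diff_distrib cvec.scale_left_distrib cvec.scale_minus_left algebra_simps)
    then show ?thesis using \<gamma>' w' unfolding affine_weyl_def by blast
  qed
  have "word_prod ws \<in> affine_weyl H P" if "set ws \<subseteq> simple_reflections H P" for ws
    using that
  proof (induction ws)
    case Nil
    have "id \<in> weyl_group H" unfolding weyl_group_def by (auto intro!: exI[of _ "[]"])
    then show ?case using coroot_lattice_0 unfolding affine_weyl_def
      by (auto intro!: exI[of _ 0] exI[of _ id] simp: id_def)
  next
    case (Cons r ws)
    then obtain s where "s \<in> simple_affine" "r = arefl s" by (auto simp: simple_reflections_eq)
    then have "arefl s \<circ> word_prod ws \<in> affine_weyl H P" using Cons step simple_affine_root by simp
    then show ?case by (simp add: o_def \<open>r = arefl s\<close>)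
  qed
  then show ?thesis by (auto simp: alcove_group_def)
qed

lemma affine_weyl_eq: "affine_weyl H P = alcove_group"
  using affine_weyl_subset alcove_group_subset by blast

lemma evr_fund_alcove:
  assumes "a \<in> affine_roots" "pos a" "u \<in> fund_alcove H P"
  shows "evr a u \<ge> 0"
proof -
  have u: "\<And>\<alpha>. \<alpha> \<in> P \<Longrightarrow> kf \<alpha> u \<ge> 0" "kf \<psi> u \<le> 1"
    using assms(3) by (auto simp: fund_alcove_def dominant_chamber_def)
  have "kf (fst a + of_int (snd a) *\<^sub>R \<psi>) u \<ge> 0" using pos_affine_N(1)[OF assms(1,2)] u(1) by (rule N_kf_nonneg)
  moreover have "of_int (snd a) * kf \<psi> u \<le> of_int (snd a) * 1"
    using u(2) pos_affine_N(2)[OF assms(1,2)] by (intro mult_left_mono) auto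
  ultimately show ?thesis by (simp add: evr_def kf_simps)
qed

lemma two_rho_fund_alcove: "two_rho \<in> fund_alcove H P"
  using two_rho_real_form pos_root_two_rho[OF P_pos] highest_root_two_rho kf_root_pos[OF highest_root(1)]
  by (auto simp: fund_alcove_def dominant_chamber_def less_imp_le)

lemma fund_alcove_real_form: "u \<in> fund_alcove H P \<Longrightarrow> u \<in> real_form H"
  by (simp add: fund_alcove_def dominant_chamber_def)

lemma evr_image_nonzero:
  assumes "\<sigma> \<in> alcove_group" "a \<in> affine_roots"
  shows "evr a (\<sigma> two_rho) \<noteq> 0"
proof -
  obtain a' where "a' \<in> affine_roots" "\<And>v. v \<in> real_form H \<Longrightarrow> evr a (\<sigma> v) = evr a' v"
    using compatible_pull[OF alcove_group_compatible[OF assms(1)] assms(2)] by metis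
  then show ?thesis using pos_iff_evr[of a'] two_rho_real_form by (cases "pos a'") auto
qed

lemma evr_image_alcove:
  assumes "\<sigma> \<in> alcove_group" "a \<in> affine_roots" "evr a (\<sigma> two_rho) > 0" "u \<in> fund_alcove H P"
  shows "evr a (\<sigma> u) \<ge> 0"
proof -
  obtain a' where a': "a' \<in> affine_roots" "\<And>v. v \<in> real_form H \<Longrightarrow> evr a (\<sigma> v) = evr a' v"
    using compatible_pull[OF alcove_group_compatible[OF assms(1)] assms(2)] by metis
  then have "pos a'" using pos_iff_evr(1) assms(3) two_rho_real_form by simp
  then show ?thesis using evr_fund_alcove[OF a'(1) _ assms(4)] a'(2)[OF fund_alcove_real_form[OF assms(4)]] by simp
qed

lemma Inv_not_mem:
  assumes "\<sigma> \<in> alcove_group" "a \<in> affine_roots" "pos a" "a \<notin> Inv \<sigma>"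
  shows "evr a (\<sigma> two_rho) > 0"
  using evr_image_nonzero[OF assms(1,2)] assms by (auto simp: Inv_def)

text \<open>Separating hyperplanes of level zero are those that bound the image away from the
  dominant chamber.\<close>

lemma affine_weyl_plus_iff:
  "\<sigma> \<in> affine_weyl_plus H P \<longleftrightarrow> \<sigma> \<in> alcove_group \<and> (\<forall>a\<in>Inv \<sigma>. snd a \<ge> 1)"
proof
  assume "\<sigma> \<in> affine_weyl_plus H P"
  then have \<sigma>: "\<sigma> \<in> alcove_group" "\<sigma> ` fund_alcove H P \<subseteq> dominant_chamber H P"
    by (auto simp: affine_weyl_plus_def affine_weyl_eq)
  then have dom: "\<sigma> two_rho \<in> dominant_chamber H P" using two_rho_fund_alcove by blast
  have "snd a \<ge> 1" if a: "a \<in> Inv \<sigma>" for a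
  proof (rule ccontr)
    assume "\<not> snd a \<ge> 1"
    then have a0: "snd a = 0" "fst a \<in> Rp" using a by (auto simp: Inv_def pos_def)
    have "kf (fst a) (\<sigma> two_rho) \<ge> 0"
      by (rule N_kf_nonneg[OF pos_rootsD(2)[OF a0(2)]]) (use dom in \<open>auto simp: dominant_chamber_def\<close>)
    then show False using a a0 by (simp add: Inv_def evr_def)
  qed
  then show "\<sigma> \<in> alcove_group \<and> (\<forall>a\<in>Inv \<sigma>. snd a \<ge> 1)" using \<sigma> by blast
next
  assume \<sigma>: "\<sigma> \<in> alcove_group \<and> (\<forall>a\<in>Inv \<sigma>. snd a \<ge> 1)"
  then have g: "\<sigma> \<in> alcove_group" ..
  have "\<sigma> u \<in> dominant_chamber H P" if u: "u \<in> fund_alcove H P" for u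
  proof -
    have "kf \<alpha> (\<sigma> u) \<ge> 0" if \<alpha>: "\<alpha> \<in> P" for \<alpha>
    proof -
      have a: "(\<alpha>, 0) \<in> affine_roots" "pos (\<alpha>, 0)" using \<alpha> P_root P_pos by (auto simp: affine_roots_iff pos_def)
      have "(\<alpha>, 0) \<notin> Inv \<sigma>" using \<sigma> by force
      then have "evr (\<alpha>, 0) (\<sigma> u) \<ge> 0" using evr_image_alcove[OF g a(1) Inv_not_mem[OF g a] u] by blast
      then show ?thesis by (simp add: evr_def)
    qed
    moreover have "\<sigma> u \<in> real_form H"
      using \<sigma> compatible_real_form[OF alcove_group_compatible fund_alcove_real_form[OF u]] by blast
    ultimately show ?thesis by (simp add: dominant_chamber_def)
  qed
  then show "\<sigma> \<in> affine_weyl_plus H P" using \<sigma> by (auto simp: affine_weyl_plus_def affine_weyl_eq)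
qed

text \<open>On the dominant chamber \<open>\<psi>\<close> has the largest value of all roots, so if a hyperplane of
  level two or more separates, then \<open>\<psi>\<close> exceeds two on the image of the alcove.\<close>

lemma affine_weyl_two_iff:
  "\<sigma> \<in> affine_weyl_two H P \<longleftrightarrow> \<sigma> \<in> alcove_group \<and> (\<forall>a\<in>Inv \<sigma>. snd a = 1)"
proof
  assume two: "\<sigma> \<in> affine_weyl_two H P"
  then have plus: "\<sigma> \<in> affine_weyl_plus H P" by (simp add: affine_weyl_two_def)
  then have \<sigma>: "\<sigma> \<in> alcove_group" "\<forall>a\<in>Inv \<sigma>. snd a \<ge> 1" by (auto simp: affine_weyl_plus_iff)
  have dom: "\<sigma> two_rho \<in> dominant_chamber H P"
    using plus two_rho_fund_alcove by (auto simp: affine_weyl_plus_def)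
  obtain u where u: "u \<in> fund_alcove H P" "\<sigma> two_rho = 2 *\<^sub>R u"
    using two two_rho_fund_alcove by (auto simp: affine_weyl_two_def)
  then have le2: "kf \<psi> (\<sigma> two_rho) \<le> 2" by (simp add: fund_alcove_def kf_simps)
  have "snd a = 1" if a: "a \<in> Inv \<sigma>" for a
  proof (rule ccontr)
    assume "snd a \<noteq> 1"
    then have "real_of_int (snd a) \<ge> 2" using \<sigma>(2) a by force
    then have gt: "kf (- fst a) (\<sigma> two_rho) > 2" using a by (simp add: Inv_def evr_def kf_simps)
    have "- fst a \<in> R" using a by (simp add: Inv_def affine_roots_iff root_uminus)
    then have "\<psi> - - fst a \<in> N" by (rule highest_root(2))
    then have "kf (\<psi> - - fst a) (\<sigma> two_rho) \<ge> 0"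
      by (rule N_kf_nonneg) (use dom in \<open>auto simp: dominant_chamber_def\<close>)
    then show False using gt le2 by (simp add: kf_simps)
  qed
  then show "\<sigma> \<in> alcove_group \<and> (\<forall>a\<in>Inv \<sigma>. snd a = 1)" using \<sigma> by blast
next
  assume \<sigma>: "\<sigma> \<in> alcove_group \<and> (\<forall>a\<in>Inv \<sigma>. snd a = 1)"
  then have g: "\<sigma> \<in> alcove_group" ..
  have plus: "\<sigma> \<in> affine_weyl_plus H P" unfolding affine_weyl_plus_iff using \<sigma> by force
  have "\<sigma> u \<in> (\<lambda>x. 2 *\<^sub>R x) ` fund_alcove H P" if u: "u \<in> fund_alcove H P" for u
  proof -
    have a: "(- \<psi>, 2) \<in> affine_roots" "pos (- \<psi>, 2)"
      using root_uminus[OF highest_root(1)] by (auto simp: affine_roots_iff pos_def)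
    have "(- \<psi>, 2) \<notin> Inv \<sigma>" using \<sigma> by force
    then have "evr (- \<psi>, 2) (\<sigma> u) \<ge> 0" using evr_image_alcove[OF g a(1) Inv_not_mem[OF g a] u] by blast
    then have le: "kf \<psi> (\<sigma> u) \<le> 2" by (simp add: evr_def kf_simps)
    have dom: "\<sigma> u \<in> dominant_chamber H P" using plus u by (auto simp: affine_weyl_plus_def)
    have "(1/2) *\<^sub>R \<sigma> u \<in> fund_alcove H P"
      using dom le by (auto simp: fund_alcove_def dominant_chamber_def kf_simps intro: real_form_scale)
    then show ?thesis by (intro image_eqI[of _ _ "(1/2) *\<^sub>R \<sigma> u"]) simp_all
  qed
  then show "\<sigma> \<in> affine_weyl_two H P" using plus by (auto simp: affine_weyl_two_def)
qed

lemma Cas_weight_of: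
  assumes "\<sigma> \<in> alcove_group"
  shows "Cas H P (weight_of H P \<sigma>) = (\<Sum>a\<in>Inv \<sigma>. of_int (snd a))"
proof -
  have rho: "rho H P = (1/2) *\<^sub>R two_rho" by (simp add: two_rho_def)
  have "Cas H P (weight_of H P \<sigma>) = (kf (\<sigma> two_rho) (\<sigma> two_rho) - kf two_rho two_rho) / 4"
    unfolding Cas_def weight_of_def two_rho_def[symmetric] by (simp add: rho kf_simps)
  also have "\<dots> = (\<Sum>a\<in>Inv \<sigma>. of_int (snd a))"
    unfolding image_two_rho(2)[OF assms] by (simp add: sum_distrib_left[symmetric])
  finally show ?thesis .
qed

lemma weight_of_eq:
  assumes "\<sigma> \<in> alcove_group"
  shows "weight_of H P \<sigma> = - (\<Sum>a\<in>Inv \<sigma>. fst a)"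
proof -
  have "weight_of H P \<sigma> = (1/2) *\<^sub>R \<sigma> two_rho - (1/2) *\<^sub>R two_rho"
    by (simp add: weight_of_def two_rho_def)
  also have "\<dots> = - (\<Sum>a\<in>Inv \<sigma>. fst a)"
    unfolding image_two_rho(1)[OF assms] by (simp add: scaleR_right_diff_distrib scaleR_sum_right)
  finally show ?thesis .
qed

lemma weight_of_inj:
  assumes "\<sigma> \<in> alcove_group" "\<tau> \<in> alcove_group" "weight_of H P \<sigma> = weight_of H P \<tau>"
  shows "\<sigma> = \<tau>"
proof (rule alcove_group_determined[OF assms(1,2)])
  show "\<sigma> two_rho = \<tau> two_rho" using assms(3) by (simp add: weight_of_def two_rho_def)
qed

text \<open>The difference of the two sides is the sum of \<open>k - 1\<close> over the separating hyperplanes,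
  \<open>k\<close> being their levels.\<close>

lemma Cas_length:
  assumes \<sigma>: "\<sigma> \<in> affine_weyl_plus H P"
  shows "Cas H P (weight_of H P \<sigma>) \<ge> real (coxeter_length H P \<sigma>)"
    and "Cas H P (weight_of H P \<sigma>) = real (coxeter_length H P \<sigma>) \<longleftrightarrow> \<sigma> \<in> affine_weyl_two H P"
proof -
  have g: "\<sigma> \<in> alcove_group" and lev: "\<And>a. a \<in> Inv \<sigma> \<Longrightarrow> snd a \<ge> 1" using \<sigma> by (auto simp: affine_weyl_plus_iff)
  have diff: "Cas H P (weight_of H P \<sigma>) - real (coxeter_length H P \<sigma>) = (\<Sum>a\<in>Inv \<sigma>. of_int (snd a - 1))"
    by (simp add: Cas_weight_of[OF g] coxeter_length_eq[OF g] sum_subtractf)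
  have nonneg: "(0::real) \<le> of_int (snd a - 1)" if "a \<in> Inv \<sigma>" for a using lev[OF that] by simp
  have "(\<Sum>a\<in>Inv \<sigma>. of_int (snd a - 1)) \<ge> (0::real)" using nonneg by (rule sum_nonneg)
  then show "Cas H P (weight_of H P \<sigma>) \<ge> real (coxeter_length H P \<sigma>)" using diff by simp
  have "Cas H P (weight_of H P \<sigma>) = real (coxeter_length H P \<sigma>) \<longleftrightarrow>
      (\<Sum>a\<in>Inv \<sigma>. of_int (snd a - 1) :: real) = 0" unfolding diff[symmetric] by simp
  also have "\<dots> \<longleftrightarrow> (\<forall>a\<in>Inv \<sigma>. of_int (snd a - 1) = (0::real))"
    by (rule sum_nonneg_eq_0_iff[OF finite_Inv nonneg])
  also have "\<dots> \<longleftrightarrow> \<sigma> \<in> affine_weyl_two H P" using g by (simp add: affine_weyl_two_iff)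
  finally show "Cas H P (weight_of H P \<sigma>) = real (coxeter_length H P \<sigma>) \<longleftrightarrow> \<sigma> \<in> affine_weyl_two H P" .
qed

end

section \<open>Abelian ideals of roots\<close>

context simple_system
begin

text \<open>These are the root sets of the abelian ideals of the Borel subalgebra.\<close>

definition abelian_root_ideal :: "'g set \<Rightarrow> bool" where
  "abelian_root_ideal \<Phi> \<longleftrightarrow> \<Phi> \<subseteq> Rp \<and>
    (\<forall>\<phi>\<in>\<Phi>. \<forall>\<beta>\<in>Rp. \<phi> + \<beta> \<in> R \<longrightarrow> \<phi> + \<beta> \<in> \<Phi>) \<and> (\<forall>\<phi>\<in>\<Phi>. \<forall>\<beta>\<in>\<Phi>. \<phi> + \<beta> \<notin> R)"

lemma image_dominant:
  assumes "\<sigma> \<in> alcove_group" "\<And>a. a \<in> Inv \<sigma> \<Longrightarrow> snd a \<ge> 1" "x \<in> N"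
  shows "kf x (\<sigma> two_rho) \<ge> 0"
proof -
  have "\<sigma> \<in> affine_weyl_plus H P" using assms by (simp add: affine_weyl_plus_iff)
  then have "\<sigma> two_rho \<in> dominant_chamber H P" using two_rho_fund_alcove by (auto simp: affine_weyl_plus_def)
  then show ?thesis using N_kf_nonneg[OF assms(3)] by (auto simp: dominant_chamber_def)
qed

text \<open>Take for \<open>\<Phi>\<close> the roots whose value at \<open>\<sigma>(2\<rho>)\<close> exceeds one. Adding a positive root does
  not decrease this value, since \<open>\<sigma>(2\<rho>)\<close> is dominant; and if the sum of two elements were a
  root, its value would exceed two, giving a separating hyperplane of level two.\<close>

lemma two_root_ideal:
  assumes "\<sigma> \<in> affine_weyl_two H P"
  obtains \<Phi> where "abelian_root_ideal \<Phi>" "Inv \<sigma> = (\<lambda>\<phi>. (- \<phi>, 1)) ` \<Phi>"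
proof -
  have g: "\<sigma> \<in> alcove_group" and lev: "\<And>a. a \<in> Inv \<sigma> \<Longrightarrow> snd a = 1" using assms by (auto simp: affine_weyl_two_iff)
  let ?y = "\<sigma> two_rho"
  have dom: "kf x ?y \<ge> 0" if "x \<in> N" for x using lev by (intro image_dominant[OF g _ that]) simp
  define \<Phi> where "\<Phi> = {\<phi>\<in>R. kf \<phi> ?y > 1}"
  have memI: "(- \<phi>, k) \<in> Inv \<sigma>" if "\<phi> \<in> R" "kf \<phi> ?y > of_int k" "k \<ge> 1" for \<phi> and k :: int
    using that by (simp add: Inv_def evr_def affine_roots_iff root_uminus pos_def kf_simps)
  have Inv: "Inv \<sigma> = (\<lambda>\<phi>. (- \<phi>, 1)) ` \<Phi>"
  proof
    show "(\<lambda>\<phi>. (- \<phi>, 1)) ` \<Phi> \<subseteq> Inv \<sigma>" using memI[of _ 1] by (auto simp: \<Phi>_def)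
    show "Inv \<sigma> \<subseteq> (\<lambda>\<phi>. (- \<phi>, 1)) ` \<Phi>"
    proof
      fix a assume a: "a \<in> Inv \<sigma>"
      then have "- fst a \<in> \<Phi>" using lev[OF a] by (simp add: \<Phi>_def Inv_def evr_def affine_roots_iff root_uminus kf_simps)
      moreover have "a = (- (- fst a), 1)" using lev[OF a] by (simp add: prod_eq_iff)
      ultimately show "a \<in> (\<lambda>\<phi>. (- \<phi>, 1)) ` \<Phi>" by blast
    qed
  qed
  have "\<phi> \<in> Rp" if "\<phi> \<in> \<Phi>" for \<phi>
  proof (rule ccontr)
    assume "\<phi> \<notin> Rp"
    then have "- \<phi> \<in> N" using pos_or_neg pos_rootsD(2) that by (auto simp: \<Phi>_def)
    then show False using dom[of "- \<phi>"] that by (simp add: \<Phi>_def kf_simps)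
  qed
  moreover have "\<phi> + \<beta> \<in> \<Phi>" if "\<phi> \<in> \<Phi>" "\<beta> \<in> Rp" "\<phi> + \<beta> \<in> R" for \<phi> \<beta>
    using that dom[OF pos_rootsD(2)[OF that(2)]] by (simp add: \<Phi>_def kf_simps)
  moreover have "\<phi> + \<beta> \<notin> R" if "\<phi> \<in> \<Phi>" "\<beta> \<in> \<Phi>" for \<phi> \<beta>
  proof
    assume "\<phi> + \<beta> \<in> R"
    then have "(- (\<phi> + \<beta>), 2) \<in> Inv \<sigma>" using that by (intro memI) (auto simp: \<Phi>_def kf_simps)
    then show False using lev by fastforce
  qed
  ultimately have "abelian_root_ideal \<Phi>" unfolding abelian_root_ideal_def by blast
  then show ?thesis using that Inv by blast
qed

lemma evr_image_pos_iff:
  assumes "\<sigma> \<in> alcove_group" "a \<in> affine_roots" "pos a"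
  shows "evr a (\<sigma> two_rho) > 0 \<longleftrightarrow> a \<notin> Inv \<sigma>"
  using Inv_not_mem[OF assms] assms by (auto simp: Inv_def)

text \<open>Let \<open>\<phi>\<close> be an element of \<open>\<Phi>\<close> whose hyperplane \<open>(\<phi>, x) = 1\<close> is the next to be crossed.
  Its affine root is indecomposable among those positive on the current alcove: the summand
  \<open>d\<close>, of level \<open>0\<close> or \<open>-1\<close>, has a positive root \<open>\<beta>\<close> as its linear part, and \<open>\<phi> + \<beta>\<close> is a
  root. Level \<open>0\<close> contradicts that \<open>\<phi> + \<beta>\<close> belongs to \<open>\<Phi>\<close>, and level \<open>-1\<close> contradicts that
  no two elements of \<open>\<Phi>\<close> add up to a root.\<close>

lemma no_decomposition:
  assumes \<sigma>: "\<sigma> \<in> alcove_group" and Inv: "Inv \<sigma> = (\<lambda>\<phi>. (- \<phi>, 1)) ` (\<Phi> - {\<phi>})"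
    and \<Phi>: "abelian_root_ideal \<Phi>" "\<phi> \<in> \<Phi>"
    and c: "c \<in> affine_roots" "evr c (\<sigma> two_rho) > 0" and d: "d \<in> affine_roots" "evr d (\<sigma> two_rho) > 0"
    and sum: "fst c + fst d = - \<phi>" "snd c + snd d = 1" and k: "snd c \<ge> 1"
  shows False
proof -
  let ?y = "\<sigma> two_rho"
  have R: "fst c \<in> R" "fst d \<in> R" using c d by (auto simp: affine_roots_iff)
  have \<phi>: "\<phi> \<in> Rp" using \<Phi> by (auto simp: abelian_root_ideal_def)
  have dom: "kf x ?y \<ge> 0" if "x \<in> N" for x using Inv by (intro image_dominant[OF \<sigma> _ that]) auto
  have d0: "snd d \<le> 0" using sum k by simp
  have dp: "kf (fst d) ?y > - of_int (snd d)" using d(2) by (simp add: evr_def)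
  have dRp: "fst d \<in> Rp"
  proof (rule ccontr)
    assume "fst d \<notin> Rp"
    then have "- fst d \<in> N" using pos_or_neg[OF R(2)] pos_rootsD by blast
    then have "kf (fst d) ?y \<le> 0" using dom by (force simp: kf_simps)
    then show False using dp d0 by simp
  qed
  have memI: "(- \<gamma>, k) \<in> Inv \<sigma>" if "\<gamma> \<in> R" "kf \<gamma> ?y > of_int k" "k \<ge> 1" for \<gamma> and k :: int
    using that by (simp add: Inv_def evr_def affine_roots_iff root_uminus pos_def kf_simps)
  have "snd d \<ge> -1"
  proof (rule ccontr)
    assume "\<not> snd d \<ge> -1"
    then have "(- fst d, 2) \<in> Inv \<sigma>" using dp R by (intro memI) auto
    then show False unfolding Inv by auto
  qed
  then consider "snd d = 0" | "snd d = -1" using d0 by linarith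
  then show False
  proof cases
    case 1
    have \<gamma>: "fst c = - (\<phi> + fst d)" using sum(1) by (metis add_diff_cancel_right' minus_add_distrib uminus_add_conv_diff add.commute)
    have "\<phi> + fst d = - fst c" unfolding \<gamma> by simp
    then have "\<phi> + fst d \<in> R" using root_uminus[OF R(1)] by simp
    then have "\<phi> + fst d \<in> \<Phi> - {\<phi>}" using \<Phi> dRp rootsD(2)[OF R(2)] by (auto simp: abelian_root_ideal_def)
    then have "(- (\<phi> + fst d), 1) \<in> Inv \<sigma>" unfolding Inv by blast
    moreover have "c = (- (\<phi> + fst d), 1)" using \<gamma> sum(2) 1 by (simp add: prod_eq_iff)
    ultimately show False using c by (simp add: Inv_def)
  next
    case 2
    then have "(- fst d, 1) \<in> Inv \<sigma>" using dp R by (intro memI) auto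
    then have "fst d \<in> \<Phi>" unfolding Inv by auto
    then have "\<phi> + fst d \<notin> R" using \<Phi> by (auto simp: abelian_root_ideal_def)
    moreover have "\<phi> + fst d = - fst c" using sum(1) by (metis add.commute add_diff_cancel_right' minus_diff_eq diff_minus_eq_add add_diff_cancel_left' minus_minus)
    ultimately show False using root_uminus[OF R(1)] by simp
  qed
qed

text \<open>The hyperplanes are crossed one at a time, in order of decreasing height of the
  elements of \<open>\<Phi>\<close>. The next one is a wall of the current alcove: otherwise a simple affine
  root could be split off from the pull-back of its affine root, leaving a positive affine
  root or a positive integer.\<close>

lemma root_ideal_alcove:
  assumes "abelian_root_ideal \<Phi>"
  shows "\<exists>\<sigma>\<in>alcove_group. Inv \<sigma> = (\<lambda>\<phi>. (- \<phi>, 1)) ` \<Phi>"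
  using assms
proof (induction "card \<Phi>" arbitrary: \<Phi>)
  case 0
  have "finite \<Phi>" using 0 finite_pos_roots by (meson abelian_root_ideal_def finite_subset)
  then have "\<Phi> = {}" using 0 by simp
  then show ?case using alcove_group_id Inv_id by blast
next
  case (Suc n)
  have sub: "\<Phi> \<subseteq> Rp" and up: "\<And>\<phi> \<beta>. \<phi> \<in> \<Phi> \<Longrightarrow> \<beta> \<in> Rp \<Longrightarrow> \<phi> + \<beta> \<in> R \<Longrightarrow> \<phi> + \<beta> \<in> \<Phi>"
    and ab: "\<And>\<phi> \<beta>. \<phi> \<in> \<Phi> \<Longrightarrow> \<beta> \<in> \<Phi> \<Longrightarrow> \<phi> + \<beta> \<notin> R"
    using Suc.prems by (auto simp: abelian_root_ideal_def)
  have fin: "finite \<Phi>" using sub finite_pos_roots by (rule finite_subset)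
  have "\<Phi> \<noteq> {}" using Suc.hyps(2) by auto
  then have "Min ((\<lambda>\<phi>. kf \<phi> two_rho) ` \<Phi>) \<in> (\<lambda>\<phi>. kf \<phi> two_rho) ` \<Phi>" using fin by (intro Min_in) auto
  then obtain \<phi> where \<phi>: "\<phi> \<in> \<Phi>" "kf \<phi> two_rho = Min ((\<lambda>\<phi>. kf \<phi> two_rho) ` \<Phi>)" by auto
  \<comment> \<open>Minimality of the height keeps \<open>\<Phi> - {\<phi>}\<close> closed under adding positive roots.\<close>
  have min: "kf \<phi> two_rho \<le> kf \<beta> two_rho" if "\<beta> \<in> \<Phi>" for \<beta>
    unfolding \<phi>(2) using fin that by (intro Min_le) auto
  have "\<beta> + \<gamma> \<noteq> \<phi>" if "\<beta> \<in> \<Phi>" "\<gamma> \<in> Rp" for \<beta> \<gamma>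
    using min[OF that(1)] pos_root_two_rho[OF that(2)] by (auto simp: kf_simps)
  then have "abelian_root_ideal (\<Phi> - {\<phi>})" using sub up ab by (auto simp: abelian_root_ideal_def)
  moreover have "n = card (\<Phi> - {\<phi>})" using Suc.hyps(2) \<phi>(1) fin by simp
  ultimately obtain \<sigma> where \<sigma>: "\<sigma> \<in> alcove_group" "Inv \<sigma> = (\<lambda>\<phi>. (- \<phi>, 1)) ` (\<Phi> - {\<phi>})"
    using Suc.hyps(1) by blast
  let ?y = "\<sigma> two_rho"
  define a where "a = (- \<phi>, 1 :: int)"
  have \<phi>R: "\<phi> \<in> R" "\<phi> \<in> N" using \<phi> sub pos_rootsD by auto
  have a: "a \<in> affine_roots" "pos a" by (simp_all add: a_def affine_roots_iff root_uminus \<phi>R pos_def)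
  have "a \<notin> Inv \<sigma>" using \<sigma>(2) by (auto simp: a_def)
  then have ay: "evr a ?y > 0" using evr_image_pos_iff[OF \<sigma>(1) a] by simp
  obtain b where b: "b \<in> affine_roots" "\<And>v. ev a (\<sigma> v) = ev b v" "\<And>v. v \<in> real_form H \<Longrightarrow> evr a (\<sigma> v) = evr b v"
    using compatible_pull[OF alcove_group_compatible[OF \<sigma>(1)] a(1)] by metis
  have pb: "pos b" using pos_iff_evr(1)[OF b(1)] ay b(3)[OF two_rho_real_form] by simp
  obtain \<tau> where \<tau>: "\<sigma> \<circ> \<tau> = id" using alcove_group_inverse[OF \<sigma>(1)] by metis
  have cancel: "a' = b'" if "\<And>v. ev a' (\<sigma> v) = ev b' (\<sigma> v)" for a' b'
  proof (rule ev_inj)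
    fix v
    show "ev a' v = ev b' v" using that[of "\<tau> v"] \<tau> by (metis comp_apply id_apply)
  qed
  have push: "\<exists>c\<in>affine_roots. (\<forall>v. ev c (\<sigma> v) = ev s v) \<and> evr c ?y = evr s two_rho" if sA: "s \<in> affine_roots" for s
  proof -
    obtain c where c: "c \<in> affine_roots" "\<And>v. ev c (\<sigma> v) = ev s v" using alcove_group_push[OF \<sigma>(1) sA] by metis
    have "(of_real (evr c ?y) :: complex) = of_real (evr s two_rho)"
      using c(2)[of two_rho] ev_real[OF sA two_rho_real_form]
        ev_real[OF c(1) compatible_real_form[OF alcove_group_compatible[OF \<sigma>(1)] two_rho_real_form]] by simp
    then show ?thesis using c by (auto simp only: of_real_eq_iff)
  qed
  have "b \<in> simple_affine"
  proof (rule ccontr)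
    assume nb: "b \<notin> simple_affine"
    obtain s where s: "s \<in> simple_affine" "kf (fst s) (fst b) > 0" using pos_affine_pairs_simple[OF b(1) pb] by blast
    note sR = simple_affine_root[OF s(1)]
    have R: "fst s \<in> R" "fst b \<in> R" using sR b(1) by (auto simp: affine_roots_iff)
    have spos: "evr s two_rho > 0" using pos_iff_evr(1)[OF sR] simple_affine_pos[OF s(1)] by simp
    have bpos: "evr b two_rho > 0" using pos_iff_evr(1)[OF b(1)] pb by simp
    obtain c where c: "c \<in> affine_roots" "\<And>v. ev c (\<sigma> v) = ev s v" "evr c ?y = evr s two_rho" using push[OF sR] by blast
    show False
    proof (cases "fst s = fst b")
      case True
      \<comment> \<open>If \<open>b - s\<close> is a constant \<open>j\<close>, it is a positive integer, and \<open>\<phi>\<close> would be negative at \<open>\<sigma>(2\<rho>)\<close>.\<close>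
      have slt: "evr s two_rho < 1"
        using s(1) evr_two_rho_bound P_root pos_root_two_rho[OF highest_root_pos]
        by (auto simp: simple_affine_def evr_def kf_simps) (metis abs_less_iff)
      define j where "j = snd b - snd s"
      have "evr b two_rho = evr s two_rho + of_int j" using True by (simp add: evr_def j_def)
      then have "real_of_int j > -1" using bpos slt by linarith
      then have "j \<ge> 0" by linarith
      moreover have "j \<noteq> 0"
      proof
        assume "j = 0"
        then have "b = s" using True by (simp add: j_def prod_eq_iff)
        then show False using nb s(1) by simp
      qed
      ultimately have j: "j \<ge> 1" by simp
      have "ev a (\<sigma> v) = ev (fst c, snd c + j) (\<sigma> v)" for v
        using b(2)[of v] c(2)[of v] True by (simp add: ev_def j_def algebra_simps)
      then have "a = (fst c, snd c + j)" by (rule cancel)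
      then have "fst c = - \<phi>" "snd c = 1 - j" by (auto simp: a_def)
      then have "evr c ?y = - kf \<phi> ?y + 1 - of_int j" by (simp add: evr_def kf_simps)
      then have "kf \<phi> ?y < 0" using c(3) spos j by linarith
      moreover have "kf \<phi> ?y \<ge> 0" using \<sigma>(2) by (intro image_dominant[OF \<sigma>(1) _ \<phi>R(2)]) auto
      ultimately show False by simp
    next
      case False
      define b' where "b' = (fst b - fst s, snd b - snd s)"
      \<comment> \<open>Otherwise \<open>b = s + b'\<close>, and this decomposition is pushed forward by \<open>\<sigma>\<close>.\<close>
      have b'R: "b' \<in> affine_roots" using root_diff[OF R] s(2) False by (simp add: b'_def affine_roots_iff kf_sym)
      obtain n :: int where n: "2 * kf (fst b) (fst s) = of_int n * kf (fst s) (fst s)" using cartan_integer[OF R] by blast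
      have "of_int n * kf (fst s) (fst s) > 0" using n s(2) by (simp add: kf_sym)
      then have npos: "n \<ge> 1" using kf_root_pos[OF R(1)] by (simp add: zero_less_mult_iff)
      have "evr b (arefl s two_rho) > 0" using simple_reflection_pos[OF s(1) b(1) pb] nb s(1) by auto
      moreover have "evr b (arefl s two_rho) = evr b two_rho - of_int n * evr s two_rho"
        using n kf_root_pos[OF R(1)]
        by (simp add: arefl_real[OF sR two_rho_real_form] evr_def[of b] kf_simps coroot_def field_simps)
      moreover have "of_int n * evr s two_rho \<ge> 1 * evr s two_rho" using npos spos by (intro mult_right_mono) auto
      ultimately have b'pos: "evr b' two_rho > 0" by (simp add: b'_def evr_def kf_simps)
      obtain d where d: "d \<in> affine_roots" "\<And>v. ev d (\<sigma> v) = ev b' v" "evr d ?y = evr b' two_rho" using push[OF b'R] by blast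
      have "ev a (\<sigma> v) = ev (fst c + fst d, snd c + snd d) (\<sigma> v)" for v
      proof -
        have "ev a (\<sigma> v) = ev s v + ev b' v" unfolding b(2) by (simp add: ev_def b'_def killing_diff_left)
        also have "\<dots> = ev (fst c + fst d, snd c + snd d) (\<sigma> v)"
          unfolding c(2)[symmetric] d(2)[symmetric] by (simp add: ev_def killing_add_left)
        finally show ?thesis .
      qed
      then have "a = (fst c + fst d, snd c + snd d)" by (rule cancel)
      then have sum: "fst c + fst d = - \<phi>" "snd c + snd d = 1" by (auto simp: a_def)
      have "snd c \<ge> 1 \<or> snd d \<ge> 1" using sum(2) by linarith
      then show False
      proof
        assume "snd c \<ge> 1"
        then show False using no_decomposition[OF \<sigma> Suc.prems \<phi>(1) c(1) _ d(1) _ sum] c(3) d(3) spos b'pos by simp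
      next
        assume "snd d \<ge> 1"
        then show False using no_decomposition[OF \<sigma> Suc.prems \<phi>(1) d(1) _ c(1)] sum c(3) d(3) spos b'pos by (simp add: add.commute)
      qed
    qed
  qed
  then have "Inv (\<sigma> \<circ> arefl b) = insert a (Inv \<sigma>)" using Inv_step(1)[OF \<sigma>(1) _ a(1) b(2) a(2)] by blast
  also have "\<dots> = (\<lambda>\<phi>. (- \<phi>, 1)) ` \<Phi>" using \<phi>(1) unfolding \<sigma>(2) a_def by auto
  finally show ?case using alcove_group_comp[OF \<sigma>(1) alcove_group_refl[OF \<open>b \<in> simple_affine\<close>]] by blast
qed

end

section \<open>Abelian ideals of the Borel subalgebra\<close>

locale simple_root_basis = simple_system H P + root_basis H B t
  for H P B :: "'g::complex_simple_lie_algebra set" and t :: "'g \<Rightarrow> 'g"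
begin

lemma root_vec_space: "\<phi> \<in> R \<Longrightarrow> root_vec \<phi> \<in> root_space H \<phi>"
  using B_root_space root_vec by metis

lemma root_space_multiple: "\<phi> \<in> R \<Longrightarrow> x \<in> root_space H \<phi> \<Longrightarrow> \<exists>c. x = c *\<^sub>C root_vec \<phi>"
  using root_space_1dim[OF _ root_vec_space B_nonzero[OF root_vec(1)]] by blast

lemma root_space_subset:
  assumes "\<phi> \<in> R" "cvec.subspace A" "x \<in> A" "x \<in> root_space H \<phi>" "x \<noteq> 0"
  shows "root_space H \<phi> \<subseteq> A"
  using root_space_1dim[OF assms(1,4,5)] cvec.subspace_scale[OF assms(2,3)] by blast

lemma borel_H: "h \<in> H \<Longrightarrow> h \<in> borel_subalgebra H P"
  and borel_root: "\<phi> \<in> Rp \<Longrightarrow> x \<in> root_space H \<phi> \<Longrightarrow> x \<in> borel_subalgebra H P"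
  unfolding borel_subalgebra_def by (auto intro: cvec.span_base)

lemma borel_coord:
  assumes "x \<in> borel_subalgebra H P" "coord x b \<noteq> 0"
  shows "t b \<in> insert 0 Rp"
proof (rule ccontr)
  assume nb: "t b \<notin> insert 0 Rp"
  have b: "b \<in> B" using assms(2) cvec.representation_ne_zero by blast
  have "coord x b = 0"
    using assms(1) unfolding borel_subalgebra_def
  proof (induction rule: cvec.span_induct_alt)
    case (step c y z)
    have "coord y b = 0"
    proof (rule ccontr)
      assume nz: "coord y b \<noteq> 0"
      have "\<exists>\<gamma>\<in>insert 0 Rp. y \<in> root_space H \<gamma>" using step(1) by (auto simp: root_space_0)
      then obtain \<gamma> where \<gamma>: "\<gamma> \<in> insert 0 Rp" "y \<in> root_space H \<gamma>" by blast
      have "\<gamma> \<in> H" using \<gamma> pos_rootsD(1) rootsD(1) H_0 by auto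
      have "killing (t b) h = killing \<gamma> h" if "h \<in> H" for h
        using component_weight[OF _ nz that, of "killing \<gamma>"] \<gamma> by (simp add: root_space_eq)
      then have "t b = \<gamma>" using \<open>\<gamma> \<in> H\<close> t_H[OF b] by (intro H_eqI) auto
      then show False using \<gamma> nb by simp
    qed
    then show ?case using step by (simp add: coord_add coord_scale)
  qed (simp add: cvec.representation_zero)
  then show False using assms(2) by simp
qed

text \<open>An element \<open>h\<close> of \<open>A\<close> in \<open>H\<close> satisfies \<open>[h, [h, e]] = 0\<close> for every positive root
  vector \<open>e\<close>, because \<open>[h, e]\<close> lies in the abelian ideal \<open>A\<close>; so all roots vanish on \<open>h\<close>,
  and \<open>h = 0\<close>. As \<open>A\<close> contains the weight components of its elements, it is a sum of root
  spaces. Its roots form an ideal since brackets of root vectors are nonzero whenever the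
  sum of the roots is a root.\<close>

lemma abelian_ideal_structure:
  assumes A: "A \<in> abelian_ideals H P"
  shows "A = cvec.span (root_vec ` ideal_roots H P A)" and "abelian_root_ideal (ideal_roots H P A)"
proof -
  let ?\<Phi> = "ideal_roots H P A"
  have sub: "cvec.subspace A" and ab: "\<And>x y. x \<in> A \<Longrightarrow> y \<in> A \<Longrightarrow> lie x y = 0"
    and Ab: "A \<subseteq> borel_subalgebra H P" and ideal: "\<And>x y. x \<in> borel_subalgebra H P \<Longrightarrow> y \<in> A \<Longrightarrow> lie x y \<in> A"
    using A by (auto simp: abelian_ideals_def abelian_subalgebra_def)
  have AH: "h = 0" if h: "h \<in> A" "h \<in> H" for h
  proof -
    have pos: "killing \<phi> h = 0" if \<phi>: "\<phi> \<in> Rp" for \<phi>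
    proof -
      let ?e = "root_vec \<phi>"
      have e: "?e \<in> root_space H \<phi>" "?e \<noteq> 0" using root_vec_space B_nonzero root_vec(1) pos_rootsD(1)[OF \<phi>] by auto
      have he: "lie h ?e = killing \<phi> h *\<^sub>C ?e" using e h by (simp add: root_space_def)
      have "- lie ?e h \<in> A" using ideal[OF borel_root[OF \<phi> e(1)] h(1)] sub by (simp add: cvec.subspace_neg)
      then have "lie h ?e \<in> A" by (simp add: lie_antisym[of h])
      then have "lie h (lie h ?e) = 0" using ab h by blast
      then have "(killing \<phi> h * killing \<phi> h) *\<^sub>C ?e = 0" by (simp add: he lie_scaleC_right)
      then show ?thesis using e by simp
    qed
    show ?thesis
    proof (rule H_weights_zero[OF h(2)])
      fix b assume b: "b \<in> B"
      show "killing (t b) h = 0"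
        using t_root[OF b] pos_or_neg pos[of "t b"] pos[of "- t b"] by (auto simp: killing_minus_left)
    qed
  qed
  have comp: "t b \<in> ?\<Phi>" if x: "x \<in> A" and nz: "coord x b \<noteq> 0" for x b
  proof -
    have b: "b \<in> B" using nz cvec.representation_ne_zero by blast
    define v where "v \<gamma> = (\<Sum>c\<in>{c\<in>B. t c = \<gamma>}. coord x c *\<^sub>C c)" for \<gamma>
    have x_sum: "x = (\<Sum>\<gamma>\<in>t ` B. v \<gamma>)"
      using sum.image_gen[OF finite_B, of "\<lambda>c. coord x c *\<^sub>C c" t] by (simp add: v_def expand)
    have v_space: "v \<gamma> \<in> root_space H \<gamma>" for \<gamma>
      unfolding v_def using B_root_space
      by (intro cvec.subspace_sum[OF subspace_root_space] cvec.subspace_scale[OF subspace_root_space]) auto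
    have vA: "v (t b) \<in> A"
    proof (rule invariant_subspace_contains_components[where v = v and i = "t b" and I = "t ` B" and K = H and l = killing])
      show "finite (t ` B)" "t b \<in> t ` B" "cvec.subspace A" using finite_B b sub by auto
      show "lie h z \<in> A" if "h \<in> H" "z \<in> A" for h z using ideal[OF borel_H[OF that(1)] that(2)] .
      show "lie h (v \<gamma>) = killing \<gamma> h *\<^sub>C v \<gamma>" if "\<gamma> \<in> t ` B" "h \<in> H" for \<gamma> h
        using v_space[of \<gamma>] that(2) by (simp add: root_space_def)
      show "\<exists>h\<in>H. killing \<gamma> h \<noteq> killing \<delta> h" if "\<gamma> \<in> t ` B" "\<delta> \<in> t ` B" "\<gamma> \<noteq> \<delta>" for \<gamma> \<delta>
        using H_eqI[of \<gamma> \<delta>] that t_H by blast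
      show "(\<Sum>\<gamma>\<in>t ` B. v \<gamma>) \<in> A" using x x_sum by simp
    qed
    have "coord (v (t b)) b = (\<Sum>c\<in>{c\<in>B. t c = t b}. coord (coord x c *\<^sub>C c) b)"
      unfolding v_def by (subst cvec.representation_sum[OF independent_B]) (simp_all add: span_B)
    also have "\<dots> = (\<Sum>c\<in>{c\<in>B. t c = t b}. if c = b then coord x b else 0)"
      by (rule sum.cong) (auto simp: coord_scale coord_basis)
    also have "\<dots> = coord x b" using b finite_B by simp
    finally have vnz: "v (t b) \<noteq> 0" using nz by (auto simp: cvec.representation_zero)
    have "t b \<noteq> 0" using AH[OF vA] vnz v_space[of "t b"] by (auto simp: root_space_0)
    then have pos: "t b \<in> Rp" using borel_coord[of x b] x Ab nz by auto
    then show ?thesis using root_space_subset[OF _ sub vA v_space vnz] pos_rootsD by (simp add: ideal_roots_def)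
  qed
  have \<Phi>R: "?\<Phi> \<subseteq> Rp" by (auto simp: ideal_roots_def)
  have rvA: "root_vec \<phi> \<in> A" if "\<phi> \<in> ?\<Phi>" for \<phi>
    using that root_vec_space pos_rootsD(1) by (auto simp: ideal_roots_def)
  show "A = cvec.span (root_vec ` ?\<Phi>)"
  proof
    show "cvec.span (root_vec ` ?\<Phi>) \<subseteq> A" by (rule cvec.span_minimal[OF _ sub]) (use rvA in auto)
    show "A \<subseteq> cvec.span (root_vec ` ?\<Phi>)"
    proof
      fix x assume x: "x \<in> A"
      have "coord x b *\<^sub>C b \<in> cvec.span (root_vec ` ?\<Phi>)" if b: "b \<in> B" for b
      proof (cases "coord x b = 0")
        case True
        then show ?thesis by (simp add: cvec.span_zero)
      next
        case False
        then have "t b \<in> ?\<Phi>" by (rule comp[OF x])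
        moreover have "root_vec (t b) = b" using root_vec_t[OF b] calculation \<Phi>R pos_rootsD(1) by blast
        ultimately have "b \<in> root_vec ` ?\<Phi>" by force
        then show ?thesis by (intro cvec.span_scale cvec.span_base)
      qed
      then have "(\<Sum>b\<in>B. coord x b *\<^sub>C b) \<in> cvec.span (root_vec ` ?\<Phi>)" by (rule cvec.span_sum)
      then show "x \<in> cvec.span (root_vec ` ?\<Phi>)" by (simp add: expand)
    qed
  qed
  have nz: "lie (root_vec \<beta>) (root_vec \<phi>) \<noteq> 0" if "\<beta> \<in> R" "\<phi> \<in> R" "\<beta> + \<phi> \<in> R" for \<beta> \<phi>
    using lie_root_vectors_nonzero[OF that] root_vec_space B_nonzero root_vec(1) that by blast
  have "\<phi> + \<beta> \<in> ?\<Phi>" if that: "\<phi> \<in> ?\<Phi>" "\<beta> \<in> Rp" "\<phi> + \<beta> \<in> R" for \<phi> \<beta>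
  proof -
    have R: "\<phi> \<in> R" "\<beta> \<in> R" "\<beta> + \<phi> \<in> R" using that \<Phi>R pos_rootsD(1) by (auto simp: add.commute)
    have "lie (root_vec \<beta>) (root_vec \<phi>) \<in> A"
      by (rule ideal[OF borel_root[OF that(2) root_vec_space[OF R(2)]] rvA[OF that(1)]])
    moreover have "lie (root_vec \<beta>) (root_vec \<phi>) \<in> root_space H (\<beta> + \<phi>)"
      using lie_root_space root_vec_space R by blast
    ultimately have "root_space H (\<beta> + \<phi>) \<subseteq> A" using root_space_subset[OF R(3) sub] nz[OF R(2,1,3)] by blast
    moreover have "\<beta> + \<phi> \<in> Rp" using R(3) N_add pos_rootsD(2) that \<Phi>R by (auto simp: pos_roots_def)
    ultimately show ?thesis by (simp add: ideal_roots_def add.commute)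
  qed
  moreover have "\<phi> + \<beta> \<notin> R" if "\<phi> \<in> ?\<Phi>" "\<beta> \<in> ?\<Phi>" for \<phi> \<beta>
    using nz[of \<phi> \<beta>] ab[OF rvA[OF that(1)] rvA[OF that(2)]] that \<Phi>R pos_rootsD(1) by blast
  ultimately show "abelian_root_ideal ?\<Phi>" using \<Phi>R unfolding abelian_root_ideal_def by blast
qed

lemma lie_spans:
  assumes W: "cvec.subspace W" and gen: "\<And>a b. a \<in> S \<Longrightarrow> b \<in> T \<Longrightarrow> lie a b \<in> W"
    and x: "x \<in> cvec.span S" and y: "y \<in> cvec.span T"
  shows "lie x y \<in> (W :: 'g set)"
proof -
  have ay: "lie a y \<in> W" if "a \<in> S" for a
    using y
  proof (induction rule: cvec.span_induct_alt)
    case (step c b z)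
    then show ?case using gen[OF that step(1)] W
      by (simp add: lie_add_right lie_scaleC_right cvec.subspace_add cvec.subspace_scale)
  qed (simp add: cvec.subspace_0[OF W])
  show ?thesis
    using x
  proof (induction rule: cvec.span_induct_alt)
    case (step c a z)
    then show ?case using W ay
      by (simp add: lie_add_left lie_scaleC_left cvec.subspace_add cvec.subspace_scale)
  qed (simp add: cvec.subspace_0[OF W])
qed

lemma abelian_ideal_of_root_ideal:
  assumes \<Phi>: "abelian_root_ideal \<Phi>"
  defines "A \<equiv> cvec.span (root_vec ` \<Phi>)"
  shows "A \<in> abelian_ideals H P" "ideal_roots H P A = \<Phi>"
proof -
  have sub: "\<Phi> \<subseteq> Rp" and up: "\<And>\<phi> \<beta>. \<phi> \<in> \<Phi> \<Longrightarrow> \<beta> \<in> Rp \<Longrightarrow> \<phi> + \<beta> \<in> R \<Longrightarrow> \<phi> + \<beta> \<in> \<Phi>"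
    and ab: "\<And>\<phi> \<beta>. \<phi> \<in> \<Phi> \<Longrightarrow> \<beta> \<in> \<Phi> \<Longrightarrow> \<phi> + \<beta> \<notin> R"
    using \<Phi> by (auto simp: abelian_root_ideal_def)
  have R: "\<phi> \<in> R" if "\<phi> \<in> \<Phi>" for \<phi> using sub that pos_rootsD by blast
  have sum0: "\<phi> + \<beta> \<noteq> 0" if "\<phi> \<in> Rp" "\<beta> \<in> Rp" for \<phi> \<beta>
    using not_pos_and_neg[OF that(1)] that(2) by (metis add_eq_0_iff)
  have zero: "lie x y = 0" if "x \<in> root_space H \<phi>" "y \<in> root_space H \<beta>" "\<phi> \<in> Rp" "\<beta> \<in> Rp" "\<phi> + \<beta> \<notin> R" for x y \<phi> \<beta>
    using nonroot_space_zero[OF lie_root_space[OF that(1,2)] _ sum0[OF that(3,4)] that(5)]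
      H_add rootsD(1) pos_rootsD(1) that by blast
  have subA: "cvec.subspace A" by (simp add: A_def)
  have "lie x y \<in> {0}" if "x \<in> A" "y \<in> A" for x y
    using _ _ that[unfolded A_def]
  proof (rule lie_spans)
    show "cvec.subspace {0::'g}" by (rule cvec.subspace_single_0)
    show "lie a b \<in> {0}" if gen: "a \<in> root_vec ` \<Phi>" "b \<in> root_vec ` \<Phi>" for a b
    proof -
      obtain \<phi> \<beta> where "a = root_vec \<phi>" "b = root_vec \<beta>" "\<phi> \<in> \<Phi>" "\<beta> \<in> \<Phi>" using gen by blast
      then show ?thesis using zero[of a \<phi> b \<beta>] root_vec_space R ab subsetD[OF sub] by auto
    qed
  qed
  then have "abelian_subalgebra A" using subA by (simp add: abelian_subalgebra_def)
  moreover have "A \<subseteq> borel_subalgebra H P"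
    unfolding A_def
  proof (rule cvec.span_minimal)
    show "root_vec ` \<Phi> \<subseteq> borel_subalgebra H P" using borel_root root_vec_space R sub by blast
    show "cvec.subspace (borel_subalgebra H P)" by (simp add: borel_subalgebra_def)
  qed
  moreover have "lie x y \<in> A" if "x \<in> borel_subalgebra H P" "y \<in> A" for x y
    using subA _ that[unfolded A_def borel_subalgebra_def]
  proof (rule lie_spans)
    fix a b assume a: "a \<in> H \<union> (\<Union>\<phi>\<in>Rp. root_space H \<phi>)" and "b \<in> root_vec ` \<Phi>"
    then obtain \<phi> where \<phi>: "b = root_vec \<phi>" "\<phi> \<in> \<Phi>" by blast
    have bA: "b \<in> A" using \<phi> by (auto simp: A_def intro: cvec.span_base)
    have bs: "b \<in> root_space H \<phi>" using \<phi> root_vec_space R by blast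
    show "lie a b \<in> A"
    proof (cases "a \<in> H")
      case True
      then show ?thesis using bs bA subA by (simp add: root_space_def cvec.subspace_scale)
    next
      case False
      then obtain \<beta> where \<beta>: "\<beta> \<in> Rp" "a \<in> root_space H \<beta>" using a by blast
      show ?thesis
      proof (cases "\<phi> + \<beta> \<in> R")
        case True
        then have m: "\<phi> + \<beta> \<in> \<Phi>" using up \<phi> \<beta> by blast
        have "lie a b \<in> root_space H (\<phi> + \<beta>)" using lie_root_space[OF \<beta>(2) bs] by (simp add: add.commute)
        then obtain c where "lie a b = c *\<^sub>C root_vec (\<phi> + \<beta>)" using root_space_multiple[OF True] by blast
        moreover have "root_vec (\<phi> + \<beta>) \<in> A" using m by (auto simp: A_def intro: cvec.span_base)
        ultimately show ?thesis using subA by (simp add: cvec.subspace_scale)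
      next
        case False
        then have "lie a b = 0" using zero[OF \<beta>(2) bs \<beta>(1)] \<phi> sub by (auto simp: add.commute)
        then show ?thesis using subA by (simp add: cvec.subspace_0)
      qed
    qed
  qed
  ultimately show "A \<in> abelian_ideals H P" by (simp add: abelian_ideals_def)
  show "ideal_roots H P A = \<Phi>"
  proof
    show "\<Phi> \<subseteq> ideal_roots H P A"
    proof
      fix \<phi> assume \<phi>: "\<phi> \<in> \<Phi>"
      have "root_vec \<phi> \<in> A" using \<phi> by (auto simp: A_def intro: cvec.span_base)
      then have "root_space H \<phi> \<subseteq> A"
        using root_space_subset[OF R[OF \<phi>] subA _ root_vec_space[OF R[OF \<phi>]]] B_nonzero root_vec(1) R[OF \<phi>] by blast
      then show "\<phi> \<in> ideal_roots H P A" using \<phi> sub by (auto simp: ideal_roots_def)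
    qed
    show "ideal_roots H P A \<subseteq> \<Phi>"
    proof
      fix \<phi> assume "\<phi> \<in> ideal_roots H P A"
      then have \<phi>: "\<phi> \<in> R" "root_vec \<phi> \<in> A" using root_vec_space pos_rootsD(1) by (auto simp: ideal_roots_def)
      show "\<phi> \<in> \<Phi>"
      proof (rule ccontr)
        assume "\<phi> \<notin> \<Phi>"
        then have "root_vec ` \<Phi> \<subseteq> B - {root_vec \<phi>}"
          using inj_onD[OF inj_root_vec] R \<phi>(1) root_vec(1) by blast
        then have "root_vec \<phi> \<in> cvec.span (B - {root_vec \<phi>})" using \<phi>(2) cvec.span_mono unfolding A_def by blast
        then show False using independent_B root_vec(1)[OF \<phi>(1)] unfolding cvec.dependent_def by blast
      qed
    qed
  qed
qed

lemma dim_abelian_ideal: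
  assumes "A \<in> abelian_ideals H P"
  shows "cvec.dim A = card (ideal_roots H P A)"
proof -
  have sub: "ideal_roots H P A \<subseteq> R" using pos_rootsD by (auto simp: ideal_roots_def)
  have ind: "cvec.independent (root_vec ` ideal_roots H P A)"
    by (rule cvec.independent_mono[OF independent_B]) (use sub root_vec(1) in auto)
  have "cvec.dim A = card (root_vec ` ideal_roots H P A)"
    by (subst abelian_ideal_structure(1)[OF assms]) (rule cvec.dim_span_eq_card_independent[OF ind])
  also have "\<dots> = card (ideal_roots H P A)" by (rule card_image[OF inj_on_subset[OF inj_root_vec sub]])
  finally show ?thesis .
qed

end

context simple_system
begin

lemma weight_of_root_ideal:
  assumes "\<sigma> \<in> alcove_group" "Inv \<sigma> = (\<lambda>\<phi>. (- \<phi>, 1)) ` \<Phi>"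
  shows "weight_of H P \<sigma> = (\<Sum>\<phi>\<in>\<Phi>. \<phi>)" "coxeter_length H P \<sigma> = card \<Phi>"
proof -
  have inj: "inj_on (\<lambda>\<phi>. (- \<phi>, 1::int)) \<Phi>" by (rule inj_onI) simp
  show "weight_of H P \<sigma> = (\<Sum>\<phi>\<in>\<Phi>. \<phi>)"
    unfolding weight_of_eq[OF assms(1)] assms(2) sum.reindex[OF inj] by (simp add: sum_negf)
  show "coxeter_length H P \<sigma> = card \<Phi>"
    unfolding coxeter_length_eq[OF assms(1)] assms(2) by (rule card_image[OF inj])
qed

lemma ideal_elt_eq:
  assumes "\<sigma> \<in> affine_weyl_plus H P" "ideal_weight H P A = weight_of H P \<sigma>"
  shows "ideal_elt H P A = \<sigma>"
  unfolding ideal_elt_def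
proof (rule the_equality)
  show "\<sigma> \<in> affine_weyl_plus H P \<and> ideal_weight H P A = weight_of H P \<sigma>" using assms by blast
  fix \<tau> assume "\<tau> \<in> affine_weyl_plus H P \<and> ideal_weight H P A = weight_of H P \<tau>"
  then show "\<tau> = \<sigma>" using assms weight_of_inj[of \<tau> \<sigma>] by (auto simp: affine_weyl_plus_iff)
qed

text \<open>For the second claim, every abelian ideal has to be matched with an alcove, lest the
  description that defines \<open>ideal_elt\<close> fail to denote and have an arbitrary value.\<close>

lemma two_abelian_ideal:
  assumes \<sigma>: "\<sigma> \<in> affine_weyl_two H P"
  shows "\<exists>A\<in>abelian_ideals H P. \<sigma> = ideal_elt H P A"
    and "A \<in> abelian_ideals H P \<Longrightarrow> \<sigma> = ideal_elt H P A \<Longrightarrow> coxeter_length H P \<sigma> = cvec.dim A"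
proof -
  obtain B t where "root_basis H B t" using root_basis_ex by blast
  then interpret root_basis H B t .
  interpret simple_root_basis H P B t ..
  have plus: "\<sigma> \<in> affine_weyl_plus H P" using \<sigma> by (simp add: affine_weyl_two_def)
  then have g: "\<sigma> \<in> alcove_group" by (simp add: affine_weyl_plus_iff)
  obtain \<Phi> where \<Phi>: "abelian_root_ideal \<Phi>" "Inv \<sigma> = (\<lambda>\<phi>. (- \<phi>, 1)) ` \<Phi>" using two_root_ideal[OF \<sigma>] .
  have "ideal_weight H P (cvec.span (root_vec ` \<Phi>)) = weight_of H P \<sigma>"
    unfolding ideal_weight_def abelian_ideal_of_root_ideal(2)[OF \<Phi>(1)] weight_of_root_ideal(1)[OF g \<Phi>(2)] ..
  then show "\<exists>A\<in>abelian_ideals H P. \<sigma> = ideal_elt H P A"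
    using abelian_ideal_of_root_ideal(1)[OF \<Phi>(1)] ideal_elt_eq[OF plus] by metis
  assume A: "A \<in> abelian_ideals H P" "\<sigma> = ideal_elt H P A"
  obtain \<tau> where \<tau>: "\<tau> \<in> alcove_group" "Inv \<tau> = (\<lambda>\<phi>. (- \<phi>, 1)) ` ideal_roots H P A"
    using root_ideal_alcove[OF abelian_ideal_structure(2)[OF A(1)]] by blast
  have "\<tau> \<in> affine_weyl_plus H P" using \<tau> by (auto simp: affine_weyl_plus_iff)
  moreover have "ideal_weight H P A = weight_of H P \<tau>"
    unfolding ideal_weight_def weight_of_root_ideal(1)[OF \<tau>] ..
  ultimately have "\<sigma> = \<tau>" using ideal_elt_eq A(2) by simp
  then show "coxeter_length H P \<sigma> = cvec.dim A"
    using weight_of_root_ideal(2)[OF \<tau>] dim_abelian_ideal[OF A(1)] by simp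
qed

end

theorem theorem0p8:
  fixes H P :: "'g::complex_simple_lie_algebra set" and \<sigma> :: "'g \<Rightarrow> 'g"
  assumes "cartan_subalgebra H"
    and "simple_roots H P"
    and "\<sigma> \<in> affine_weyl_plus H P"
  shows "Cas H P (weight_of H P \<sigma>) \<ge> real (coxeter_length H P \<sigma>)
    \<and> (Cas H P (weight_of H P \<sigma>) = real (coxeter_length H P \<sigma>)
         \<longleftrightarrow> \<sigma> \<in> affine_weyl_two H P)
    \<and> (\<sigma> \<in> affine_weyl_two H P \<longrightarrow>
         (\<exists>A\<in>abelian_ideals H P. \<sigma> = ideal_elt H P A) \<and>
         (\<forall>A\<in>abelian_ideals H P. \<sigma> = ideal_elt H P A \<longrightarrow>
            Cas H P (weight_of H P \<sigma>) = real (coxeter_length H P \<sigma>) \<and>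
            coxeter_length H P \<sigma> = cvec.dim A))"
proof -
  interpret simple_system H P by unfold_locales (fact assms)+
  show ?thesis using Cas_length[OF assms(3)] two_abelian_ideal[of \<sigma>] by blast
qed

end
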